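(* Let $p\in(0,1)$ be fixed, and let $d=d(n)$ (positive integers) and $q=q(n)\in[0,1]$ be sequences indexed by $n$. All limits are as $n\to\infty$. (a) (Impossibility) If $nq\to 0$ or $n^3q^2/d\to 0$, then $\mathrm{TV}(\mathcal{G}(n,p),\dot{\mathcal{G}}(n,p,d,q))\to 0$. (b) (Possibility) If $n^3q^6/d\to\infty$, then $\mathrm{TV}(\mathcal{G}(n,p),\dot{\mathcal{G}}(n,p,d,q))\to 1$.
   Context: $\mathcal{G}(n,p)$ denotes the Erdős–Rényi random graph on vertex set $[n]=\{1,\dots,n\}$ in which each pair is an edge independently with probability $p$. $\dot{\mathcal{G}}(n,p,d,q)$ denotes the following random graph on $[n]$: let $\mathbf{x}_1,\dots,\mathbf{x}_n$ be i.i.d. standard normal vectors in $\mathbb{R}^d$, and let $u_{p,d}$ be the threshold determined by $\mathbb{P}(\langle\mathbf{x}_i,\mathbf{x}_j\rangle\ge u_{p,d})=p$ for $i\ne j$. Conditionally on $\mathbf{x}_1,\dots,\mathbf{x}_n$, the pairs $\{i,j\}$, $i\neq j$, are edges independently with probability $\phi_q(\langle\mathbf{x}_i,\mathbf{x}_j\rangle)$, where $\phi_q(x)=(1-q)p+q\,\mathbf{1}\{x\ge u_{p,d}\}$. $\mathrm{TV}(\mathcal P,\mathcal Q)=\sup_A|\mathcal P(A)-\mathcal Q(A)|$ is the total variation distance between the laws of the two random graphs. *)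

theory Defs
  imports "HOL-Probability.Probability"
begin

text \<open>
  A simple graph on the vertex set \<open>{1..n}\<close> is represented by its set of edges, where the
  unordered pair of \<open>i\<close> and \<open>j\<close> with \<open>i < j\<close> is encoded as \<open>(i, j)\<close>.
\<close>

type_synonym graph = "(nat \<times> nat) set"

definition vertex_pairs :: "nat \<Rightarrow> (nat \<times> nat) set" where
  "vertex_pairs n = {(i, j). 1 \<le> i \<and> i < j \<and> j \<le> n}"

definition indep_edges :: "nat \<Rightarrow> (nat \<Rightarrow> nat \<Rightarrow> real) \<Rightarrow> graph pmf" where
  "indep_edges n w =
     map_pmf (\<lambda>f. {e \<in> vertex_pairs n. f e})
       (Pi_pmf (vertex_pairs n) False (\<lambda>(i, j). bernoulli_pmf (w i j)))"

definition erdos_renyi :: "nat \<Rightarrow> real \<Rightarrow> graph measure" where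
  "erdos_renyi n p = measure_pmf (indep_edges n (\<lambda>i j. p))"

text \<open>
  The dimension varies with \<open>n\<close>, so vectors of dimension \<open>d\<close> are functions on \<open>{..<d}\<close>;
  a standard normal vector has independent standard normal coordinates.
\<close>

definition std_normal_vec :: "nat \<Rightarrow> (nat \<Rightarrow> real) measure" where
  "std_normal_vec d = (\<Pi>\<^sub>M k\<in>{..<d}. density lborel std_normal_density)"

definition inner_vec :: "nat \<Rightarrow> (nat \<Rightarrow> real) \<Rightarrow> (nat \<Rightarrow> real) \<Rightarrow> real" where
  "inner_vec d x y = (\<Sum>k<d. x k * y k)"

text \<open>
  For \<open>0 < p < 1\<close> and \<open>d \<ge> 1\<close> the inner product of two independent standard normal vectors has
  a continuous distribution with full support, so the threshold exists and is unique.
\<close>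

definition threshold :: "real \<Rightarrow> nat \<Rightarrow> real" where
  "threshold p d =
     (THE u. \<P>(z in std_normal_vec d \<Otimes>\<^sub>M std_normal_vec d. inner_vec d (fst z) (snd z) \<ge> u) = p)"

definition connection_prob :: "real \<Rightarrow> nat \<Rightarrow> real \<Rightarrow> real \<Rightarrow> real" where
  "connection_prob p d q x = (1 - q) * p + q * indicator {threshold p d..} x"

text \<open>
  The law is the mixture, over the i.i.d. latent vectors \<open>x 1, \<dots>, x n\<close>, of the conditional
  law of the graph given these vectors.
\<close>

definition noisy_rgg :: "nat \<Rightarrow> real \<Rightarrow> nat \<Rightarrow> real \<Rightarrow> graph measure" where
  "noisy_rgg n p d q =
     (\<Pi>\<^sub>M i\<in>{1..n}. std_normal_vec d) \<bind>
       (\<lambda>x. measure_pmf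
          (indep_edges n (\<lambda>i j. connection_prob p d q (inner_vec d (x i) (x j)))))"

text \<open>The definition is meant for probability measures with the same measurable sets.\<close>

definition total_variation :: "'a measure \<Rightarrow> 'a measure \<Rightarrow> real" where
  "total_variation P Q = (SUP A\<in>sets P. \<bar>measure P A - measure Q A\<bar>)"

end

theory Submission
  imports Defs
begin

text \<open>
  Write \<open>\<sigma>(x, y) = 1{\<langle>x, y\<rangle> \<ge> u} - p\<close>, so that the conditional edge probabilities are \<open>p + q \<sigma>(x\<^sub>i, x\<^sub>j)\<close>.

  Impossibility. Reveal the edges \<open>(i, t)\<close>, \<open>i < t\<close>, ordered by \<open>t\<close> and then by \<open>i\<close>. By the chain rule, the
  relative entropy of the noisy graph with respect to \<open>G(n, p)\<close> is at most a constant times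
  \<open>q\<^sup>2\<close> times the sum over the edges of \<open>E(E(\<sigma>(x\<^sub>i, x\<^sub>t) | F)\<^sup>2)\<close>, where \<open>F\<close> contains \<open>x\<^sub>1, \<dots>, x\<^sub>i\<close> and the
  projection of \<open>x\<^sub>t\<close> to the span of \<open>x\<^sub>1, \<dots>, x\<^bsub>i-1\<^esub>\<close>. By rotation invariance \<open>\<langle>x\<^sub>i, x\<^sub>t\<rangle>\<close> is then
  Gaussian with a mean of order \<open>\<surd>i\<close> and a standard deviation \<open>\<surd>d + O(1 + i / \<surd>d)\<close>, so each summand
  is \<open>O(min 1 (i / d))\<close>. Hence the entropy is \<open>O(min (n\<^sup>2 q\<^sup>2) (n\<^sup>3 q\<^sup>2 / d))\<close>, and Pinsker's inequality
  covers both hypotheses at once.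

  Possibility. The second moment method is applied to the number of signed triangles if \<open>d\<close> is
  large, where a triangle has mean of order \<open>q\<^sup>3 / \<surd>d\<close>. For the finitely many small \<open>d\<close> it is applied
  to signed four-cycles instead, because the mean of a four-cycle is the squared Hilbert-Schmidt norm of the square of
  the operator with kernel \<open>\<sigma>\<close>, so its positivity needs no computation.
\<close>

subsection \<open>Resampling coordinates of product measures\<close>

text \<open>A chi-square bound for the whole graph would involve, for two independent copies of the
  latent vectors, the mean of a product over all edges; the entropy asks only for one second moment
  per edge. Conditional expectations are never formed. Their norms are reached by duality:
  correlations of \<sigma> with test functions \<open>F\<close> are bounded by
  \<open>(c * \<epsilon> + E(F\<^sup>2) / c) / 2\<close> for every \<open>c > 0\<close>,
  \<open>F\<close> is then chosen as the very quantity to be estimated, and half of the result is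
  absorbed. This treats the entropy of an edge, signed paths and signed degrees alike. Neither cycle
  statistic suffices alone. The error terms in the triangle mean are of order \<open>1 / d\<close>
  against a main term of order \<open>1 / sqrt d\<close>, so its sign is clear only for large
  \<open>d\<close>. The mean of a four-cycle is at most of order \<open>q ^ 4 / d\<close>, so that
  its second moment argument asks for \<open>n * q\<^sup>2\<close> to dominate
  \<open>sqrt d\<close>, whereas the hypothesis only makes it dominate the cube root of
  \<open>d\<close>.\<close>

lemma product_prob_space_const: "prob_space N \<Longrightarrow> product_prob_space (\<lambda>_. N)"
  by (simp add: product_prob_space_def product_prob_space_axioms_def product_sigma_finite_def prob_space_imp_sigma_finite)

lemma measurable_PiM_override:
  "(\<lambda>(x, y) i. if i \<in> J then y i else x i) \<in> PiM I M \<Otimes>\<^sub>M PiM I M \<rightarrow>\<^sub>M PiM I M"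
proof (rule measurable_PiM_single')
  show "(\<lambda>z. (case z of (x, y) \<Rightarrow> \<lambda>i. if i \<in> J then y i else x i) i) \<in> PiM I M \<Otimes>\<^sub>M PiM I M \<rightarrow>\<^sub>M M i" if "i \<in> I" for i
    using that by (cases "i \<in> J") (simp_all add: case_prod_beta)
qed (auto simp: space_pair_measure space_PiM PiE_iff extensional_def)

lemma measurable_PiM_update:
  assumes "i \<in> I"
  shows "(\<lambda>(x, y). x(i := y)) \<in> PiM I M \<Otimes>\<^sub>M M i \<rightarrow>\<^sub>M PiM I M"
proof (rule measurable_PiM_single')
  show "(\<lambda>z. (case z of (x, y) \<Rightarrow> x(i := y)) j) \<in> PiM I M \<Otimes>\<^sub>M M i \<rightarrow>\<^sub>M M j" if "j \<in> I" for j
    using that assms by (cases "j = i") (simp_all add: case_prod_beta)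
qed (use assms in \<open>auto simp: space_pair_measure space_PiM PiE_iff extensional_def\<close>)

text \<open>Resampling the coordinates in \<open>J\<close> from an independent copy leaves a product
  law unchanged. Independence of coordinate blocks is used in this form: both copies keep the full
  index set \<open>I\<close>, so the product is never split into one over \<open>J\<close> and one
  over its complement.\<close>

lemma distr_PiM_override:
  fixes I :: "'i set" and N :: "'a measure"
  assumes I: "finite I" and N: "prob_space N"
  shows "distr (PiM I (\<lambda>_. N) \<Otimes>\<^sub>M PiM I (\<lambda>_. N)) (PiM I (\<lambda>_. N)) (\<lambda>(x, y) i. if i \<in> J then y i else x i)
    = PiM I (\<lambda>_. N)"
proof -
  interpret N: prob_space N by fact
  interpret product_prob_space "\<lambda>_. N" I using N by (rule product_prob_space_const)
  interpret P: prob_space "PiM I (\<lambda>_. N)" by (rule prob_space_PiM) (use N in auto)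
  note measurable_PiM_override[measurable]
  let ?f = "\<lambda>(x :: 'i \<Rightarrow> 'a, y) i. if i \<in> J then y i else x i"
  let ?P = "PiM I (\<lambda>_. N)"
  show ?thesis
  proof (rule PiM_eqI)
    fix A assume A: "\<And>i. i \<in> I \<Longrightarrow> A i \<in> sets N"
    \<comment> \<open>A rectangle pulls back to a rectangle: the first copy carries the constraints
      outside \<open>J\<close>, the second those inside.\<close>
    let ?X = "Pi\<^sub>E I (\<lambda>i. if i \<in> J then space N else A i)"
    let ?Y = "Pi\<^sub>E I (\<lambda>i. if i \<in> J then A i else space N)"
    have sub: "\<And>i. i \<in> I \<Longrightarrow> A i \<subseteq> space N" using A sets.sets_into_space by blast
    have "?f -` (Pi\<^sub>E I A) \<inter> space (?P \<Otimes>\<^sub>M ?P) = ?X \<times> ?Y"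
      using sub by (auto simp: space_pair_measure space_PiM PiE_iff extensional_def split: if_splits) (metis subsetD)+
    moreover have "Pi\<^sub>E I A \<in> sets ?P" using A I by (intro sets_PiM_I_finite) auto
    moreover have X: "?X \<in> sets ?P" "?Y \<in> sets ?P" using A I by (auto intro!: sets_PiM_I_finite)
    ultimately have "emeasure (distr (?P \<Otimes>\<^sub>M ?P) ?P ?f) (Pi\<^sub>E I A) = emeasure ?P ?X * emeasure ?P ?Y"
      by (subst emeasure_distr) (auto simp: P.emeasure_pair_measure_Times measurable_PiM_override)
    also have "\<dots> = (\<Prod>i\<in>I. emeasure N (if i \<in> J then space N else A i)) * (\<Prod>i\<in>I. emeasure N (if i \<in> J then A i else space N))"
      using A I by (subst (1 2) emeasure_PiM) auto
    also have "\<dots> = (\<Prod>i\<in>I. emeasure N (A i))"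
      unfolding prod.distrib[symmetric] by (intro prod.cong) (auto simp: N.emeasure_space_1)
    finally show "emeasure (distr (?P \<Otimes>\<^sub>M ?P) ?P ?f) (Pi\<^sub>E I A) = (\<Prod>i\<in>I. emeasure N (A i))" .
  qed (use I in auto)
qed

lemma distr_PiM_update:
  fixes I :: "'i set" and N :: "'a measure"
  assumes I: "finite I" "i \<in> I" and N: "prob_space N"
  shows "distr (PiM I (\<lambda>_. N) \<Otimes>\<^sub>M N) (PiM I (\<lambda>_. N)) (\<lambda>(x, y). x(i := y)) = PiM I (\<lambda>_. N)"
proof -
  interpret N: prob_space N by fact
  interpret product_prob_space "\<lambda>_. N" I using N by (rule product_prob_space_const)
  interpret P: prob_space "PiM I (\<lambda>_. N)" by (rule prob_space_PiM) (use N in auto)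
  note measurable_PiM_update[OF I(2), of "\<lambda>_. N", measurable]
  let ?f = "\<lambda>(x :: 'i \<Rightarrow> 'a, y). x(i := y)"
  let ?P = "PiM I (\<lambda>_. N)"
  show ?thesis
  proof (rule PiM_eqI)
    fix A assume A: "\<And>i. i \<in> I \<Longrightarrow> A i \<in> sets N"
    let ?X = "Pi\<^sub>E I (A(i := space N))"
    have sub: "\<And>i. i \<in> I \<Longrightarrow> A i \<subseteq> space N" using A sets.sets_into_space by blast
    have "?f -` (Pi\<^sub>E I A) \<inter> space (?P \<Otimes>\<^sub>M N) = ?X \<times> A i"
      using sub I(2) by (auto simp: space_pair_measure space_PiM PiE_iff extensional_def split: if_splits) (metis subsetD)
    moreover have "Pi\<^sub>E I A \<in> sets ?P" using A I by (intro sets_PiM_I_finite) auto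
    moreover have X: "?X \<in> sets ?P" "A i \<in> sets N" using A I by (auto intro!: sets_PiM_I_finite)
    ultimately have "emeasure (distr (?P \<Otimes>\<^sub>M N) ?P ?f) (Pi\<^sub>E I A) = emeasure ?P ?X * emeasure N (A i)"
      by (subst emeasure_distr) (auto simp: N.emeasure_pair_measure_Times measurable_PiM_update I(2))
    also have "\<dots> = (\<Prod>j\<in>I. emeasure N ((A(i := space N)) j)) * emeasure N (A i)"
      using A I by (subst emeasure_PiM) auto
    also have "\<dots> = (\<Prod>j\<in>I. emeasure N (A j))"
      using I by (simp add: prod.remove[of I i] N.emeasure_space_1 mult.commute)
    finally show "emeasure (distr (?P \<Otimes>\<^sub>M N) ?P ?f) (Pi\<^sub>E I A) = (\<Prod>j\<in>I. emeasure N (A j))" .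
  qed (use I in auto)
qed

lemma integrable_bounded_prob:
  fixes F :: "'a \<Rightarrow> real"
  assumes "prob_space M" "F \<in> borel_measurable M" "\<And>x. x \<in> space M \<Longrightarrow> \<bar>F x\<bar> \<le> C"
  shows "integrable M F"
proof -
  interpret prob_space M by fact
  show ?thesis using assms by (intro integrable_const_bound[of _ C]) auto
qed

text \<open>A non-integrable function has integral 0 by convention, so in that case the bound
  reduces to \<open>0 \<le> C\<close>, which a point of the nonempty space supplies.\<close>

lemma abs_integral_le_bound:
  fixes F :: "'a \<Rightarrow> real"
  assumes "prob_space M" "\<And>x. x \<in> space M \<Longrightarrow> \<bar>F x\<bar> \<le> C"
  shows "\<bar>integral\<^sup>L M F\<bar> \<le> C"
proof -
  interpret prob_space M by fact
  obtain x where "x \<in> space M" using not_empty by auto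
  then have C: "0 \<le> C" using assms(2)[of x] by linarith
  show ?thesis
  proof (cases "integrable M F")
    case True
    have "\<bar>integral\<^sup>L M F\<bar> \<le> (\<integral>x. \<bar>F x\<bar> \<partial>M)" using integral_norm_bound[of M F] by simp
    also have "\<dots> \<le> (\<integral>x. C \<partial>M)" using True assms by (intro integral_mono) auto
    finally show ?thesis by (simp add: prob_space)
  qed (use C in \<open>simp add: not_integrable_integral_eq\<close>)
qed

lemma integral_distr_pair:
  fixes F :: "'c \<Rightarrow> real"
  assumes "prob_space A" "prob_space B" and f: "f \<in> A \<Otimes>\<^sub>M B \<rightarrow>\<^sub>M M" and "distr (A \<Otimes>\<^sub>M B) M f = M"
    and F: "F \<in> borel_measurable M" "\<And>x. x \<in> space M \<Longrightarrow> \<bar>F x\<bar> \<le> C"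
  shows "integral\<^sup>L M F = (\<integral>x. \<integral>y. F (f (x, y)) \<partial>B \<partial>A)"
proof -
  interpret A: prob_space A by fact
  interpret B: prob_space B by fact
  interpret AB: pair_prob_space A B ..
  have "integral\<^sup>L M F = (\<integral>z. F (f z) \<partial>(A \<Otimes>\<^sub>M B))"
    using integral_distr[OF f F(1)] assms(4) by simp
  also have "\<dots> = (\<integral>x. \<integral>y. F (f (x, y)) \<partial>B \<partial>A)"
  proof (rule AB.integral_fst'[symmetric])
    show "integrable (A \<Otimes>\<^sub>M B) (\<lambda>z. F (f z))"
      using measurable_space[OF f] F f
      by (intro integrable_bounded_prob[of _ _ C]) (auto intro: AB.prob_space_axioms)
  qed
  finally show ?thesis .
qed

lemma integral_PiM_update:
  fixes F :: "('i \<Rightarrow> 'a) \<Rightarrow> real"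
  assumes "finite I" "i \<in> I" "prob_space N" "F \<in> borel_measurable (PiM I (\<lambda>_. N))"
    "\<And>x. x \<in> space (PiM I (\<lambda>_. N)) \<Longrightarrow> \<bar>F x\<bar> \<le> C"
  shows "integral\<^sup>L (PiM I (\<lambda>_. N)) F = (\<integral>x. \<integral>y. F (x(i := y)) \<partial>N \<partial>PiM I (\<lambda>_. N))"
  using integral_distr_pair[OF _ assms(3) measurable_PiM_update[OF assms(2), of "\<lambda>_. N"] distr_PiM_update[OF assms(1,2,3)] assms(4,5)]
  by (auto simp: assms prob_space_PiM)

lemma integral_PiM_override:
  fixes F :: "('i \<Rightarrow> 'a) \<Rightarrow> real"
  assumes "finite I" "prob_space N" "F \<in> borel_measurable (PiM I (\<lambda>_. N))"
    "\<And>x. x \<in> space (PiM I (\<lambda>_. N)) \<Longrightarrow> \<bar>F x\<bar> \<le> C"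
  shows "integral\<^sup>L (PiM I (\<lambda>_. N)) F
    = (\<integral>x. \<integral>y. F (\<lambda>i. if i \<in> J then y i else x i) \<partial>PiM I (\<lambda>_. N) \<partial>PiM I (\<lambda>_. N))"
  using integral_distr_pair[OF _ _ measurable_PiM_override distr_PiM_override[OF assms(1,2)] assms(3,4)]
  by (auto simp: assms prob_space_PiM)

lemma integral_PiM_component:
  fixes F :: "'a \<Rightarrow> real"
  assumes "prob_space N" "i \<in> I" "F \<in> borel_measurable N"
  shows "(\<integral>x. F (x i) \<partial>PiM I (\<lambda>_. N)) = integral\<^sup>L N F"
  by (subst (2) distr_PiM_component[of I "\<lambda>_. N" i, symmetric])
     (use assms in \<open>auto intro: integral_distr[symmetric]\<close>)

subsection \<open>Gaussian tails and the threshold\<close>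

lemma prob_space_std_normal_distribution: "prob_space std_normal_distribution"
  by (rule prob_space_normal_density) simp

lemma space_std_normal_vec: "space (std_normal_vec d) = ({..<d} \<rightarrow>\<^sub>E UNIV)"
  by (simp add: std_normal_vec_def space_PiM)

lemma prob_space_std_normal_vec: "prob_space (std_normal_vec d)"
  unfolding std_normal_vec_def by (rule prob_space_PiM) (rule prob_space_std_normal_distribution)

lemma measurable_std_normal_vec_component[measurable (raw)]:
  assumes "f \<in> M \<rightarrow>\<^sub>M std_normal_vec d" "l < d"
  shows "(\<lambda>x. f x l) \<in> borel_measurable M"
proof -
  have "(\<lambda>y. y l) \<in> std_normal_vec d \<rightarrow>\<^sub>M std_normal_distribution"
    unfolding std_normal_vec_def using assms(2) by (intro measurable_component_singleton) auto
  from measurable_compose[OF assms(1) this] show ?thesis by simp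
qed

lemma measurable_inner_vec[measurable (raw)]:
  assumes "f \<in> M \<rightarrow>\<^sub>M std_normal_vec d" "g \<in> M \<rightarrow>\<^sub>M std_normal_vec d"
  shows "(\<lambda>x. inner_vec d (f x) (g x)) \<in> borel_measurable M"
  unfolding inner_vec_def using assms by (intro borel_measurable_sum borel_measurable_times measurable_std_normal_vec_component) auto

definition normal_tail :: "real \<Rightarrow> real" where
  "normal_tail v = measure std_normal_distribution {v..}"

lemma normal_tail_bounds: "0 \<le> normal_tail v" "normal_tail v \<le> 1"
  using prob_space.prob_le_1[OF prob_space_std_normal_distribution] by (simp_all add: normal_tail_def)

lemma std_normal_density_le_1: "std_normal_density x \<le> 1"
proof -
  have "1 \<le> sqrt (2 * pi)" using pi_gt3 by simp
  moreover have "exp (- x\<^sup>2 / 2) \<le> 1" by simp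
  ultimately have "exp (- x\<^sup>2 / 2) \<le> sqrt (2 * pi)" by linarith
  then show ?thesis by (simp add: std_normal_density_def divide_le_eq_1)
qed

text \<open>The derivative \<open>- z * std_normal_density z\<close> is at most 1 in absolute value
  because \<open>\<bar>z\<bar> \<le> 1 + z\<^sup>2 / 2 \<le> exp (z\<^sup>2 / 2)\<close>. The
  constant is crude; it only has to make the error in \<open>normal_tail_taylor\<close> quadratic
  with a universal constant.\<close>

lemma std_normal_density_lipschitz:
  "\<bar>std_normal_density x - std_normal_density y\<bar> \<le> \<bar>x - y\<bar>"
proof -
  have D: "(std_normal_density has_real_derivative - z * std_normal_density z) (at z)" for z
  proof -
    have "((\<lambda>z. k * exp (- z\<^sup>2 / 2)) has_real_derivative - z * (k * exp (- z\<^sup>2 / 2))) (at z)" for k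
      by (auto intro!: derivative_eq_intros simp: power2_eq_square)
    then show ?thesis unfolding std_normal_density_def .
  qed
  have B: "norm (- z * std_normal_density z) \<le> 1" for z
  proof -
    have "\<bar>z\<bar> \<le> 1 + z\<^sup>2 / 2" using zero_le_power2[of "\<bar>z\<bar> - 1"] by (simp add: power2_diff)
    also have "\<dots> \<le> exp (z\<^sup>2 / 2)" by (rule exp_ge_add_one_self)
    finally have "\<bar>z\<bar> * exp (- z\<^sup>2 / 2) \<le> 1" by (simp add: exp_minus field_simps)
    moreover have "1 \<le> sqrt (2 * pi)" using pi_gt3 by simp
    ultimately have "1 / sqrt (2 * pi) * (\<bar>z\<bar> * exp (- z\<^sup>2 / 2)) \<le> 1 * 1"
      by (intro mult_mono) auto
    then show ?thesis by (simp add: std_normal_density_def abs_mult mult_ac)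
  qed
  have "norm (std_normal_density x - std_normal_density y) \<le> 1 * norm (x - y)"
    by (rule field_differentiable_bound[of UNIV std_normal_density "\<lambda>z. - z * std_normal_density z"])
       (use D B in auto)
  then show ?thesis by simp
qed

lemma normal_tail_diff:
  assumes "a \<le> b"
  shows "normal_tail a - normal_tail b = (\<integral>x. indicator {a..<b} x * std_normal_density x \<partial>lborel)"
proof -
  interpret prob_space std_normal_distribution by (rule prob_space_std_normal_distribution)
  have "normal_tail a - normal_tail b = prob ({a..} - {b..})"
    unfolding normal_tail_def using assms by (subst finite_measure_Diff) auto
  also have "{a..} - {b..} = {a..<b}" by auto
  also have "prob {a..<b} = (\<integral>x. indicator {a..<b} x \<partial>std_normal_distribution)"
    by simp
  also have "\<dots> = (\<integral>x. indicator {a..<b} x * std_normal_density x \<partial>lborel)"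
    by (subst integral_density) (auto simp: mult.commute)
  finally show ?thesis .
qed

lemma normal_tail_antimono:
  assumes "a \<le> b" shows "normal_tail b \<le> normal_tail a"
proof -
  have "0 \<le> (\<integral>x. indicator {a..<b} x * std_normal_density x \<partial>lborel)"
    by (intro Bochner_Integration.integral_nonneg) auto
  then show ?thesis using normal_tail_diff[OF assms] by linarith
qed

lemma integrable_indicator_density:
  "integrable lborel (\<lambda>x. indicator {a..<b::real} x * std_normal_density x)"
  using integrable_mult_indicator[of "{a..<b}" lborel std_normal_density] integrable_std_normal_moment[of 0] by simp

text \<open>The density on the interval is frozen at an arbitrary point \<open>v\<close> of it.
  Taking \<open>v\<close> at the right or at the left end yields both signs of \<open>e\<close> in
  \<open>normal_tail_taylor\<close>.\<close>

lemma normal_tail_taylor_aux: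
  assumes "a \<le> b" "v \<in> {a..b}"
  shows "\<bar>normal_tail a - normal_tail b - std_normal_density v * (b - a)\<bar> \<le> (b - a)\<^sup>2"
proof -
  have i: "integrable lborel (\<lambda>x. indicator {a..<b} x * c)" for c :: real
    using integrable_real_indicator[of "{a..<b}" lborel] assms(1) by simp
  have v: "(\<integral>x. indicator {a..<b} x * c \<partial>lborel) = (b - a) * c" for c :: real
    using assms(1) by (simp)
  have eq: "normal_tail a - normal_tail b - std_normal_density v * (b - a)
    = (\<integral>x. indicator {a..<b} x * std_normal_density x - indicator {a..<b} x * std_normal_density v \<partial>lborel)"
    unfolding normal_tail_diff[OF assms(1)]
    by (subst Bochner_Integration.integral_diff[OF integrable_indicator_density i]) (simp only: v mult.commute[of "b - a"])
  have "\<bar>normal_tail a - normal_tail b - std_normal_density v * (b - a)\<bar>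
    \<le> (\<integral>x. \<bar>indicator {a..<b} x * std_normal_density x - indicator {a..<b} x * std_normal_density v\<bar> \<partial>lborel)"
    unfolding eq by (rule integral_abs_bound)
  also have "\<dots> \<le> (\<integral>x. indicator {a..<b} x * (b - a) \<partial>lborel)"
  proof (rule integral_mono)
    show "integrable lborel (\<lambda>x. \<bar>indicator {a..<b} x * std_normal_density x - indicator {a..<b} x * std_normal_density v\<bar>)"
      by (rule integrable_abs) (rule Bochner_Integration.integrable_diff[OF integrable_indicator_density i])
    show "integrable lborel (\<lambda>x. indicator {a..<b} x * (b - a))" by (rule i)
    fix x :: real
    show "\<bar>indicator {a..<b} x * std_normal_density x - indicator {a..<b} x * std_normal_density v\<bar> \<le> indicator {a..<b} x * (b - a)"
    proof (cases "x \<in> {a..<b}")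
      case True
      then have "\<bar>x - v\<bar> \<le> b - a" using assms(2) by auto
      then show ?thesis using std_normal_density_lipschitz[of x v] True by simp
    qed simp
  qed
  also have "\<dots> = (b - a)\<^sup>2" unfolding v by (simp add: power2_eq_square)
  finally show ?thesis .
qed

lemma normal_tail_taylor:
  "\<bar>normal_tail (v - e) - normal_tail v - std_normal_density v * e\<bar> \<le> e\<^sup>2"
proof (cases "e \<ge> 0")
  case True
  then show ?thesis using normal_tail_taylor_aux[of "v - e" v v] by simp
next
  case False
  then show ?thesis using normal_tail_taylor_aux[of v "v - e" v] by (simp add: abs_minus_commute algebra_simps)
qed

lemma normal_tail_lipschitz: "\<bar>normal_tail a - normal_tail b\<bar> \<le> \<bar>a - b\<bar>"
proof (induction a b rule: linorder_wlog)
  case (le a b)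
  have "integrable lborel (\<lambda>x. indicator {a..<b} x * (1 :: real))"
    using integrable_real_indicator[of "{a..<b}" lborel] le by simp
  then have "normal_tail a - normal_tail b \<le> (\<integral>x. indicator {a..<b} x * 1 \<partial>lborel)"
    unfolding normal_tail_diff[OF le]
    by (rule integral_mono[OF integrable_indicator_density]) (auto simp: indicator_def std_normal_density_le_1)
  then show ?case using normal_tail_antimono[OF le] le by simp
qed (simp add: abs_minus_commute)

lemma isCont_normal_tail: "isCont normal_tail v"
proof -
  have "1-lipschitz_on UNIV normal_tail"
    by (rule lipschitz_onI) (use normal_tail_lipschitz in \<open>auto simp: dist_real_def\<close>)
  then show ?thesis
    using lipschitz_on_continuous_on[of 1 UNIV normal_tail] by (simp add: continuous_on_eq_continuous_at)
qed

lemma borel_measurable_normal_tail[measurable]: "normal_tail \<in> borel_measurable borel"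
  using isCont_normal_tail by (intro borel_measurable_continuous_onI) (simp add: continuous_on_eq_continuous_at)

text \<open>Equality would force the interval to be a null set, since the density is positive. This
  makes the threshold unique and the lower bound for \<open>half_mean\<close> strictly
  positive.\<close>

lemma normal_tail_strict_antimono:
  assumes "a < b" shows "normal_tail b < normal_tail a"
proof -
  have "normal_tail a \<noteq> normal_tail b"
  proof
    assume "normal_tail a = normal_tail b"
    then have "(\<integral>x. indicator {a..<b} x * std_normal_density x \<partial>lborel) = 0"
      using normal_tail_diff[of a b] assms by simp
    then have "AE x in lborel. indicator {a..<b} x * std_normal_density x = 0"
      using integral_nonneg_eq_0_iff_AE[OF integrable_indicator_density, of a b] by simp
    then have "AE x in lborel. x \<notin> {a..<b}"
      by eventually_elim (auto simp: indicator_def std_normal_density_def split: if_splits)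
    then have "emeasure lborel {a..<b} = 0"
      by (subst (asm) AE_iff_measurable[of "{a..<b}"]) auto
    then show False using assms by simp
  qed
  then show ?thesis using normal_tail_antimono[of a b] assms by simp
qed

lemma normal_tail_at_top: "(normal_tail \<longlongrightarrow> 0) at_top"
proof -
  interpret prob_space std_normal_distribution by (rule prob_space_std_normal_distribution)
  have "(\<lambda>n. prob {real n..}) \<longlonglongrightarrow> prob (\<Inter>n. {real n..})"
    by (intro finite_Lim_measure_decseq) (auto simp: decseq_def)
  moreover have "(\<Inter>n. {real n..}) = {}"
    by auto (meson not_le reals_Archimedean2)
  ultimately have "(\<lambda>n. normal_tail (real n)) \<longlonglongrightarrow> 0" by (simp add: normal_tail_def)
  then have lim: "(\<lambda>x. - normal_tail (real x)) \<longlonglongrightarrow> 0" using tendsto_minus by fastforce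
  have "((\<lambda>x. - normal_tail x) \<longlongrightarrow> 0) at_top"
    by (rule tendsto_at_topI_sequentially_real[OF _ lim]) (auto simp: mono_def normal_tail_antimono)
  then show ?thesis using tendsto_minus by fastforce
qed

lemma normal_tail_at_bot: "(normal_tail \<longlongrightarrow> 1) at_bot"
proof -
  interpret prob_space std_normal_distribution by (rule prob_space_std_normal_distribution)
  have "(\<lambda>n. prob {- real n..}) \<longlonglongrightarrow> prob (\<Union>n. {- real n..})"
    by (intro finite_Lim_measure_incseq) (auto simp: incseq_def)
  moreover have "(\<Union>n. {- real n..}) = UNIV"
    by auto (metis less_imp_le minus_less_iff reals_Archimedean2)
  ultimately have lim: "(\<lambda>n. normal_tail (- real n)) \<longlonglongrightarrow> 1" using prob_space by (simp add: normal_tail_def)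
  have "((\<lambda>x. normal_tail (- x)) \<longlongrightarrow> 1) at_top"
    by (rule tendsto_at_topI_sequentially_real[OF _ lim]) (auto simp: mono_def normal_tail_antimono)
  then show ?thesis by (simp add: filterlim_at_bot_mirror)
qed

section \<open>Linear and quadratic forms in independent Gaussian coordinates\<close>

lemma distributed_PiM_std_normal:
  assumes "l \<in> I"
  shows "distributed (PiM I (\<lambda>_. std_normal_distribution)) lborel (\<lambda>y. y l) std_normal_density"
proof -
  have "distr (PiM I (\<lambda>_. std_normal_distribution)) lborel (\<lambda>y. y l)
    = distr (PiM I (\<lambda>_. std_normal_distribution)) std_normal_distribution (\<lambda>y. y l)"
    by (rule distr_cong) auto
  also have "\<dots> = std_normal_distribution"
    using distr_PiM_component[of I "\<lambda>_. std_normal_distribution" l] assms prob_space_std_normal_distribution by auto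
  moreover have "(\<lambda>y. y l) \<in> PiM I (\<lambda>_. std_normal_distribution) \<rightarrow>\<^sub>M std_normal_distribution"
    using assms by measurable
  ultimately show ?thesis by (auto simp: distributed_def)
qed

text \<open>Centred functions of distinct coordinates are orthogonal, so only the diagonal survives.
  It is used with \<open>c z = z\<close> for inner products with a fixed vector and with
  \<open>c z = 1 - z\<^sup>2\<close> for fluctuations of squared norms.\<close>

lemma integral_square_sum:
  fixes c :: "real \<Rightarrow> real" and a :: "'i \<Rightarrow> real"
  assumes I: "finite I" "L \<subseteq> I"
    and c: "integrable std_normal_distribution c" "integrable std_normal_distribution (\<lambda>z. (c z)\<^sup>2)"
    and c0: "(\<integral>z. c z \<partial>std_normal_distribution) = 0"
  shows "integrable (PiM I (\<lambda>_. std_normal_distribution)) (\<lambda>y. (\<Sum>l\<in>L. a l * c (y l))\<^sup>2)"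
    and "(\<integral>y. (\<Sum>l\<in>L. a l * c (y l))\<^sup>2 \<partial>PiM I (\<lambda>_. std_normal_distribution))
      = (\<integral>z. (c z)\<^sup>2 \<partial>std_normal_distribution) * (\<Sum>l\<in>L. (a l)\<^sup>2)"
proof -
  let ?N = "std_normal_distribution"
  let ?M = "PiM I (\<lambda>_. ?N)"
  interpret N: prob_space ?N by (rule prob_space_std_normal_distribution)
  interpret product_prob_space "\<lambda>_. ?N" I
    by (rule product_prob_space_const) (rule prob_space_std_normal_distribution)
  define v where "v = (\<integral>z. (c z)\<^sup>2 \<partial>?N)"
  have fin: "finite L" using I finite_subset by auto
  have pr: "integrable ?M (\<lambda>y. c (y l) * c (y m)) \<and>
     (\<integral>y. c (y l) * c (y m) \<partial>?M) = (if l = m then v else 0)" if "l \<in> L" "m \<in> L" for l m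
  proof -
    \<comment> \<open>Each term is written as a product over all of \<open>I\<close>, with factor 1
      away from \<open>l\<close> and \<open>m\<close>, so that the product formula for
      \<open>PiM\<close> applies.\<close>
    define f where "f i = (if i = l then (if l = m then (\<lambda>z. (c z)\<^sup>2) else c) else if i = m then c else (\<lambda>_. 1))" for i
    have f: "integrable ?N (f i)" for i using c by (simp add: f_def)
    have lm: "l \<in> I" "m \<in> I" using that I by auto
    have eq: "(\<Prod>i\<in>I. f i (y i)) = c (y l) * c (y m)" for y
    proof (cases "l = m")
      case True
      then show ?thesis using lm I by (simp add: prod.remove[of I l] f_def power2_eq_square)
    next
      case False
      then have "(\<Prod>i\<in>I. f i (y i)) = f l (y l) * (f m (y m) * (\<Prod>i\<in>I-{l}-{m}. f i (y i)))"
        using lm I by (subst prod.remove[of I l], simp, simp, subst prod.remove[of "I - {l}" m]) auto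
      also have "(\<Prod>i\<in>I-{l}-{m}. f i (y i)) = 1" by (rule prod.neutral) (auto simp: f_def)
      finally show ?thesis using False by (simp add: f_def)
    qed
    have eq2: "(\<Prod>i\<in>I. integral\<^sup>L ?N (f i)) = (if l = m then v else 0)"
    proof (cases "l = m")
      case True
      then show ?thesis using lm I N.prob_space by (simp add: prod.remove[of I l] f_def v_def)
    next
      case False
      then show ?thesis using lm I c0 by (auto simp: f_def intro!: bexI[of _ l])
    qed
    show ?thesis
      using product_integrable_prod[OF I(1), of f, OF f] product_integral_prod[OF I(1), of f, OF f] unfolding eq eq2 by simp
  qed
  have ex: "(\<Sum>l\<in>L. a l * c (y l))\<^sup>2 = (\<Sum>l\<in>L. \<Sum>m\<in>L. a l * a m * (c (y l) * c (y m)))" for y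
    by (simp add: power2_eq_square sum_product mult_ac)
  show "integrable ?M (\<lambda>y. (\<Sum>l\<in>L. a l * c (y l))\<^sup>2)"
    unfolding ex using pr by (intro Bochner_Integration.integrable_sum integrable_mult_right) auto
  have "(\<integral>y. (\<Sum>l\<in>L. a l * c (y l))\<^sup>2 \<partial>?M) = (\<Sum>l\<in>L. \<Sum>m\<in>L. a l * a m * (if l = m then v else 0))"
    unfolding ex using pr by (subst Bochner_Integration.integral_sum; (intro Bochner_Integration.integrable_sum integrable_mult_right sum.cong refl)?; (simp add: Bochner_Integration.integral_sum)?)
  also have "\<dots> = v * (\<Sum>l\<in>L. (a l)\<^sup>2)"
    using fin by (simp add: if_distrib[of "\<lambda>x. _ * x"] sum.delta' power2_eq_square sum_distrib_left mult_ac cong: if_cong)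
  finally show "(\<integral>y. (\<Sum>l\<in>L. a l * c (y l))\<^sup>2 \<partial>?M) = (\<integral>z. (c z)\<^sup>2 \<partial>?N) * (\<Sum>l\<in>L. (a l)\<^sup>2)"
    by (simp add: v_def)
qed

lemma prob_lincomb_ge:
  fixes b :: "'i \<Rightarrow> real"
  assumes "finite I" "L \<subseteq> I" and pos: "0 < (\<Sum>l\<in>L. (b l)\<^sup>2)"
  shows "measure (PiM I (\<lambda>_. std_normal_distribution))
      {y \<in> space (PiM I (\<lambda>_. std_normal_distribution)). (\<Sum>l\<in>L. b l * y l) \<ge> t}
    = normal_tail (t / sqrt (\<Sum>l\<in>L. (b l)\<^sup>2))"
proof -
  let ?M = "PiM I (\<lambda>_. std_normal_distribution)"
  interpret prob_space ?M by (rule prob_space_PiM) (rule prob_space_std_normal_distribution)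
  \<comment> \<open>Terms with coefficient 0 are dropped: the sum rule for independent normals needs
    each summand to have a positive standard deviation.\<close>
  define L' where "L' = {l \<in> L. b l \<noteq> 0}"
  have "finite L" using assms finite_subset by auto
  then have fin: "finite L" "finite L'" "L' \<subseteq> I" using assms by (auto simp: L'_def)
  have s: "(\<Sum>l\<in>L. (b l)\<^sup>2) = (\<Sum>l\<in>L'. \<bar>b l\<bar>\<^sup>2)"
    using fin by (intro sum.mono_neutral_cong_right) (auto simp: L'_def)
  have e: "(\<Sum>l\<in>L. b l * y l) = (\<Sum>l\<in>L'. b l * y l)" for y
    using fin by (intro sum.mono_neutral_cong_right) (auto simp: L'_def)
  have "L' \<noteq> {}" using pos unfolding s by (auto)
  define s where "s = sqrt (\<Sum>l\<in>L'. \<bar>b l\<bar>\<^sup>2)"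
  have s0: "0 < s" using pos s by (simp add: s_def)
  have comp: "(\<lambda>y. y l) \<in> borel_measurable ?M" if "l \<in> I" for l
  proof -
    have "(\<lambda>y. y l) \<in> ?M \<rightarrow>\<^sub>M std_normal_distribution" using that by measurable
    then show ?thesis by simp
  qed
  have ind0: "indep_vars (\<lambda>_. borel) (\<lambda>l y. y l) L'"
  proof (subst indep_vars_iff_distr_eq_PiM'[OF \<open>L' \<noteq> {}\<close>])
    show "(\<lambda>y. y l) \<in> borel_measurable ?M" if "l \<in> L'" for l using that fin comp by auto
    interpret product_prob_space "\<lambda>_. std_normal_distribution" I
      by (rule product_prob_space_const) (rule prob_space_std_normal_distribution)
    have sets_eq: "sets (PiM L' (\<lambda>_. borel)) = sets (PiM L' (\<lambda>_. std_normal_distribution))" by (rule sets_PiM_cong) auto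
    have "distr ?M (PiM L' (\<lambda>_. borel)) (\<lambda>y. \<lambda>l\<in>L'. y l) = distr ?M (PiM L' (\<lambda>_. std_normal_distribution)) (\<lambda>y. restrict y L')"
      by (intro distr_cong refl sets_eq)
    also have "\<dots> = PiM L' (\<lambda>_. std_normal_distribution)"
      by (rule distr_PiM_restrict_finite) (use fin in auto)
    also have "\<dots> = PiM L' (\<lambda>l. distr ?M borel (\<lambda>y. y l))"
    proof (intro PiM_cong refl)
      fix l assume "l \<in> L'"
      then have "distr ?M lborel (\<lambda>y. y l) = std_normal_distribution"
        using distributed_PiM_std_normal[of l I] fin by (auto simp: distributed_def)
      moreover have "distr ?M lborel (\<lambda>y. y l) = distr ?M borel (\<lambda>y. y l)" by (rule distr_cong) auto
      ultimately show "std_normal_distribution = distr ?M borel (\<lambda>y. y l)" by simp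
    qed
    finally show "distr ?M (PiM L' (\<lambda>_. borel)) (\<lambda>y. \<lambda>l\<in>L'. y l) = PiM L' (\<lambda>l. distr ?M borel (\<lambda>y. y l))" .
  qed
  have ind: "indep_vars (\<lambda>_. borel) (\<lambda>l y. b l * y l) L'"
    by (rule indep_vars_compose2[OF ind0]) auto
  have "distributed ?M lborel (\<lambda>y. \<Sum>l\<in>L'. b l * y l) (normal_density (\<Sum>l\<in>L'. 0) s)"
    unfolding s_def
  proof (rule sum_indep_normal[OF fin(2) \<open>L' \<noteq> {}\<close> ind])
    show "0 < \<bar>b l\<bar>" if "l \<in> L'" for l using that by (simp add: L'_def)
    show "distributed ?M lborel (\<lambda>y. b l * y l) (normal_density 0 \<bar>b l\<bar>)" if "l \<in> L'" for l
      using normal_density_affine[OF distributed_PiM_std_normal[of l I], of "b l" 0] that fin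
      by (auto simp: L'_def)
  qed
  then have "distributed ?M lborel (\<lambda>y. 0 + (1 / s) * (\<Sum>l\<in>L'. b l * y l)) (normal_density (0 + (1 / s) * 0) (\<bar>1 / s\<bar> * s))"
    using s0 by (intro normal_density_affine) auto
  then have D: "distributed ?M lborel (\<lambda>y. (\<Sum>l\<in>L'. b l * y l) / s) std_normal_density"
    using s0 by simp
  have "measure ?M {y \<in> space ?M. (\<Sum>l\<in>L. b l * y l) \<ge> t} = measure ?M ((\<lambda>y. (\<Sum>l\<in>L'. b l * y l) / s) -` {t / s..} \<inter> space ?M)"
    using s0 by (intro arg_cong[where f = "measure ?M"]) (auto simp: e divide_le_cancel)
  also have "\<dots> = measure (distr ?M lborel (\<lambda>y. (\<Sum>l\<in>L'. b l * y l) / s)) {t / s..}"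
    using D by (subst measure_distr) (auto simp: distributed_def)
  also have "\<dots> = normal_tail (t / s)"
    using D by (simp add: distributed_def normal_tail_def)
  finally show ?thesis by (simp add: s_def s)
qed

lemma std_normal_moments:
  "integrable std_normal_distribution (\<lambda>z. z)" "(\<integral>z. z \<partial>std_normal_distribution) = 0"
  "integrable std_normal_distribution (\<lambda>z. z\<^sup>2)" "(\<integral>z. z\<^sup>2 \<partial>std_normal_distribution) = 1"
  "integrable std_normal_distribution (\<lambda>z. 1 - z\<^sup>2)" "(\<integral>z. 1 - z\<^sup>2 \<partial>std_normal_distribution) = 0"
  "integrable std_normal_distribution (\<lambda>z. (1 - z\<^sup>2)\<^sup>2)" "(\<integral>z. (1 - z\<^sup>2)\<^sup>2 \<partial>std_normal_distribution) = 2"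
proof -
  interpret prob_space std_normal_distribution by (rule prob_space_std_normal_distribution)
  note m = integrable_std_normal_distribution_moment std_normal_distribution_even_moments
  show 1: "integrable std_normal_distribution (\<lambda>z. z)" using m(1)[of 1] by simp
  show "(\<integral>z. z \<partial>std_normal_distribution) = 0"
    using integral_std_normal_distribution_moment_odd[of 1] by simp
  show 2: "integrable std_normal_distribution (\<lambda>z. z\<^sup>2)" using m(1)[of 2] by simp
  show 3: "(\<integral>z. z\<^sup>2 \<partial>std_normal_distribution) = 1" using m(2)[of 1] by simp
  show "integrable std_normal_distribution (\<lambda>z. 1 - z\<^sup>2)" using 2 by simp
  show "(\<integral>z. 1 - z\<^sup>2 \<partial>std_normal_distribution) = 0"
    using 2 3 prob_space by simp
  have 4: "(1 - z\<^sup>2)\<^sup>2 = 1 - 2 * z\<^sup>2 + z ^ 4" for z :: real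
    by (simp add: power2_diff flip: power_mult)
  show "integrable std_normal_distribution (\<lambda>z. (1 - z\<^sup>2)\<^sup>2)"
    unfolding 4 using 2 m(1)[of 4] by (intro Bochner_Integration.integrable_add Bochner_Integration.integrable_diff integrable_mult_right) auto
  have "(\<integral>z. z ^ 4 \<partial>std_normal_distribution) = 3" using m(2)[of 2] by (simp add: fact_numeral)
  then show "(\<integral>z. (1 - z\<^sup>2)\<^sup>2 \<partial>std_normal_distribution) = 2"
    unfolding 4 using 2 3 m(1)[of 4] prob_space by simp
qed

lemma AE_tail_sum_pos:
  assumes "k < d"
  shows "AE b in std_normal_vec d. 0 < (\<Sum>l=k..<d. (b l)\<^sup>2)"
proof -
  have "AE z in lborel. z \<noteq> (0 :: real)" by (rule AE_lborel_singleton)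
  then have "AE z in lborel. 0 < ennreal (std_normal_density z) \<longrightarrow> z \<noteq> (0 :: real)" by eventually_elim simp
  then have "AE z in std_normal_distribution. z \<noteq> (0 :: real)" by (subst AE_density) auto
  then have "AE b in std_normal_vec d. b k \<noteq> 0"
    unfolding std_normal_vec_def using assms
    by (intro AE_PiM_component[where M = "\<lambda>_. std_normal_distribution" and P = "\<lambda>z. z \<noteq> 0"])
       (auto intro: prob_space_std_normal_distribution)
  then show ?thesis
  proof eventually_elim
    case (elim b)
    have "0 < (b k)\<^sup>2" using elim by simp
    also have "\<dots> \<le> (\<Sum>l=k..<d. (b l)\<^sup>2)" using assms by (intro member_le_sum) auto
    finally show ?case .
  qed
qed

text \<open>Given \<open>b\<close> and the first \<open>k\<close> coordinates of \<open>y\<close>,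
  the inner product is normal with mean the sum of \<open>b l * y l\<close> over
  \<open>l < k\<close> and variance the sum of \<open>(b l)\<^sup>2\<close> over
  \<open>l \<ge> k\<close>. As \<open>F\<close> sees only those first \<open>k\<close> coordinates,
  the indicator may be replaced by its conditional probability.\<close>

lemma integral_inner_vec_ge:
  assumes kd: "k \<le> d" and pos: "0 < (\<Sum>l=k..<d. (b l)\<^sup>2)"
    and F[measurable]: "F \<in> borel_measurable (std_normal_vec d)" and C: "\<And>y. \<bar>F y\<bar> \<le> C"
    and dep: "\<And>y y'. \<lbrakk>y \<in> space (std_normal_vec d); y' \<in> space (std_normal_vec d); \<And>l. l < k \<Longrightarrow> y l = y' l\<rbrakk> \<Longrightarrow> F y = F y'"
    and b[measurable]: "b \<in> space (std_normal_vec d)"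
  shows "(\<integral>y. indicator {u..} (inner_vec d b y) * F y \<partial>std_normal_vec d)
    = (\<integral>y. normal_tail ((u - (\<Sum>l<k. b l * y l)) / sqrt (\<Sum>l=k..<d. (b l)\<^sup>2)) * F y \<partial>std_normal_vec d)"
proof -
  let ?N = "std_normal_vec d"
  interpret prob_space ?N by (rule prob_space_std_normal_vec)
  have split: "inner_vec d b y = (\<Sum>l<k. b l * y l) + (\<Sum>l=k..<d. b l * y l)" for y
    unfolding inner_vec_def using kd
    by (subst sum.union_disjoint[symmetric]) (auto intro!: sum.cong)
  have "(\<integral>y. indicator {u..} (inner_vec d b y) * F y \<partial>?N)
    = (\<integral>x. \<integral>y. indicator {u..} (inner_vec d b (\<lambda>i. if i \<in> {k..<d} then y i else x i)) * F (\<lambda>i. if i \<in> {k..<d} then y i else x i) \<partial>?N \<partial>?N)"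
    unfolding std_normal_vec_def
  proof (rule integral_PiM_override[where C = C])
    show "(\<lambda>y. indicator {u..} (inner_vec d b y) * F y) \<in> borel_measurable (PiM {..<d} (\<lambda>_. std_normal_distribution))"
      unfolding std_normal_vec_def[symmetric] by measurable
    show "\<bar>indicator {u..} (inner_vec d b x) * F x\<bar> \<le> C" for x
      using C[of x] by (auto simp: indicator_def)
  qed (auto intro: prob_space_std_normal_distribution)
  also have "\<dots> = (\<integral>x. \<integral>y. indicator {y \<in> space ?N. (\<Sum>l=k..<d. b l * y l) \<ge> u - (\<Sum>l<k. b l * x l)} y * F x \<partial>?N \<partial>?N)"
  proof (intro Bochner_Integration.integral_cong refl)
    fix x y assume xy: "x \<in> space ?N" "y \<in> space ?N"
    let ?z = "\<lambda>i. if i \<in> {k..<d} then y i else x i"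
    have "?z \<in> space ?N" using xy by (auto simp: space_std_normal_vec PiE_iff extensional_def)
    then have "F ?z = F x" by (rule dep) (use xy in auto)
    moreover have "(\<Sum>l<k. b l * ?z l) = (\<Sum>l<k. b l * x l)" by (rule sum.cong) auto
    moreover have "(\<Sum>l=k..<d. b l * ?z l) = (\<Sum>l=k..<d. b l * y l)" by (rule sum.cong) auto
    ultimately show "indicator {u..} (inner_vec d b ?z) * F ?z
      = indicator {y \<in> space ?N. (\<Sum>l=k..<d. b l * y l) \<ge> u - (\<Sum>l<k. b l * x l)} y * F x"
      using xy unfolding split by (auto simp: indicator_def)
  qed
  also have "\<dots> = (\<integral>x. measure ?N {y \<in> space ?N. (\<Sum>l=k..<d. b l * y l) \<ge> u - (\<Sum>l<k. b l * x l)} * F x \<partial>?N)"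
    by (intro Bochner_Integration.integral_cong refl) simp
  also have "\<dots> = (\<integral>x. normal_tail ((u - (\<Sum>l<k. b l * x l)) / sqrt (\<Sum>l=k..<d. (b l)\<^sup>2)) * F x \<partial>?N)"
    unfolding std_normal_vec_def using pos by (subst prob_lincomb_ge) auto
  finally show ?thesis .
qed

section \<open>Existence, uniqueness and size of the threshold\<close>

definition inner_tail :: "nat \<Rightarrow> real \<Rightarrow> real" where
  "inner_tail d u = (\<integral>b. normal_tail (u / sqrt (\<Sum>l<d. (b l)\<^sup>2)) \<partial>std_normal_vec d)"

lemma borel_measurable_component_std_normal_vec[measurable]:
  "l < d \<Longrightarrow> (\<lambda>b. b l) \<in> borel_measurable (std_normal_vec d)"
  using measurable_std_normal_vec_component[of "\<lambda>x. x" "std_normal_vec d" d l] by simp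

lemma borel_measurable_sum_squares[measurable]:
  "(\<lambda>b. \<Sum>l<d. (b l)\<^sup>2) \<in> borel_measurable (std_normal_vec d)"
  "(\<lambda>b. \<Sum>l=k..<d. (b l)\<^sup>2) \<in> borel_measurable (std_normal_vec d)"
  by (intro borel_measurable_sum borel_measurable_power borel_measurable_component_std_normal_vec; simp)+

lemma AE_sum_squares_pos:
  assumes "1 \<le> d"
  shows "AE b in std_normal_vec d. 0 < (\<Sum>l<d. (b l)\<^sup>2)"
  using AE_tail_sum_pos[of 0 d] assms by (simp add: lessThan_atLeast0)

lemma borel_measurable_indicator_inner_vec[measurable (raw)]:
  assumes "f \<in> M \<rightarrow>\<^sub>M std_normal_vec d" "g \<in> M \<rightarrow>\<^sub>M std_normal_vec d"
  shows "(\<lambda>x. indicator {u..} (inner_vec d (f x) (g x)) :: real) \<in> borel_measurable M"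
  using measurable_inner_vec[OF assms] by measurable

lemma inner_tail_measurable:
  "(\<lambda>b. normal_tail (u / sqrt (\<Sum>l<d. (b l)\<^sup>2))) \<in> borel_measurable (std_normal_vec d)"
  by measurable

lemma integrable_inner_tail:
  "integrable (std_normal_vec d) (\<lambda>b. normal_tail (u / sqrt (\<Sum>l<d. (b l)\<^sup>2)))"
  using normal_tail_bounds
  by (intro integrable_bounded_prob[where C = 1] prob_space_std_normal_vec inner_tail_measurable) auto

text \<open>Given \<open>b\<close>, the inner product with a Gaussian vector is a centred normal
  variable with standard deviation the length of \<open>b\<close>. This is the case
  \<open>k = 0\<close> of \<open>integral_inner_vec_ge\<close>, and it explains the formula for
  \<open>inner_tail\<close>.\<close>

lemma integral_inner_vec_ge_eq_inner_tail:
  assumes "1 \<le> d"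
  shows "(\<integral>b. \<integral>y. indicator {u..} (inner_vec d b y) \<partial>std_normal_vec d \<partial>std_normal_vec d) = inner_tail d u"
  unfolding inner_tail_def
proof (rule integral_cong_AE)
  interpret prob_space "std_normal_vec d" by (rule prob_space_std_normal_vec)
  show "(\<lambda>b. \<integral>y. (indicator {u..} (inner_vec d b y) :: real) \<partial>std_normal_vec d) \<in> borel_measurable (std_normal_vec d)" by measurable
  show "AE b in std_normal_vec d. (\<integral>y. indicator {u..} (inner_vec d b y) \<partial>std_normal_vec d)
      = normal_tail (u / sqrt (\<Sum>l<d. (b l)\<^sup>2))"
    using AE_sum_squares_pos[OF assms] AE_space
  proof eventually_elim
    case (elim b)
    then show ?case using integral_inner_vec_ge[of 0 d b "\<lambda>_. 1" 1 u] by (simp add: lessThan_atLeast0 prob_space)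
  qed
qed (rule inner_tail_measurable)

lemma prob_inner_vec_ge:
  assumes "1 \<le> d"
  shows "\<P>(z in std_normal_vec d \<Otimes>\<^sub>M std_normal_vec d. inner_vec d (fst z) (snd z) \<ge> u) = inner_tail d u"
proof -
  let ?N = "std_normal_vec d"
  interpret N: prob_space ?N by (rule prob_space_std_normal_vec)
  interpret P: pair_prob_space ?N ?N ..
  have "\<P>(z in ?N \<Otimes>\<^sub>M ?N. inner_vec d (fst z) (snd z) \<ge> u)
    = (\<integral>z. indicator {z \<in> space (?N \<Otimes>\<^sub>M ?N). inner_vec d (fst z) (snd z) \<ge> u} z \<partial>(?N \<Otimes>\<^sub>M ?N))" by simp
  also have "\<dots> = (\<integral>z. indicator {u..} (inner_vec d (fst z) (snd z)) \<partial>(?N \<Otimes>\<^sub>M ?N))"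
    by (intro Bochner_Integration.integral_cong refl) (auto simp: indicator_def)
  also have "\<dots> = (\<integral>b. \<integral>y. indicator {u..} (inner_vec d (fst (b, y)) (snd (b, y))) \<partial>?N \<partial>?N)"
    by (intro P.integral_fst'[symmetric] integrable_bounded_prob[where C = 1] P.prob_space_axioms) (auto simp: indicator_def)
  finally show ?thesis using integral_inner_vec_ge_eq_inner_tail[OF assms] by simp
qed

lemma inner_tail_strict_antimono:
  assumes "1 \<le> d" "u < v" shows "inner_tail d v < inner_tail d u"
proof -
  interpret prob_space "std_normal_vec d" by (rule prob_space_std_normal_vec)
  show ?thesis unfolding inner_tail_def
  proof (rule integral_less_AE_space[OF integrable_inner_tail integrable_inner_tail])
    show "AE b in std_normal_vec d. normal_tail (v / sqrt (\<Sum>l<d. (b l)\<^sup>2)) < normal_tail (u / sqrt (\<Sum>l<d. (b l)\<^sup>2))"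
      using AE_sum_squares_pos[OF assms(1)]
    proof eventually_elim
      case (elim b)
      then show ?case using assms by (intro normal_tail_strict_antimono) (simp add: divide_strict_right_mono)
    qed
  qed (simp add: emeasure_space_1)
qed

text \<open>Dominated convergence under the mixture over \<open>b\<close>. It serves the limits at
  both infinities and continuity, with \<open>g\<close> equal to 0, to 1 and to a normal
  tail.\<close>

lemma inner_tail_sequence:
  assumes "\<And>r. r > 0 \<Longrightarrow> (\<lambda>n. normal_tail (f n / r)) \<longlonglongrightarrow> g r" "1 \<le> d"
    and g: "(\<lambda>b. g (sqrt (\<Sum>l<d. (b l)\<^sup>2))) \<in> borel_measurable (std_normal_vec d)"
  shows "(\<lambda>n. inner_tail d (f n)) \<longlonglongrightarrow> (\<integral>b. g (sqrt (\<Sum>l<d. (b l)\<^sup>2)) \<partial>std_normal_vec d)"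
  unfolding inner_tail_def
proof (rule integral_dominated_convergence[where w = "\<lambda>_. 1"])
  interpret prob_space "std_normal_vec d" by (rule prob_space_std_normal_vec)
  show "integrable (std_normal_vec d) (\<lambda>_. 1 :: real)" by simp
  show "AE b in std_normal_vec d. (\<lambda>n. normal_tail (f n / sqrt (\<Sum>l<d. (b l)\<^sup>2))) \<longlonglongrightarrow> g (sqrt (\<Sum>l<d. (b l)\<^sup>2))"
    using AE_sum_squares_pos[OF assms(2)]
  proof eventually_elim
    case (elim b)
    then show ?case by (intro assms) simp
  qed
  show "AE b in std_normal_vec d. norm (normal_tail (f n / sqrt (\<Sum>l<d. (b l)\<^sup>2))) \<le> 1" for n
    using normal_tail_bounds by auto
qed (use g in measurable)

lemma inner_tail_surj:
  assumes "1 \<le> d" "0 < p" "p < 1"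
  shows "\<exists>u. inner_tail d u = p"
proof -
  interpret prob_space "std_normal_vec d" by (rule prob_space_std_normal_vec)
  have "(\<lambda>n. inner_tail d (real n)) \<longlonglongrightarrow> (\<integral>b. (\<lambda>_. 0) (sqrt (\<Sum>l<d. (b l)\<^sup>2)) \<partial>std_normal_vec d)"
  proof (rule inner_tail_sequence[OF _ assms(1)])
    fix r :: real assume "0 < r"
    then have "filterlim (\<lambda>n. inverse r * real n) at_top sequentially"
      by (intro filterlim_tendsto_pos_mult_at_top[OF tendsto_const] filterlim_real_sequentially) auto
    then show "(\<lambda>n. normal_tail (real n / r)) \<longlonglongrightarrow> 0"
      using filterlim_compose[OF normal_tail_at_top] by (simp add: divide_inverse mult.commute)
  qed simp
  then have "(\<lambda>n. inner_tail d (real n)) \<longlonglongrightarrow> 0" by simp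
  then obtain n where n: "inner_tail d (real n) < p"
    using order_tendstoD(2)[of _ 0 sequentially p] assms eventually_happens[of _ sequentially] by fastforce
  have "(\<lambda>n. inner_tail d (- real n)) \<longlonglongrightarrow> (\<integral>b. (\<lambda>_. 1) (sqrt (\<Sum>l<d. (b l)\<^sup>2)) \<partial>std_normal_vec d)"
  proof (rule inner_tail_sequence[OF _ assms(1)])
    fix r :: real assume "0 < r"
    have "filterlim (\<lambda>n. inverse r * real n) at_top sequentially"
      using \<open>0 < r\<close> by (intro filterlim_tendsto_pos_mult_at_top[OF tendsto_const] filterlim_real_sequentially) auto
    then have "filterlim (\<lambda>n. - (inverse r * real n)) at_bot sequentially"
      by (simp add: filterlim_uminus_at_top)
    then show "(\<lambda>n. normal_tail (- real n / r)) \<longlonglongrightarrow> 1"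
      using filterlim_compose[OF normal_tail_at_bot] by (simp add: divide_inverse mult.commute)
  qed simp
  then have "(\<lambda>n. inner_tail d (- real n)) \<longlonglongrightarrow> 1" using prob_space by simp
  then obtain m where m: "inner_tail d (- real m) > p"
    using order_tendstoD(1)[of _ 1 sequentially p] assms eventually_happens[of _ sequentially] by fastforce
  have "isCont (inner_tail d) x" for x
    unfolding continuous_at_sequentially comp_def
  proof (intro allI impI)
    fix f assume f: "f \<longlonglongrightarrow> x"
    show "(\<lambda>n. inner_tail d (f n)) \<longlonglongrightarrow> inner_tail d x"
      unfolding inner_tail_def[of d x]
    proof (rule inner_tail_sequence[where g = "\<lambda>r. normal_tail (x / r)", OF _ assms(1)])
      show "(\<lambda>n. normal_tail (f n / r)) \<longlonglongrightarrow> normal_tail (x / r)" if "r > 0" for r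
        using f that by (intro isCont_tendsto_compose[OF isCont_normal_tail] tendsto_divide tendsto_const) auto
    qed measurable
  qed
  then show ?thesis
    using IVT2[of "inner_tail d" "real n" p "- real m"] n m by auto
qed

text \<open>The definite description is resolved here by existence and strict monotonicity; every
  later fact about the value of the threshold comes from this equation.\<close>

lemma inner_tail_threshold:
  assumes "1 \<le> d" "0 < p" "p < 1"
  shows "inner_tail d (threshold p d) = p"
proof -
  obtain u where u: "inner_tail d u = p" using inner_tail_surj[OF assms] by auto
  have "v = u" if "inner_tail d v = p" for v
    using inner_tail_strict_antimono[OF assms(1), of u v] inner_tail_strict_antimono[OF assms(1), of v u] that u
    by (cases u v rule: linorder_cases) auto
  then have "threshold p d = u"
    unfolding threshold_def prob_inner_vec_ge[OF assms(1)] by (intro the_equality u)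
  then show ?thesis using u by simp
qed

lemma normal_tail_chebyshev:
  "t > 0 \<Longrightarrow> normal_tail t * t\<^sup>2 \<le> 1" "t < 0 \<Longrightarrow> (1 - normal_tail t) * t\<^sup>2 \<le> 1"
proof -
  interpret prob_space std_normal_distribution by (rule prob_space_std_normal_distribution)
  have *: "measure std_normal_distribution A * t\<^sup>2 \<le> 1"
    if A: "A \<in> sets borel" "\<And>z. z \<in> A \<Longrightarrow> \<bar>t\<bar> \<le> \<bar>z\<bar>" for A
  proof -
    have "measure std_normal_distribution A * t\<^sup>2 = (\<integral>z. indicator A z * t\<^sup>2 \<partial>std_normal_distribution)"
      using A by simp
    also have "\<dots> \<le> (\<integral>z. z\<^sup>2 \<partial>std_normal_distribution)"
    proof (rule integral_mono)
      show "integrable std_normal_distribution (\<lambda>z. indicator A z * t\<^sup>2)"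
        using A by (intro integrable_bounded_prob[where C = "t\<^sup>2"] prob_space_axioms) (auto simp: indicator_def)
      show "indicator A z * t\<^sup>2 \<le> z\<^sup>2" for z
        using A(2)[of z] by (simp add: indicator_def abs_le_square_iff)
    qed (rule std_normal_moments)
    finally show ?thesis using std_normal_moments by simp
  qed
  show "normal_tail t * t\<^sup>2 \<le> 1" if "t > 0" unfolding normal_tail_def by (rule *) (use that in auto)
  show "(1 - normal_tail t) * t\<^sup>2 \<le> 1" if "t < 0"
  proof -
    have "1 - normal_tail t = prob (space std_normal_distribution - {t..})"
      unfolding normal_tail_def by (subst prob_compl) auto
    then show ?thesis by simp (rule *, use that in auto)
  qed
qed

lemma integral_component_square:
  assumes "L \<subseteq> {..<d}"
  shows "integrable (std_normal_vec d) (\<lambda>b. \<Sum>l\<in>L. (b l)\<^sup>2)"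
    and "(\<integral>b. (\<Sum>l\<in>L. (b l)\<^sup>2) \<partial>std_normal_vec d) = real (card L)"
proof -
  have 1: "integrable (std_normal_vec d) (\<lambda>b. (b l)\<^sup>2) \<and> (\<integral>b. (b l)\<^sup>2 \<partial>std_normal_vec d) = 1" if "l \<in> L" for l
    using integral_square_sum[OF _ _ std_normal_moments(1,3,2), of "{..<d}" "{l}" "\<lambda>_. 1"] std_normal_moments(4) assms that
    by (simp add: std_normal_vec_def subset_eq)
  then show "integrable (std_normal_vec d) (\<lambda>b. \<Sum>l\<in>L. (b l)\<^sup>2)" by simp
  show "(\<integral>b. (\<Sum>l\<in>L. (b l)\<^sup>2) \<partial>std_normal_vec d) = real (card L)"
    using 1 by (subst Bochner_Integration.integral_sum) auto
qed

text \<open>Chebyshev's inequality given \<open>b\<close>, integrated over \<open>b\<close>, yields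
  \<open>p * u\<^sup>2 \<le> d\<close> for \<open>u > 0\<close> and
  \<open>(1 - p) * u\<^sup>2 \<le> d\<close> for \<open>u < 0\<close>; the factor
  \<open>p * (1 - p)\<close> covers both signs. So the threshold is at most of the order of the
  standard deviation \<open>sqrt d\<close> of the inner product.\<close>

lemma threshold_square_le:
  assumes d: "1 \<le> d" and p: "0 < p" "p < 1"
  shows "(threshold p d)\<^sup>2 \<le> real d / (p * (1 - p))"
proof -
  interpret prob_space "std_normal_vec d" by (rule prob_space_std_normal_vec)
  define u where "u = threshold p d"
  have p': "inner_tail d u = p" using inner_tail_threshold[OF assms] by (simp add: u_def)
  note i = integral_component_square[of "{..<d}" d]
  note pos = AE_sum_squares_pos[OF d]
  have 1: "p * u\<^sup>2 \<le> d" if "u > 0"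
  proof -
    have "inner_tail d u * u\<^sup>2 = (\<integral>b. normal_tail (u / sqrt (\<Sum>l<d. (b l)\<^sup>2)) * u\<^sup>2 \<partial>std_normal_vec d)"
      unfolding inner_tail_def by simp
    also have "\<dots> \<le> (\<integral>b. (\<Sum>l<d. (b l)\<^sup>2) \<partial>std_normal_vec d)"
    proof (rule integral_mono_AE)
      show "AE b in std_normal_vec d. normal_tail (u / sqrt (\<Sum>l<d. (b l)\<^sup>2)) * u\<^sup>2 \<le> (\<Sum>l<d. (b l)\<^sup>2)"
        using pos
      proof eventually_elim
        case (elim b)
        then show ?case using normal_tail_chebyshev(1)[of "u / sqrt (\<Sum>l<d. (b l)\<^sup>2)"] that
          by (auto simp: power_divide field_simps)
      qed
    qed (use i integrable_inner_tail in auto)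
    finally show ?thesis using p' i by simp
  qed
  have 2: "(1 - p) * u\<^sup>2 \<le> d" if "u < 0"
  proof -
    have "(1 - inner_tail d u) * u\<^sup>2 = (\<integral>b. (1 - normal_tail (u / sqrt (\<Sum>l<d. (b l)\<^sup>2))) * u\<^sup>2 \<partial>std_normal_vec d)"
      unfolding inner_tail_def using integrable_inner_tail by (simp add: prob_space)
    also have "\<dots> \<le> (\<integral>b. (\<Sum>l<d. (b l)\<^sup>2) \<partial>std_normal_vec d)"
    proof (rule integral_mono_AE)
      show "AE b in std_normal_vec d. (1 - normal_tail (u / sqrt (\<Sum>l<d. (b l)\<^sup>2))) * u\<^sup>2 \<le> (\<Sum>l<d. (b l)\<^sup>2)"
        using pos
      proof eventually_elim
        case (elim b)
        then have "u / sqrt (\<Sum>l<d. (b l)\<^sup>2) < 0" using that by (simp add: divide_neg_pos)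
        from normal_tail_chebyshev(2)[OF this] show ?case using elim
          by (auto simp: power_divide field_simps)
      qed
    qed (use i integrable_inner_tail in auto)
    finally show ?thesis using p' i by simp
  qed
  consider "u > 0" | "u < 0" | "u = 0" by linarith
  then have "p * (1 - p) * u\<^sup>2 \<le> d"
  proof cases
    case 1
    have "p * (1 - p) * u\<^sup>2 \<le> p * 1 * u\<^sup>2" using p by (intro mult_right_mono mult_left_mono) auto
    then show ?thesis using \<open>u > 0 \<Longrightarrow> p * u\<^sup>2 \<le> d\<close> 1 by simp
  next
    case 2
    have "p * (1 - p) * u\<^sup>2 \<le> 1 * (1 - p) * u\<^sup>2" using p by (intro mult_right_mono) auto
    then show ?thesis using \<open>u < 0 \<Longrightarrow> (1 - p) * u\<^sup>2 \<le> d\<close> 2 by simp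
  qed simp
  then show ?thesis using p by (simp add: u_def field_simps)
qed

text \<open>The conditional expectation of the centred edge indicator between \<open>b\<close> and
  \<open>y\<close>, given \<open>b\<close> and the first \<open>k\<close> coordinates of
  \<open>y\<close>.\<close>

definition tail_error :: "real \<Rightarrow> nat \<Rightarrow> nat \<Rightarrow> (nat \<Rightarrow> real) \<Rightarrow> (nat \<Rightarrow> real) \<Rightarrow> real" where
  "tail_error p d k b y = normal_tail ((threshold p d - (\<Sum>l<k. b l * y l)) / sqrt (\<Sum>l=k..<d. (b l)\<^sup>2)) - p"

lemma abs_tail_error_le:
  assumes "0 < p" "p < 1" shows "\<bar>tail_error p d k b y\<bar> \<le> 1"
  using normal_tail_bounds[of "(threshold p d - (\<Sum>l<k. b l * y l)) / sqrt (\<Sum>l=k..<d. (b l)\<^sup>2)"] assms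
  by (auto simp: tail_error_def)

lemma borel_measurable_tail_error[measurable (raw)]:
  assumes "f \<in> M \<rightarrow>\<^sub>M std_normal_vec d" "g \<in> M \<rightarrow>\<^sub>M std_normal_vec d" "k \<le> d"
  shows "(\<lambda>x. tail_error p d k (f x) (g x)) \<in> borel_measurable M"
proof -
  have 1: "(\<lambda>x. \<Sum>l<k. f x l * g x l) \<in> borel_measurable M"
    by (intro borel_measurable_sum borel_measurable_times measurable_std_normal_vec_component[of _ _ d]) (use assms in auto)
  have 2: "(\<lambda>x. \<Sum>l=k..<d. (f x l)\<^sup>2) \<in> borel_measurable M"
    by (intro borel_measurable_sum borel_measurable_power measurable_std_normal_vec_component[of _ _ d]) (use assms in auto)
  show ?thesis unfolding tail_error_def using 1 2 by measurable
qed

lemma power2_add_le: "(a + b)\<^sup>2 \<le> 2 * a\<^sup>2 + 2 * b\<^sup>2" for a b :: real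
  using zero_le_power2[of "a - b"] by (simp add: power2_sum power2_diff)

text \<open>If \<open>S \<ge> d / 2\<close>, the normal tail is 1-Lipschitz and both denominators
  are at least of order \<open>sqrt d\<close>; otherwise \<open>(d - S)\<^sup>2\<close> is at least
  \<open>d\<^sup>2 / 4\<close> and the trivial bound 1 is paid for by the second term. The
  \<open>+ 1\<close> in \<open>K + 1\<close> serves that second case, where \<open>K\<close> may be
  small.\<close>

lemma normal_tail_compare:
  assumes d: "1 \<le> d" and u: "u\<^sup>2 \<le> K * real d" and S: "0 \<le> S"
  shows "(normal_tail ((u - m) / sqrt S) - normal_tail (u / sqrt d))\<^sup>2
    \<le> 4 * m\<^sup>2 / d + 4 * (K + 1) * (d - S)\<^sup>2 / (real d)\<^sup>2"
proof -
  have "0 \<le> K * real d" using u zero_le_power2[of u] by linarith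
  then have K: "0 \<le> K" using d by (simp add: zero_le_mult_iff)
  show ?thesis
  proof (cases "S \<ge> d / 2")
    case True
    define s where "s = sqrt S"
    define r where "r = sqrt d"
    have s: "s > 0" "s\<^sup>2 = S" and r: "r > 0" "r\<^sup>2 = d" using True d S by (auto simp: s_def r_def)
    have "\<bar>normal_tail ((u - m) / s) - normal_tail (u / r)\<bar> \<le> \<bar>(u - m) / s - u / r\<bar>"
      by (rule normal_tail_lipschitz)
    then have "(normal_tail ((u - m) / s) - normal_tail (u / r))\<^sup>2 \<le> ((u - m) / s - u / r)\<^sup>2"
      by (simp add: abs_le_square_iff)
    also have "\<dots> = (- (m / s) + u * (r - s) / (s * r))\<^sup>2"
      using s r by (intro arg_cong[where f = "\<lambda>x. x\<^sup>2"]) (simp add: field_simps)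
    also have "\<dots> \<le> 2 * (m / s)\<^sup>2 + 2 * (u * (r - s) / (s * r))\<^sup>2"
      using power2_add_le[of "- (m / s)" "u * (r - s) / (s * r)"] by simp
    finally have main: "(normal_tail ((u - m) / s) - normal_tail (u / r))\<^sup>2 \<le> 2 * (m / s)\<^sup>2 + 2 * (u * (r - s) / (s * r))\<^sup>2" .
    have A: "(m / s)\<^sup>2 \<le> 2 * m\<^sup>2 / d"
    proof -
      have "(m / s)\<^sup>2 = m\<^sup>2 / S" using s by (simp add: power_divide)
      also have "\<dots> \<le> m\<^sup>2 / (d / 2)" using True d by (intro divide_left_mono) auto
      finally show ?thesis by (simp add: mult.commute)
    qed
    have B: "(u * (r - s) / (s * r))\<^sup>2 \<le> 2 * K * (d - S)\<^sup>2 / (real d)\<^sup>2"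
    proof -
      \<comment> \<open>Replacing the factor \<open>r\<close> by \<open>r + s\<close> turns the
        difference of square roots into the difference \<open>d - S\<close>.\<close>
      have "((r - s) * r)\<^sup>2 \<le> ((r - s) * (r + s))\<^sup>2"
        unfolding power_mult_distrib using s r by (intro mult_left_mono power_mono) auto
      also have "(r - s) * (r + s) = d - S" using s(2) r(2) by (simp add: power2_eq_square algebra_simps)
      finally have 1: "((r - s) * r)\<^sup>2 \<le> (d - S)\<^sup>2" .
      have "(u * (r - s) / (s * r))\<^sup>2 = (u * ((r - s) * r))\<^sup>2 / (s * r\<^sup>2)\<^sup>2"
      proof -
        have "u * (r - s) / (s * r) = (u * ((r - s) * r)) / (s * r\<^sup>2)"
          using r(1) by (simp add: power2_eq_square)
        then show ?thesis by (simp only: power_divide)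
      qed
      also have "\<dots> = u\<^sup>2 * ((r - s) * r)\<^sup>2 / (S * (real d)\<^sup>2)"
        unfolding power_mult_distrib[of u] power_mult_distrib[of s] r(2) s(2) ..
      also have "\<dots> \<le> (K * d) * (d - S)\<^sup>2 / (S * (real d)\<^sup>2)"
        using u 1 S K by (intro divide_right_mono mult_mono) auto
      also have "\<dots> = K * (d - S)\<^sup>2 / (S * d)"
        using d by (simp add: power2_eq_square)
      also have "\<dots> \<le> K * (d - S)\<^sup>2 / ((d / 2) * d)"
        using True d K by (intro divide_left_mono mult_right_mono) auto
      also have "\<dots> = 2 * K * (d - S)\<^sup>2 / (real d)\<^sup>2" by (simp add: power2_eq_square[of "real d"])
      finally show ?thesis .
    qed
    have "4 * K * (d - S)\<^sup>2 / (real d)\<^sup>2 \<le> 4 * (K + 1) * (d - S)\<^sup>2 / (real d)\<^sup>2"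
      by (intro divide_right_mono mult_right_mono) auto
    then show ?thesis using main A B by (simp add: s_def r_def)
  next
    case False
    have "\<bar>normal_tail ((u - m) / sqrt S) - normal_tail (u / sqrt d)\<bar> \<le> 1"
      using normal_tail_bounds[of "(u - m) / sqrt S"] normal_tail_bounds[of "u / sqrt d"] by linarith
    then have "(normal_tail ((u - m) / sqrt S) - normal_tail (u / sqrt d))\<^sup>2 \<le> 1" by (simp add: abs_square_le_1)
    also have "1 \<le> 4 * (d - S)\<^sup>2 / (real d)\<^sup>2"
    proof -
      have "(d / 2)\<^sup>2 \<le> (d - S)\<^sup>2" using False S by (intro power_mono) auto
      then show ?thesis using d by (simp add: power2_eq_square field_simps)
    qed
    also have "4 * (d - S)\<^sup>2 / (real d)\<^sup>2 \<le> 4 * (K + 1) * (d - S)\<^sup>2 / (real d)\<^sup>2"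
      using K by (intro divide_right_mono mult_right_mono) auto
    also have "\<dots> \<le> 4 * m\<^sup>2 / d + 4 * (K + 1) * (d - S)\<^sup>2 / (real d)\<^sup>2" by simp
    finally show ?thesis by simp
  qed
qed

text \<open>The deviation is a bias \<open>k\<close>, from the missing coordinates, plus a centred
  sum whose variance is \<open>2 * (d - k)\<close>.\<close>

lemma integral_tail_sum_deviation:
  assumes "k \<le> d"
  shows "integrable (std_normal_vec d) (\<lambda>b. (real d - (\<Sum>l=k..<d. (b l)\<^sup>2))\<^sup>2)"
    and "(\<integral>b. (real d - (\<Sum>l=k..<d. (b l)\<^sup>2))\<^sup>2 \<partial>std_normal_vec d) \<le> 2 * (real k)\<^sup>2 + 4 * real d"
proof -
  let ?N = "std_normal_vec d"
  interpret prob_space ?N by (rule prob_space_std_normal_vec)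
  define T where "T b = (\<Sum>l=k..<d. 1 * (1 - (b l)\<^sup>2))" for b :: "nat \<Rightarrow> real"
  have eq: "real d - (\<Sum>l=k..<d. (b l)\<^sup>2) = k + T b" for b
    using assms by (simp add: T_def sum_subtractf of_nat_diff)
  have T2: "integrable ?N (\<lambda>b. (T b)\<^sup>2)" "(\<integral>b. (T b)\<^sup>2 \<partial>?N) = 2 * real (d - k)"
    unfolding T_def std_normal_vec_def
    using integral_square_sum[OF _ _ std_normal_moments(5,7,6), of "{..<d}" "{k..<d}" "\<lambda>_. 1"] std_normal_moments(8)
    by (simp_all add: subset_eq)
  have le: "(real d - (\<Sum>l=k..<d. (b l)\<^sup>2))\<^sup>2 \<le> 2 * (real k)\<^sup>2 + 2 * (T b)\<^sup>2" for b
    unfolding eq by (rule power2_add_le)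
  have int: "integrable ?N (\<lambda>b. 2 * (real k)\<^sup>2 + 2 * (T b)\<^sup>2)" using T2 by auto
  show i: "integrable ?N (\<lambda>b. (real d - (\<Sum>l=k..<d. (b l)\<^sup>2))\<^sup>2)"
    by (rule Bochner_Integration.integrable_bound[OF int]) (use le in auto)
  have "(\<integral>b. (real d - (\<Sum>l=k..<d. (b l)\<^sup>2))\<^sup>2 \<partial>?N) \<le> (\<integral>b. 2 * (real k)\<^sup>2 + 2 * (T b)\<^sup>2 \<partial>?N)"
    by (rule integral_mono[OF i int]) (rule le)
  also have "\<dots> = 2 * (real k)\<^sup>2 + 4 * real (d - k)" using T2 by (simp add: prob_space)
  finally show "(\<integral>b. (real d - (\<Sum>l=k..<d. (b l)\<^sup>2))\<^sup>2 \<partial>?N) \<le> 2 * (real k)\<^sup>2 + 4 * real d" using assms by simp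
qed

text \<open>The summand \<open>1 / (p * (1 - p))\<close> is the bound for the squared threshold
  divided by \<open>d\<close>; 16 is large enough to absorb the numerical factors at the end of
  \<open>integral_tail_error_square\<close>.\<close>

definition edge_const :: "real \<Rightarrow> real" where
  "edge_const p = 16 * (1 / (p * (1 - p)) + 1)"

lemma edge_const_ge: "0 < p \<Longrightarrow> p < 1 \<Longrightarrow> 16 \<le> edge_const p"
  by (simp add: edge_const_def)

text \<open>The mean of the error vanishes, so its second moment is at most the second moment of the
  deviation of the Gaussian tail from the constant \<open>normal_tail (threshold p d / sqrt d)\<close>.\<close>

lemma integral_tail_error_square:
  assumes d: "k < d" and p: "0 < p" "p < 1"
  shows "(\<integral>b. \<integral>y. (tail_error p d k b y)\<^sup>2 \<partial>std_normal_vec d \<partial>std_normal_vec d)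
    \<le> edge_const p * (real k + 1) / real d"
proof -
  let ?N = "std_normal_vec d"
  interpret N: prob_space ?N by (rule prob_space_std_normal_vec)
  define K where "K = 1 / (p * (1 - p))"
  have K: "0 \<le> K" using p by (simp add: K_def)
  define u where "u = threshold p d"
  define c where "c = normal_tail (u / sqrt d)"
  have d1: "1 \<le> d" using d by simp
  have u: "u\<^sup>2 \<le> K * d" using threshold_square_le[OF d1 p] by (simp add: u_def K_def)
  let ?e = "tail_error p d k"
  define h where "h b y = ?e b y + (p - c)" for b y
  have h: "h b y = normal_tail ((u - (\<Sum>l<k. b l * y l)) / sqrt (\<Sum>l=k..<d. (b l)\<^sup>2)) - c" for b y
    by (simp add: h_def tail_error_def u_def)
  note e1 = abs_tail_error_le[OF p, of d k]
  have c01: "0 \<le> c" "c \<le> 1" using normal_tail_bounds by (auto simp: c_def)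
  have h1: "\<bar>h b y\<bar> \<le> 1" for b y
    unfolding h using c01 normal_tail_bounds[of "(u - (\<Sum>l<k. b l * y l)) / sqrt (\<Sum>l=k..<d. (b l)\<^sup>2)"] by linarith
  have kd: "k \<le> d" using d by simp
  have e_m[measurable]: "(\<lambda>y. ?e b y) \<in> borel_measurable ?N" if "b \<in> space ?N" for b
    using that kd by measurable
  have e_m2[measurable]: "(\<lambda>(b, y). ?e b y) \<in> borel_measurable (?N \<Otimes>\<^sub>M ?N)"
    unfolding case_prod_beta using kd by measurable
  have int_y: "integrable ?N (\<lambda>y. ?e b y)" if "b \<in> space ?N" for b
    by (rule integrable_bounded_prob[where C = 1]) (use that e1 in \<open>auto intro: N.prob_space_axioms\<close>)
  have int_y2: "integrable ?N (\<lambda>y. (?e b y)\<^sup>2)" if "b \<in> space ?N" for b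
    by (rule integrable_bounded_prob[where C = 1]) (use that e1 in \<open>auto intro: N.prob_space_axioms simp: abs_square_le_1\<close>)
  \<comment> \<open>The defining equation of the threshold enters here: averaged over both vectors,
    the conditional edge probability is exactly \<open>p\<close>.\<close>
  have mean: "(\<integral>b. \<integral>y. ?e b y \<partial>?N \<partial>?N) = 0"
  proof -
    have "(\<integral>b. \<integral>y. ?e b y \<partial>?N \<partial>?N) = (\<integral>b. (\<integral>y. indicator {u..} (inner_vec d b y) \<partial>?N) - p \<partial>?N)"
    proof (rule integral_cong_AE)
      show "AE b in ?N. (\<integral>y. ?e b y \<partial>?N) = (\<integral>y. indicator {u..} (inner_vec d b y) \<partial>?N) - p"
        using AE_tail_sum_pos[OF d] AE_space
      proof eventually_elim
        case (elim b)
        have "(\<integral>y. indicator {u..} (inner_vec d b y) \<partial>?N) = (\<integral>y. ?e b y + p \<partial>?N)"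
          using integral_inner_vec_ge[of k d b "\<lambda>_. 1" 1 u] elim kd by (simp add: tail_error_def u_def)
        also have "\<dots> = (\<integral>y. ?e b y \<partial>?N) + p"
          using int_y[of b] elim by (simp add: N.prob_space)
        finally show ?case by simp
      qed
    qed measurable
    also have "\<dots> = inner_tail d u - p"
      unfolding integral_inner_vec_ge_eq_inner_tail[OF d1, symmetric]
      by (subst Bochner_Integration.integral_diff)
         (auto simp: N.prob_space intro!: integrable_bounded_prob[where C = 1] N.prob_space_axioms abs_integral_le_bound)
    also have "\<dots> = 0" using inner_tail_threshold[OF d1 p] by (simp add: u_def)
    finally show ?thesis .
  qed
  have hy: "(\<integral>y. (h b y)\<^sup>2 \<partial>?N) = (\<integral>y. (?e b y)\<^sup>2 \<partial>?N) + 2 * (p - c) * (\<integral>y. ?e b y \<partial>?N) + (p - c)\<^sup>2"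
    if "b \<in> space ?N" for b
  proof -
    have "(\<integral>y. (h b y)\<^sup>2 \<partial>?N) = (\<integral>y. (?e b y)\<^sup>2 + 2 * (p - c) * ?e b y + (p - c)\<^sup>2 \<partial>?N)"
      by (intro Bochner_Integration.integral_cong refl) (simp add: h_def power2_sum mult_ac)
    then show ?thesis using int_y[OF that] int_y2[OF that] by (simp add: N.prob_space)
  qed
  have int_b: "integrable ?N (\<lambda>b. \<integral>y. ?e b y \<partial>?N)" "integrable ?N (\<lambda>b. \<integral>y. (?e b y)\<^sup>2 \<partial>?N)"
  proof -
    show "integrable ?N (\<lambda>b. \<integral>y. ?e b y \<partial>?N)"
    proof (rule integrable_bounded_prob[OF N.prob_space_axioms, where C = 1])
      show "\<bar>\<integral>y. ?e b y \<partial>?N\<bar> \<le> 1" for b by (rule abs_integral_le_bound[OF N.prob_space_axioms e1])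
    qed measurable
    show "integrable ?N (\<lambda>b. \<integral>y. (?e b y)\<^sup>2 \<partial>?N)"
    proof (rule integrable_bounded_prob[OF N.prob_space_axioms, where C = 1])
      show "\<bar>\<integral>y. (?e b y)\<^sup>2 \<partial>?N\<bar> \<le> 1" for b
        by (rule abs_integral_le_bound[OF N.prob_space_axioms]) (use e1 in \<open>simp add: abs_square_le_1\<close>)
    qed measurable
  qed
  have "(\<integral>b. \<integral>y. (h b y)\<^sup>2 \<partial>?N \<partial>?N) = (\<integral>b. (\<integral>y. (?e b y)\<^sup>2 \<partial>?N) + 2 * (p - c) * (\<integral>y. ?e b y \<partial>?N) + (p - c)\<^sup>2 \<partial>?N)"
    by (intro Bochner_Integration.integral_cong refl hy)
  also have "\<dots> = (\<integral>b. \<integral>y. (?e b y)\<^sup>2 \<partial>?N \<partial>?N) + (p - c)\<^sup>2"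
    using int_b mean by (simp add: N.prob_space)
  finally have "(\<integral>b. \<integral>y. (?e b y)\<^sup>2 \<partial>?N \<partial>?N) \<le> (\<integral>b. \<integral>y. (h b y)\<^sup>2 \<partial>?N \<partial>?N)" by simp
  also have "\<dots> \<le> (\<integral>b. 4 / d * (\<Sum>l<k. (b l)\<^sup>2) + 4 * (K + 1) / (real d)\<^sup>2 * (d - (\<Sum>l=k..<d. (b l)\<^sup>2))\<^sup>2 \<partial>?N)"
  proof (rule integral_mono)
    show "integrable ?N (\<lambda>b. \<integral>y. (h b y)\<^sup>2 \<partial>?N)"
      using int_b hy by (subst Bochner_Integration.integrable_cong[OF refl hy]) auto
    show "integrable ?N (\<lambda>b. 4 / d * (\<Sum>l<k. (b l)\<^sup>2) + 4 * (K + 1) / (real d)\<^sup>2 * (d - (\<Sum>l=k..<d. (b l)\<^sup>2))\<^sup>2)"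
      by (intro Bochner_Integration.integrable_add integrable_mult_right integral_tail_sum_deviation integral_component_square) (use d in auto)
    fix b assume b: "b \<in> space ?N"
    have m2: "integrable ?N (\<lambda>y. (\<Sum>l<k. b l * y l)\<^sup>2)" "(\<integral>y. (\<Sum>l<k. b l * y l)\<^sup>2 \<partial>?N) = (\<Sum>l<k. (b l)\<^sup>2)"
      using integral_square_sum[OF _ _ std_normal_moments(1,3,2), of "{..<d}" "{..<k}" b] std_normal_moments(4) d
      by (simp_all add: std_normal_vec_def subset_eq)
    have "(\<integral>y. (h b y)\<^sup>2 \<partial>?N) \<le> (\<integral>y. 4 / d * (\<Sum>l<k. b l * y l)\<^sup>2 + 4 * (K + 1) / (real d)\<^sup>2 * (d - (\<Sum>l=k..<d. (b l)\<^sup>2))\<^sup>2 \<partial>?N)"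
    proof (rule integral_mono)
      show "integrable ?N (\<lambda>y. (h b y)\<^sup>2)"
        by (rule integrable_bounded_prob[where C = 1]) (use b h1 in \<open>auto intro!: N.prob_space_axioms simp: abs_square_le_1 h_def\<close>)
      show "integrable ?N (\<lambda>y. 4 / d * (\<Sum>l<k. b l * y l)\<^sup>2 + 4 * (K + 1) / (real d)\<^sup>2 * (d - (\<Sum>l=k..<d. (b l)\<^sup>2))\<^sup>2)"
        using m2 by auto
      show "(h b y)\<^sup>2 \<le> 4 / d * (\<Sum>l<k. b l * y l)\<^sup>2 + 4 * (K + 1) / (real d)\<^sup>2 * (d - (\<Sum>l=k..<d. (b l)\<^sup>2))\<^sup>2" for y
        using normal_tail_compare[OF d1 u, of "\<Sum>l=k..<d. (b l)\<^sup>2" "\<Sum>l<k. b l * y l"]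
        unfolding h c_def by (simp add: sum_nonneg)
    qed
    also have "\<dots> = 4 / d * (\<Sum>l<k. (b l)\<^sup>2) + 4 * (K + 1) / (real d)\<^sup>2 * (d - (\<Sum>l=k..<d. (b l)\<^sup>2))\<^sup>2"
      using m2 by (simp add: N.prob_space)
    finally show "(\<integral>y. (h b y)\<^sup>2 \<partial>?N) \<le> 4 / d * (\<Sum>l<k. (b l)\<^sup>2) + 4 * (K + 1) / (real d)\<^sup>2 * (d - (\<Sum>l=k..<d. (b l)\<^sup>2))\<^sup>2" .
  qed
  also have "\<dots> = 4 / d * (\<integral>b. (\<Sum>l<k. (b l)\<^sup>2) \<partial>?N) + 4 * (K + 1) / (real d)\<^sup>2 * (\<integral>b. (d - (\<Sum>l=k..<d. (b l)\<^sup>2))\<^sup>2 \<partial>?N)"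
    using integral_tail_sum_deviation[OF kd] integral_component_square[of "{..<k}" d] d
    by (subst Bochner_Integration.integral_add) auto
  also have "\<dots> \<le> 4 / d * k + 4 * (K + 1) / (real d)\<^sup>2 * (2 * (real k)\<^sup>2 + 4 * real d)"
    using integral_tail_sum_deviation[OF kd] integral_component_square[of "{..<k}" d] d K
    by (intro add_mono mult_left_mono) auto
  \<comment> \<open>As \<open>k < d\<close>, the squared bias \<open>k\<^sup>2 / d\<^sup>2\<close>
    is at most \<open>k / d\<close>, the order of the first term.\<close>
  also have "\<dots> \<le> 4 / d * k + 4 * (K + 1) / (real d)\<^sup>2 * (2 * (real k * d) + 4 * real d)"
    using d K by (intro add_mono mult_left_mono) (auto simp: power2_eq_square intro!: mult_left_mono)
  also have "\<dots> = (4 * k + 8 * (K + 1) * k + 16 * (K + 1)) / d"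
    using d by (simp add: power2_eq_square field_simps)
  also have "\<dots> \<le> 16 * (K + 1) * (k + 1) / d"
    using K by (intro divide_right_mono) (auto simp: algebra_simps)
  finally show ?thesis by (simp add: edge_const_def K_def add.commute)
qed

subsection \<open>Rotation invariance\<close>

lemma nn_integral_shear1:
  fixes f :: "real \<times> real \<Rightarrow> ennreal"
  assumes [measurable]: "f \<in> borel_measurable (borel \<Otimes>\<^sub>M borel)"
  shows "(\<integral>\<^sup>+y. \<integral>\<^sup>+z. f (y, z + t * y) \<partial>lborel \<partial>lborel) = (\<integral>\<^sup>+y. \<integral>\<^sup>+z. f (y, z) \<partial>lborel \<partial>lborel)"
proof (rule nn_integral_cong)
  fix y :: real
  have "(\<integral>\<^sup>+z. f (y, z) \<partial>lborel) = (\<integral>\<^sup>+z. f (y, t * y + 1 * z) \<partial>lborel)"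
    by (subst nn_integral_real_affine[where c = 1 and t = "t * y"]) auto
  then show "(\<integral>\<^sup>+z. f (y, z + t * y) \<partial>lborel) = (\<integral>\<^sup>+z. f (y, z) \<partial>lborel)" by (simp add: add.commute)
qed

lemma nn_integral_shear2:
  fixes f :: "real \<times> real \<Rightarrow> ennreal"
  assumes f[measurable]: "f \<in> borel_measurable (borel \<Otimes>\<^sub>M borel)"
  shows "(\<integral>\<^sup>+y. \<integral>\<^sup>+z. f (y + t * z, z) \<partial>lborel \<partial>lborel) = (\<integral>\<^sup>+y. \<integral>\<^sup>+z. f (y, z) \<partial>lborel \<partial>lborel)"
proof -
  have swap: "(\<integral>\<^sup>+y. \<integral>\<^sup>+z. g (y, z) \<partial>lborel \<partial>lborel) = (\<integral>\<^sup>+z. \<integral>\<^sup>+y. g (y, z) \<partial>lborel \<partial>lborel)"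
    if [measurable]: "g \<in> borel_measurable (borel \<Otimes>\<^sub>M borel)" for g :: "real \<times> real \<Rightarrow> ennreal"
  proof -
    have "g \<in> borel_measurable (lborel \<Otimes>\<^sub>M lborel)" using that by (simp cong: measurable_cong_sets sets_pair_measure_cong)
    from lborel_pair.Fubini[OF this] show ?thesis by simp
  qed
  have "(\<integral>\<^sup>+y. \<integral>\<^sup>+z. f (y + t * z, z) \<partial>lborel \<partial>lborel) = (\<integral>\<^sup>+z. \<integral>\<^sup>+y. f (y + t * z, z) \<partial>lborel \<partial>lborel)"
    using swap[of "\<lambda>(y, z). f (y + t * z, z)"] by simp
  also have "\<dots> = (\<integral>\<^sup>+z. \<integral>\<^sup>+y. f (y, z) \<partial>lborel \<partial>lborel)"
    using nn_integral_shear1[of "\<lambda>(z, y). f (y, z)" t] by simp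
  also have "\<dots> = (\<integral>\<^sup>+y. \<integral>\<^sup>+z. f (y, z) \<partial>lborel \<partial>lborel)"
    using swap[of f] by simp
  finally show ?thesis .
qed

text \<open>A rotation by an angle other than \<open>\<pi>\<close> is a product of three shears.\<close>

lemma nn_integral_rotation:
  fixes f :: "real \<times> real \<Rightarrow> ennreal"
  assumes f[measurable]: "f \<in> borel_measurable (borel \<Otimes>\<^sub>M borel)" and cs: "c\<^sup>2 + s\<^sup>2 = 1" "0 \<le> c"
  shows "(\<integral>\<^sup>+y. \<integral>\<^sup>+z. f (c * y + s * z, - s * y + c * z) \<partial>lborel \<partial>lborel) = (\<integral>\<^sup>+y. \<integral>\<^sup>+z. f (y, z) \<partial>lborel \<partial>lborel)"
proof -
  \<comment> \<open>For \<open>c = cos \<theta>\<close> and \<open>s = sin \<theta>\<close> this is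
    \<open>tan (\<theta> / 2)\<close>, the parameter of the two outer shears; the middle one uses
    \<open>- s\<close>.\<close>
  define t where "t = s / (1 + c)"
  have t1: "t * (1 + c) = s" using cs by (simp add: t_def)
  have "(1 - s * t) * (1 + c) = c * (1 + c)"
    using t1 cs by (simp add: algebra_simps power2_eq_square)
  then have t2: "1 - s * t = c" using cs by simp
  have e1: "z - s * (y + t * z) = - s * y + c * z" for y z
  proof -
    have "z - s * (y + t * z) = (1 - s * t) * z - s * y" by (simp add: algebra_simps)
    then show ?thesis by (simp add: t2)
  qed
  have e2: "y + t * z + t * (- s * y + c * z) = c * y + s * z" for y z
  proof -
    have "y + t * z + t * (- s * y + c * z) = (1 - s * t) * y + (t * (1 + c)) * z" by (simp add: algebra_simps)
    then show ?thesis by (simp only: t1 t2)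
  qed
  have "(\<integral>\<^sup>+y. \<integral>\<^sup>+z. f (y, z) \<partial>lborel \<partial>lborel) = (\<integral>\<^sup>+y. \<integral>\<^sup>+z. f (y + t * z, z) \<partial>lborel \<partial>lborel)"
    by (rule nn_integral_shear2[symmetric]) simp
  also have "\<dots> = (\<integral>\<^sup>+y. \<integral>\<^sup>+z. f (y + t * (z + (- s) * y), z + (- s) * y) \<partial>lborel \<partial>lborel)"
    using nn_integral_shear1[of "\<lambda>(y, z). f (y + t * z, z)" "- s"] by simp
  also have "\<dots> = (\<integral>\<^sup>+y. \<integral>\<^sup>+z. f ((y + t * z) + t * (z + (- s) * (y + t * z)), z + (- s) * (y + t * z)) \<partial>lborel \<partial>lborel)"
    using nn_integral_shear2[of "\<lambda>(y, z). f (y + t * (z + (- s) * y), z + (- s) * y)" t] by simp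
  also have "\<dots> = (\<integral>\<^sup>+y. \<integral>\<^sup>+z. f (c * y + s * z, - s * y + c * z) \<partial>lborel \<partial>lborel)"
    using e1 e2 by (simp add: mult.commute)
  finally show ?thesis by simp
qed

text \<open>The joint density of two independent standard normals depends only on
  \<open>y\<^sup>2 + z\<^sup>2\<close>, so the invariance of Lebesgue measure carries over.\<close>

lemma nn_integral_std_normal_rotation:
  fixes f :: "real \<times> real \<Rightarrow> ennreal"
  assumes f[measurable]: "f \<in> borel_measurable (borel \<Otimes>\<^sub>M borel)" and cs: "c\<^sup>2 + s\<^sup>2 = 1" "0 \<le> c"
  shows "(\<integral>\<^sup>+y. \<integral>\<^sup>+z. f (c * y + s * z, - s * y + c * z) \<partial>std_normal_distribution \<partial>std_normal_distribution)
    = (\<integral>\<^sup>+y. \<integral>\<^sup>+z. f (y, z) \<partial>std_normal_distribution \<partial>std_normal_distribution)"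
proof -
  let ?g = "\<lambda>y z. ennreal (std_normal_density y) * ennreal (std_normal_density z)"
  have ex: "(\<integral>\<^sup>+y. \<integral>\<^sup>+z. h (y, z) \<partial>std_normal_distribution \<partial>std_normal_distribution)
    = (\<integral>\<^sup>+y. \<integral>\<^sup>+z. ?g y z * h (y, z) \<partial>lborel \<partial>lborel)"
    if [measurable]: "h \<in> borel_measurable (borel \<Otimes>\<^sub>M borel)" for h :: "real \<times> real \<Rightarrow> ennreal"
  proof -
    interpret prob_space std_normal_distribution by (rule prob_space_std_normal_distribution)
    have [measurable_cong]: "sets std_normal_distribution = sets borel" by simp
    have "(\<integral>\<^sup>+y. \<integral>\<^sup>+z. h (y, z) \<partial>std_normal_distribution \<partial>std_normal_distribution)
      = (\<integral>\<^sup>+y. ennreal (std_normal_density y) * (\<integral>\<^sup>+z. h (y, z) \<partial>std_normal_distribution) \<partial>lborel)"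
      by (subst nn_integral_density) (auto intro!: borel_measurable_nn_integral)
    also have "\<dots> = (\<integral>\<^sup>+y. \<integral>\<^sup>+z. ?g y z * h (y, z) \<partial>lborel \<partial>lborel)"
      by (intro nn_integral_cong, subst nn_integral_density) (auto simp: nn_integral_cmult[symmetric] mult_ac)
    finally show ?thesis .
  qed
  have inv: "?g (c * y + s * z) (- s * y + c * z) = ?g y z" for y z
  proof -
    have "(c * y + s * z)\<^sup>2 + (- s * y + c * z)\<^sup>2 = (c\<^sup>2 + s\<^sup>2) * (y\<^sup>2 + z\<^sup>2)"
      by (simp add: power2_eq_square algebra_simps)
    then have "(c * y + s * z)\<^sup>2 + (- s * y + c * z)\<^sup>2 = y\<^sup>2 + z\<^sup>2" using cs by simp
    then have "exp (- (c * y + s * z)\<^sup>2 / 2) * exp (- (- s * y + c * z)\<^sup>2 / 2) = exp (- y\<^sup>2 / 2) * exp (- z\<^sup>2 / 2)"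
      unfolding exp_add[symmetric] by (intro arg_cong[where f = exp]) (simp add: field_simps)
    then have "std_normal_density (c * y + s * z) * std_normal_density (- s * y + c * z) = std_normal_density y * std_normal_density z"
      by (simp add: std_normal_density_def mult_ac)
    then show ?thesis by (simp add: ennreal_mult[symmetric])
  qed
  have "(\<integral>\<^sup>+y. \<integral>\<^sup>+z. f (c * y + s * z, - s * y + c * z) \<partial>std_normal_distribution \<partial>std_normal_distribution)
    = (\<integral>\<^sup>+y. \<integral>\<^sup>+z. ?g y z * f (c * y + s * z, - s * y + c * z) \<partial>lborel \<partial>lborel)"
    using ex[of "\<lambda>(y, z). f (c * y + s * z, - s * y + c * z)"] by simp
  also have "\<dots> = (\<integral>\<^sup>+y. \<integral>\<^sup>+z. ?g (c * y + s * z) (- s * y + c * z) * f (c * y + s * z, - s * y + c * z) \<partial>lborel \<partial>lborel)"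
    unfolding inv ..
  also have "\<dots> = (\<integral>\<^sup>+y. \<integral>\<^sup>+z. ?g y z * f (y, z) \<partial>lborel \<partial>lborel)"
    using nn_integral_rotation[of "\<lambda>(y, z). ?g y z * f (y, z)", OF _ cs] by simp
  also have "\<dots> = (\<integral>\<^sup>+y. \<integral>\<^sup>+z. f (y, z) \<partial>std_normal_distribution \<partial>std_normal_distribution)"
    by (rule ex[symmetric]) simp
  finally show ?thesis .
qed

section \<open>Plane rotations and orthogonal maps of Gaussian vectors\<close>

lemma nn_integral_PiM_update:
  fixes F :: "('i \<Rightarrow> 'a) \<Rightarrow> ennreal"
  assumes I: "finite I" "i \<in> I" and N: "prob_space N" and F: "F \<in> borel_measurable (PiM I (\<lambda>_. N))"
  shows "(\<integral>\<^sup>+x. F x \<partial>PiM I (\<lambda>_. N)) = (\<integral>\<^sup>+x. \<integral>\<^sup>+y. F (x(i := y)) \<partial>N \<partial>PiM I (\<lambda>_. N))"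
proof -
  interpret N: prob_space N by fact
  note m = measurable_PiM_update[OF I(2), of "\<lambda>_. N"]
  have "(\<integral>\<^sup>+x. F x \<partial>PiM I (\<lambda>_. N)) = (\<integral>\<^sup>+z. F ((\<lambda>(x, y). x(i := y)) z) \<partial>(PiM I (\<lambda>_. N) \<Otimes>\<^sub>M N))"
    by (subst distr_PiM_update[OF I N, symmetric]) (rule nn_integral_distr[OF m], use F in simp)
  also have "\<dots> = (\<integral>\<^sup>+x. \<integral>\<^sup>+y. F (x(i := y)) \<partial>N \<partial>PiM I (\<lambda>_. N))"
    by (subst N.nn_integral_fst[symmetric]) (use measurable_compose[OF m F] in auto)
  finally show ?thesis .
qed

definition givens :: "real \<Rightarrow> real \<Rightarrow> nat \<Rightarrow> nat \<Rightarrow> (nat \<Rightarrow> real) \<Rightarrow> nat \<Rightarrow> real" where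
  "givens c s k l x = x(k := c * x k + s * x l, l := - s * x k + c * x l)"

lemma measurable_givens:
  assumes "k < d" "l < d"
  shows "givens c s k l \<in> std_normal_vec d \<rightarrow>\<^sub>M std_normal_vec d"
  unfolding std_normal_vec_def
proof (rule measurable_PiM_single')
  show "(\<lambda>x. givens c s k l x i) \<in> PiM {..<d} (\<lambda>_. std_normal_distribution) \<rightarrow>\<^sub>M std_normal_distribution" if "i \<in> {..<d}" for i
    using that assms borel_measurable_component_std_normal_vec[of _ d] unfolding givens_def std_normal_vec_def
    by (cases "i = l"; cases "i = k") auto
qed (use assms in \<open>auto simp: givens_def space_PiM PiE_iff extensional_def\<close>)

lemma distr_givens:
  assumes kl: "k < d" "l < d" "k \<noteq> l" and cs: "c\<^sup>2 + s\<^sup>2 = 1" "0 \<le> c"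
  shows "distr (std_normal_vec d) (std_normal_vec d) (givens c s k l) = std_normal_vec d"
proof (rule measure_eqI)
  let ?N = "std_normal_vec d" and ?G = "givens c s k l" and ?\<gamma> = std_normal_distribution
  note m = measurable_givens[OF kl(1,2), of c s]
  fix A assume "A \<in> sets (distr ?N ?N ?G)"
  then have A[measurable]: "A \<in> sets ?N" by simp
  let ?F = "\<lambda>x. indicator A x :: ennreal"
  have Fm: "?F \<in> borel_measurable ?N" by measurable
  have two: "(\<integral>\<^sup>+x. h x \<partial>?N) = (\<integral>\<^sup>+x. \<integral>\<^sup>+y. \<integral>\<^sup>+z. h (x(k := y, l := z)) \<partial>?\<gamma> \<partial>?\<gamma> \<partial>?N)"
    if h: "h \<in> borel_measurable ?N" for h
  proof -
    have "(\<lambda>x. \<integral>\<^sup>+z. h (x(l := z)) \<partial>?\<gamma>) \<in> borel_measurable ?N"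
    proof -
      interpret prob_space ?\<gamma> by (rule prob_space_std_normal_distribution)
      have "(\<lambda>z. h ((\<lambda>(x, y). x(l := y)) z)) \<in> borel_measurable (?N \<Otimes>\<^sub>M ?\<gamma>)"
        using measurable_compose[OF measurable_PiM_update[of l "{..<d}" "\<lambda>_. ?\<gamma>"]] h kl by (simp add: std_normal_vec_def)
      then show ?thesis by (intro borel_measurable_nn_integral) (simp add: case_prod_beta)
    qed
    then show ?thesis
      using nn_integral_PiM_update[of "{..<d}" l ?\<gamma> h] nn_integral_PiM_update[of "{..<d}" k ?\<gamma> "\<lambda>x. \<integral>\<^sup>+z. h (x(l := z)) \<partial>?\<gamma>"] kl h
      by (simp add: std_normal_vec_def prob_space_std_normal_distribution)
  qed
  have "emeasure (distr ?N ?N ?G) A = (\<integral>\<^sup>+x. ?F x \<partial>distr ?N ?N ?G)" by simp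
  also have "\<dots> = (\<integral>\<^sup>+x. ?F (?G x) \<partial>?N)" by (rule nn_integral_distr[OF m]) simp
  also have "\<dots> = (\<integral>\<^sup>+x. \<integral>\<^sup>+y. \<integral>\<^sup>+z. ?F (?G (x(k := y, l := z))) \<partial>?\<gamma> \<partial>?\<gamma> \<partial>?N)"
    by (rule two) (rule measurable_compose[OF m Fm])
  also have "\<dots> = (\<integral>\<^sup>+x. \<integral>\<^sup>+y. \<integral>\<^sup>+z. ?F (x(k := c * y + s * z, l := - s * y + c * z)) \<partial>?\<gamma> \<partial>?\<gamma> \<partial>?N)"
    using kl by (simp add: givens_def fun_upd_twist[of k l])
  also have "\<dots> = (\<integral>\<^sup>+x. \<integral>\<^sup>+y. \<integral>\<^sup>+z. ?F (x(k := y, l := z)) \<partial>?\<gamma> \<partial>?\<gamma> \<partial>?N)"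
  proof (rule nn_integral_cong)
    fix x assume x: "x \<in> space ?N"
    have "(\<lambda>(y, z). x(k := y, l := z)) \<in> borel \<Otimes>\<^sub>M borel \<rightarrow>\<^sub>M ?N"
      unfolding std_normal_vec_def
    proof (rule measurable_PiM_single')
      show "(\<lambda>w. (case w of (y, z) \<Rightarrow> x(k := y, l := z)) i) \<in> borel \<Otimes>\<^sub>M borel \<rightarrow>\<^sub>M ?\<gamma>" if "i \<in> {..<d}" for i
        by (cases "i = l"; cases "i = k") (auto simp: case_prod_beta)
    qed (use x kl in \<open>auto simp: space_std_normal_vec PiE_iff extensional_def fun_upd_def split: if_splits\<close>)
    from measurable_compose[OF this Fm] have "(\<lambda>(y, z). ?F (x(k := y, l := z))) \<in> borel_measurable (borel \<Otimes>\<^sub>M borel)"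
      by (simp add: case_prod_beta)
    from nn_integral_std_normal_rotation[OF this cs]
    show "(\<integral>\<^sup>+y. \<integral>\<^sup>+z. ?F (x(k := c * y + s * z, l := - s * y + c * z)) \<partial>?\<gamma> \<partial>?\<gamma>)
      = (\<integral>\<^sup>+y. \<integral>\<^sup>+z. ?F (x(k := y, l := z)) \<partial>?\<gamma> \<partial>?\<gamma>)" by simp
  qed
  also have "\<dots> = (\<integral>\<^sup>+x. ?F x \<partial>?N)" by (rule two[symmetric]) (rule Fm)
  finally show "emeasure (distr ?N ?N ?G) A = emeasure ?N A" by simp
qed simp

lemma inner_vec_givens:
  assumes kl: "k < d" "l < d" "k \<noteq> l"
  shows "inner_vec d (givens c s k l x) y = inner_vec d x (givens c (- s) k l y)"
    and "c\<^sup>2 + s\<^sup>2 = 1 \<Longrightarrow> inner_vec d (givens c s k l x) (givens c s k l y) = inner_vec d x y"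
proof -
  have ex: "inner_vec d x y = x k * y k + x l * y l + (\<Sum>i\<in>{..<d} - {k} - {l}. x i * y i)" for x y
    unfolding inner_vec_def using kl by (simp add: sum.remove[of _ k] sum.remove[of _ l])
  have rest: "(\<Sum>i\<in>{..<d} - {k} - {l}. givens c s k l x i * y i) = (\<Sum>i\<in>{..<d} - {k} - {l}. x i * y i)"
    "(\<Sum>i\<in>{..<d} - {k} - {l}. x i * givens c s k l y i) = (\<Sum>i\<in>{..<d} - {k} - {l}. x i * y i)" for x y c s
    by (rule sum.cong; simp add: givens_def)+
  show "inner_vec d (givens c s k l x) y = inner_vec d x (givens c (- s) k l y)"
    unfolding ex rest using kl by (simp add: givens_def algebra_simps)
  assume cs: "c\<^sup>2 + s\<^sup>2 = 1"
  have "inner_vec d (givens c s k l x) (givens c s k l y)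
    = (c\<^sup>2 + s\<^sup>2) * (x k * y k + x l * y l) + (\<Sum>i\<in>{..<d} - {k} - {l}. x i * y i)"
    unfolding ex rest using kl by (simp add: givens_def algebra_simps power2_eq_square)
  then show "inner_vec d (givens c s k l x) (givens c s k l y) = inner_vec d x y"
    by (simp add: cs ex)
qed

text \<open>An orthogonal matrix and its transpose, as maps on coordinate functions that preserve
  the Gaussian law. Carrying the transpose along lets a rotation of one argument of
  \<open>inner_vec\<close> be moved to the other one.\<close>

definition isometry_pair :: "nat \<Rightarrow> ((nat \<Rightarrow> real) \<Rightarrow> nat \<Rightarrow> real) \<Rightarrow> ((nat \<Rightarrow> real) \<Rightarrow> nat \<Rightarrow> real) \<Rightarrow> bool" where
  "isometry_pair d P P' \<longleftrightarrow>
     P \<in> std_normal_vec d \<rightarrow>\<^sub>M std_normal_vec d \<and> P' \<in> std_normal_vec d \<rightarrow>\<^sub>M std_normal_vec d \<and>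
     distr (std_normal_vec d) (std_normal_vec d) P = std_normal_vec d \<and>
     distr (std_normal_vec d) (std_normal_vec d) P' = std_normal_vec d \<and>
     (\<forall>x y. inner_vec d (P x) y = inner_vec d x (P' y)) \<and>
     (\<forall>x y. inner_vec d (P x) (P y) = inner_vec d x y) \<and>
     (\<forall>x y. inner_vec d (P' x) (P' y) = inner_vec d x y)"

lemma isometry_pair_id: "isometry_pair d (\<lambda>x. x) (\<lambda>x. x)"
  by (simp add: isometry_pair_def distr_id)

lemma isometry_pair_givens:
  assumes "k < d" "l < d" "k \<noteq> l" "c\<^sup>2 + s\<^sup>2 = 1" "0 \<le> c"
  shows "isometry_pair d (givens c (- s) k l) (givens c s k l)"
  unfolding isometry_pair_def
proof (intro conjI allI)
  have cs: "c\<^sup>2 + (- s)\<^sup>2 = 1" using assms by simp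
  show "inner_vec d (givens c (- s) k l x) y = inner_vec d x (givens c s k l y)" for x y
    using inner_vec_givens(1)[OF assms(1-3), of c "- s" x y] by simp
  show "inner_vec d (givens c (- s) k l x) (givens c (- s) k l y) = inner_vec d x y"
    "inner_vec d (givens c s k l x) (givens c s k l y) = inner_vec d x y" for x y
    by (rule inner_vec_givens(2)[OF assms(1-3)], fact)+
  show "distr (std_normal_vec d) (std_normal_vec d) (givens c (- s) k l) = std_normal_vec d"
    by (rule distr_givens[OF assms(1-3) cs assms(5)])
qed (intro measurable_givens distr_givens assms)+

lemma isometry_pair_compose:
  assumes "isometry_pair d P P'" "isometry_pair d Q Q'"
  shows "isometry_pair d (\<lambda>x. P (Q x)) (\<lambda>x. Q' (P' x))"
proof -
  have d: "distr (std_normal_vec d) (std_normal_vec d) (\<lambda>x. f (g x)) = std_normal_vec d"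
    if "f \<in> std_normal_vec d \<rightarrow>\<^sub>M std_normal_vec d" "g \<in> std_normal_vec d \<rightarrow>\<^sub>M std_normal_vec d"
      "distr (std_normal_vec d) (std_normal_vec d) f = std_normal_vec d"
      "distr (std_normal_vec d) (std_normal_vec d) g = std_normal_vec d" for f g
    using distr_distr[OF that(1,2)] that(3,4) by (simp add: comp_def)
  note P = assms(1)[unfolded isometry_pair_def] and Q = assms(2)[unfolded isometry_pair_def]
  show ?thesis
    unfolding isometry_pair_def
  proof (intro conjI allI)
    show "(\<lambda>x. P (Q x)) \<in> std_normal_vec d \<rightarrow>\<^sub>M std_normal_vec d" "(\<lambda>x. Q' (P' x)) \<in> std_normal_vec d \<rightarrow>\<^sub>M std_normal_vec d"
      using P Q measurable_compose by blast+
    show "distr (std_normal_vec d) (std_normal_vec d) (\<lambda>x. P (Q x)) = std_normal_vec d"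
      "distr (std_normal_vec d) (std_normal_vec d) (\<lambda>x. Q' (P' x)) = std_normal_vec d"
      using P Q d by blast+
    show "inner_vec d (P (Q x)) y = inner_vec d x (Q' (P' y))"
      "inner_vec d (P (Q x)) (P (Q y)) = inner_vec d x y"
      "inner_vec d (Q' (P' x)) (Q' (P' y)) = inner_vec d x y" for x y
      using P Q by metis+
  qed
qed

text \<open>Elimination by plane rotations, as in a QR decomposition: each rotation in coordinates
  \<open>k\<close> and \<open>m\<close> moves the \<open>m\<close>-th coordinate of \<open>a\<close>
  into the \<open>k\<close>-th. Coordinates below \<open>k\<close> stay fixed, and vectors that
  vanish from \<open>k\<close> on still do so afterwards, so earlier eliminations survive.\<close>

lemma isometry_pair_zero_above:
  assumes "k < d" "k < m" "m \<le> d"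
  shows "\<exists>P P'. isometry_pair d P P' \<and> (\<forall>x. \<forall>i<k. P' x i = x i)
    \<and> (\<forall>x. (\<forall>i. k \<le> i \<longrightarrow> i < d \<longrightarrow> x i = 0) \<longrightarrow> (\<forall>i. k \<le> i \<longrightarrow> i < d \<longrightarrow> P' x i = 0))
    \<and> (\<forall>i. k < i \<longrightarrow> i < m \<longrightarrow> P' a i = 0)"
proof -
  have "Suc k \<le> m" using assms by simp
  then show ?thesis using assms(3)
  proof (induction m rule: dec_induct)
    case base
    show ?case by (intro exI[of _ "\<lambda>x. x"]) (auto simp: isometry_pair_id)
  next
    case (step m)
    then obtain P P' where P: "isometry_pair d P P'" "\<And>x i. i < k \<Longrightarrow> P' x i = x i"
      "\<And>x i. (\<And>i. k \<le> i \<Longrightarrow> i < d \<Longrightarrow> x i = 0) \<Longrightarrow> k \<le> i \<Longrightarrow> i < d \<Longrightarrow> P' x i = 0"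
      "\<And>i. k < i \<Longrightarrow> i < m \<Longrightarrow> P' a i = 0" by auto
    define u v where "u = P' a k" and "v = P' a m"
    define r where "r = sqrt (u\<^sup>2 + v\<^sup>2)"
    \<comment> \<open>The angle is chosen so that \<open>- s * u + c * v = 0\<close>. The sign of
      \<open>u\<close> goes into \<open>s\<close> in order to keep \<open>c \<ge> 0\<close>; if
      \<open>u\<close> and \<open>v\<close> both vanish, the identity is used.\<close>
    define c s where "c = (if r = 0 then 1 else \<bar>u\<bar> / r)" and "s = (if r = 0 then 0 else if u < 0 then - v / r else v / r)"
    have r: "r \<noteq> 0 \<Longrightarrow> r\<^sup>2 = u\<^sup>2 + v\<^sup>2" "0 \<le> r" by (auto simp: r_def)
    have "c\<^sup>2 + s\<^sup>2 = 1"
    proof (cases "r = 0")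
      case False
      then have "c\<^sup>2 + s\<^sup>2 = (u\<^sup>2 + v\<^sup>2) / r\<^sup>2" by (simp add: c_def s_def power_divide add_divide_distrib)
      then show ?thesis by (simp only: r(1)[OF False, symmetric]) (simp add: False)
    qed (simp add: c_def s_def)
    moreover have "0 \<le> c" using r(2) by (simp add: c_def)
    moreover have z: "- s * u + c * v = 0"
    proof (cases "r = 0")
      case True
      then have "u\<^sup>2 + v\<^sup>2 = 0" by (simp add: r_def)
      then have "v = 0" by (simp add: sum_power2_eq_zero_iff)
      then show ?thesis using True by (simp add: s_def)
    qed (auto simp: c_def s_def)
    moreover have km: "k < m" "m < d" using step by auto
    ultimately have "isometry_pair d (givens c (- s) k m) (givens c s k m)"
      using assms by (intro isometry_pair_givens) auto
    from isometry_pair_compose[OF P(1) this]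
    have "isometry_pair d (\<lambda>x. P (givens c (- s) k m x)) (\<lambda>x. givens c s k m (P' x))" .
    moreover have "givens c s k m (P' x) i = x i" if "i < k" for x i
      using that km P(2) by (simp add: givens_def)
    moreover have "givens c s k m (P' x) i = 0" if "\<And>i. k \<le> i \<Longrightarrow> i < d \<Longrightarrow> x i = 0" "k \<le> i" "i < d" for x i
      using P(3)[OF that(1)] that km assms by (simp add: givens_def)
    moreover have "givens c s k m (P' a) i = 0" if "k < i" "i < Suc m" for i
      using that P(4)[of i] z km by (auto simp: givens_def u_def v_def less_Suc_eq)
    ultimately show ?case
      by (intro exI[of _ "\<lambda>x. P (givens c (- s) k m x)"] exI[of _ "\<lambda>x. givens c s k m (P' x)"] conjI allI impI) auto
  qed
qed

text \<open>The triangular shape of a QR decomposition: \<open>P'\<close> maps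
  \<open>a 0, ..., a (k - 1)\<close> into the span of the first \<open>k\<close> coordinate vectors.
  The induction step clears the next vector above its own index.\<close>

lemma isometry_pair_triangular:
  assumes "k \<le> d"
  shows "\<exists>P P'. isometry_pair d P P' \<and> (\<forall>j<k. \<forall>i. k \<le> i \<longrightarrow> i < d \<longrightarrow> P' (a j) i = 0)"
  using assms
proof (induction k)
  case 0
  show ?case using isometry_pair_id by blast
next
  case (Suc k)
  then obtain P P' where P: "isometry_pair d P P'" "\<And>j i. j < k \<Longrightarrow> k \<le> i \<Longrightarrow> i < d \<Longrightarrow> P' (a j) i = 0" by auto
  obtain Q Q' where Q: "isometry_pair d Q Q'"
    "\<And>x i. (\<And>i. k \<le> i \<Longrightarrow> i < d \<Longrightarrow> x i = 0) \<Longrightarrow> k \<le> i \<Longrightarrow> i < d \<Longrightarrow> Q' x i = 0"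
    "\<And>i. k < i \<Longrightarrow> i < d \<Longrightarrow> Q' (P' (a k)) i = 0"
    using isometry_pair_zero_above[of k d d "P' (a k)"] Suc.prems by auto
  have "Q' (P' (a j)) i = 0" if "j < Suc k" "Suc k \<le> i" "i < d" for i j
    using that Q(3)[of i] Q(2)[of "P' (a j)" i] P(2)[of j] by (cases "j = k") auto
  then show ?case using isometry_pair_compose[OF P(1) Q(1)]
    by (intro exI[of _ "\<lambda>x. P (Q x)"] exI[of _ "\<lambda>x. Q' (P' x)"] conjI allI impI) auto
qed

subsection \<open>Correlations of a signed edge\<close>

definition signed_edge :: "real \<Rightarrow> nat \<Rightarrow> (nat \<Rightarrow> real) \<Rightarrow> (nat \<Rightarrow> real) \<Rightarrow> real" where
  "signed_edge p d x y = indicator {threshold p d..} (inner_vec d x y) - p"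

lemma signed_edge_commute: "signed_edge p d x y = signed_edge p d y x"
  by (simp add: signed_edge_def inner_vec_def mult.commute)

lemma abs_signed_edge_le: "0 < p \<Longrightarrow> p < 1 \<Longrightarrow> \<bar>signed_edge p d x y\<bar> \<le> 1"
  by (auto simp: signed_edge_def indicator_def)

lemma borel_measurable_signed_edge[measurable (raw)]:
  assumes "f \<in> M \<rightarrow>\<^sub>M std_normal_vec d" "g \<in> M \<rightarrow>\<^sub>M std_normal_vec d"
  shows "(\<lambda>x. signed_edge p d (f x) (g x)) \<in> borel_measurable M"
  unfolding signed_edge_def using assms by measurable

text \<open>An upper bound for the second moment of the conditional expectation of a signed edge
  when \<open>k\<close> inner products with one endpoint are known. The cap at 1 is the trivial
  bound; it is what handles \<open>n * q\<close> tending to 0, whatever \<open>d\<close> is.\<close>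

definition edge_rate :: "real \<Rightarrow> nat \<Rightarrow> nat \<Rightarrow> real" where
  "edge_rate p d k = min 1 (edge_const p * (real k + 1) / real d)"

lemma edge_rate_bounds:
  "edge_rate p d k \<le> 1" "edge_rate p d k \<le> edge_const p * (real k + 1) / real d"
  "0 < p \<Longrightarrow> p < 1 \<Longrightarrow> 0 \<le> edge_rate p d k"
  by (auto simp: edge_rate_def edge_const_def)

lemma abs_mult_le_squares: "c > 0 \<Longrightarrow> \<bar>x * y\<bar> \<le> (c * x\<^sup>2 + y\<^sup>2 / c) / 2" for x y c :: real
proof -
  assume c: "c > 0"
  have "0 \<le> (c * \<bar>x\<bar> - \<bar>y\<bar>)\<^sup>2" by simp
  then have "c * (2 * \<bar>x * y\<bar>) \<le> c * (c * x\<^sup>2 + y\<^sup>2 / c)"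
    using c by (simp add: power2_diff power_mult_distrib abs_mult algebra_simps power2_eq_square[of c])
  then show ?thesis using c by simp
qed

text \<open>Young's inequality with a free weight \<open>c\<close> in place of the Cauchy-Schwarz
  inequality. It is linear in the second moments, so it can be integrated over further variables
  before \<open>c\<close> is chosen.\<close>

lemma abs_integral_mult_le:
  fixes X Y :: "'a \<Rightarrow> real"
  assumes "prob_space M" and [measurable]: "X \<in> borel_measurable M" "Y \<in> borel_measurable M"
    and C: "\<And>x. x \<in> space M \<Longrightarrow> \<bar>X x\<bar> \<le> 1" "\<And>x. x \<in> space M \<Longrightarrow> \<bar>Y x\<bar> \<le> C" and c: "0 < c"
  shows "\<bar>\<integral>x. X x * Y x \<partial>M\<bar> \<le> (c * (\<integral>x. (X x)\<^sup>2 \<partial>M) + (\<integral>x. (Y x)\<^sup>2 \<partial>M) / c) / 2"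
proof -
  have i2: "integrable M (\<lambda>x. (X x)\<^sup>2)"
    by (rule integrable_bounded_prob[where C = 1]) (use assms in \<open>auto simp: abs_square_le_1\<close>)
  have j2: "integrable M (\<lambda>x. (Y x)\<^sup>2)"
    by (rule integrable_bounded_prob[where C = "C\<^sup>2"]) (use assms in \<open>auto simp: abs_le_square_iff[symmetric] intro: order_trans[OF _ abs_ge_self]\<close>)
  have "\<bar>\<integral>x. X x * Y x \<partial>M\<bar> \<le> (\<integral>x. \<bar>X x * Y x\<bar> \<partial>M)" by (rule integral_abs_bound)
  also have "\<dots> \<le> (\<integral>x. (c * (X x)\<^sup>2 + (Y x)\<^sup>2 / c) / 2 \<partial>M)"
  proof (rule integral_mono)
    show "integrable M (\<lambda>x. \<bar>X x * Y x\<bar>)"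
    proof (rule integrable_bounded_prob[where C = "C"])
      show "\<bar>\<bar>X x * Y x\<bar>\<bar> \<le> C" if "x \<in> space M" for x
        using mult_mono[OF C(1)[OF that] C(2)[OF that]] by (simp add: abs_mult)
    qed (use assms in auto)
  qed (use i2 j2 c abs_mult_le_squares in auto)
  also have "\<dots> = (c * (\<integral>x. (X x)\<^sup>2 \<partial>M) + (\<integral>x. (Y x)\<^sup>2 \<partial>M) / c) / 2" using i2 j2 by simp
  finally show ?thesis .
qed

text \<open>By rotation invariance, the vectors \<open>a 0, \<dots>, a (k - 1)\<close> may be taken in the span of the first
  \<open>k\<close> coordinate vectors; the remaining coordinates of \<open>g\<close> are then independent of \<open>F\<close>.\<close>

lemma signed_edge_correlation:
  fixes F :: "(nat \<Rightarrow> real) \<Rightarrow> (nat \<Rightarrow> real) \<Rightarrow> real"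
  assumes d: "1 \<le> d" and p: "0 < p" "p < 1" and c: "0 < c"
    and F[measurable]: "(\<lambda>(b, g). F b g) \<in> borel_measurable (std_normal_vec d \<Otimes>\<^sub>M std_normal_vec d)"
    and FC: "\<And>b g. \<bar>F b g\<bar> \<le> C"
    and dep: "\<And>b g g'. \<lbrakk>b \<in> space (std_normal_vec d); g \<in> space (std_normal_vec d); g' \<in> space (std_normal_vec d);
      \<And>j. j < k \<Longrightarrow> inner_vec d (a j) g = inner_vec d (a j) g'\<rbrakk> \<Longrightarrow> F b g = F b g'"
  shows "(\<integral>b. \<bar>\<integral>g. signed_edge p d b g * F b g \<partial>std_normal_vec d\<bar> \<partial>std_normal_vec d)
    \<le> (c * edge_rate p d k + (\<integral>b. \<integral>g. (F b g)\<^sup>2 \<partial>std_normal_vec d \<partial>std_normal_vec d) / c) / 2"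
proof -
  let ?N = "std_normal_vec d"
  interpret N: prob_space ?N by (rule prob_space_std_normal_vec)
  note NP = N.prob_space_axioms
  define K where "K b = (\<integral>g. (F b g)\<^sup>2 \<partial>?N)" for b
  have Fb[measurable]: "(\<lambda>g. F b g) \<in> borel_measurable ?N" if "b \<in> space ?N" for b
    using measurable_Pair2[OF F that] by simp
  have Km[measurable]: "K \<in> borel_measurable ?N" unfolding K_def by measurable
  have C0: "0 \<le> C" using FC[of undefined undefined] by linarith
  have FC2: "(F b g)\<^sup>2 \<le> C\<^sup>2" for b g using FC[of b g] C0 by (simp add: abs_le_square_iff[symmetric])
  have Ki: "integrable ?N K"
  proof (rule integrable_bounded_prob[where C = "C\<^sup>2", OF NP Km])
    show "\<bar>K b\<bar> \<le> C\<^sup>2" for b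
      unfolding K_def by (rule abs_integral_le_bound[OF NP]) (use FC2 in simp)
  qed
  have Ii: "integrable ?N (\<lambda>b. \<bar>\<integral>g. signed_edge p d b g * F b g \<partial>?N\<bar>)"
  proof (rule integrable_bounded_prob[where C = C, OF NP])
    have "\<bar>signed_edge p d b g * F b g\<bar> \<le> C" for b g
      using mult_mono[OF abs_signed_edge_le[OF p] FC] by (simp add: abs_mult)
    then show "\<bar>\<bar>\<integral>g. signed_edge p d b g * F b g \<partial>?N\<bar>\<bar> \<le> C" for b
      by (simp add: abs_integral_le_bound[OF NP])
  qed measurable
  have bound: "(\<integral>b. \<bar>\<integral>g. signed_edge p d b g * F b g \<partial>?N\<bar> \<partial>?N) \<le> (c * (\<integral>b. E b \<partial>?N) + (\<integral>b. K b \<partial>?N) / c) / 2"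
    if E: "integrable ?N E" and le: "AE b in ?N. \<bar>\<integral>g. signed_edge p d b g * F b g \<partial>?N\<bar> \<le> (c * E b + K b / c) / 2" for E
  proof -
    have "(\<integral>b. \<bar>\<integral>g. signed_edge p d b g * F b g \<partial>?N\<bar> \<partial>?N) \<le> (\<integral>b. (c * E b + K b / c) / 2 \<partial>?N)"
      by (rule integral_mono_AE[OF Ii _ le]) (use E Ki in auto)
    then show ?thesis using E Ki by simp
  qed
  show ?thesis
  proof (cases "edge_const p * (real k + 1) / real d \<ge> 1")
    case True
    then have "edge_rate p d k = 1" by (simp add: edge_rate_def)
    moreover have "(\<integral>b. \<bar>\<integral>g. signed_edge p d b g * F b g \<partial>?N\<bar> \<partial>?N) \<le> (c * (\<integral>b. 1 \<partial>?N) + (\<integral>b. K b \<partial>?N) / c) / 2"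
    proof (rule bound)
      show "AE b in ?N. \<bar>\<integral>g. signed_edge p d b g * F b g \<partial>?N\<bar> \<le> (c * 1 + K b / c) / 2"
        using AE_space
      proof eventually_elim
        case (elim b)
        have "\<bar>\<integral>g. signed_edge p d b g * F b g \<partial>?N\<bar> \<le> (c * (\<integral>g. (signed_edge p d b g)\<^sup>2 \<partial>?N) + K b / c) / 2"
          unfolding K_def using elim c FC abs_signed_edge_le[OF p]
          by (intro abs_integral_mult_le[OF NP]) auto
        also have "(\<integral>g. (signed_edge p d b g)\<^sup>2 \<partial>?N) \<le> 1"
          using abs_integral_le_bound[OF NP, of "\<lambda>g. (signed_edge p d b g)\<^sup>2" 1] abs_signed_edge_le[OF p]
          by (simp add: abs_square_le_1)
        finally show ?case using c by (simp add: mult_left_mono)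
      qed
    qed simp
    ultimately show ?thesis by (simp add: K_def N.prob_space)
  next
    case False
    \<comment> \<open>Below the cap, \<open>edge_const p \<ge> 16\<close> forces
      \<open>k < d\<close>: there is room for the rotation, and a coordinate remains that keeps the
      conditional variance positive.\<close>
    have kd: "k < d"
    proof (rule ccontr)
      assume "\<not> k < d"
      then have "real d \<le> real k + 1" by simp
      then have "1 * real d \<le> edge_const p * (real k + 1)"
        using edge_const_ge[OF p] by (intro mult_mono) auto
      then show False using False d by (simp add: field_simps)
    qed
    obtain P P' where PP: "isometry_pair d P P'" and zero: "\<And>j i. j < k \<Longrightarrow> k \<le> i \<Longrightarrow> i < d \<Longrightarrow> P' (a j) i = 0"
      using isometry_pair_triangular[of k d a] kd by auto
    have P[measurable]: "P \<in> ?N \<rightarrow>\<^sub>M ?N" "P' \<in> ?N \<rightarrow>\<^sub>M ?N" and dP: "distr ?N ?N P = ?N" "distr ?N ?N P' = ?N"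
      and adj: "\<And>x y. inner_vec d (P x) y = inner_vec d x (P' y)" using PP by (auto simp: isometry_pair_def)
    have comm: "inner_vec d x y = inner_vec d y x" for x y by (simp add: inner_vec_def mult.commute)
    define E where "E b = (\<integral>y. (tail_error p d k b y)\<^sup>2 \<partial>?N)" for b
    have kd': "k \<le> d" using kd by simp
    have Em[measurable]: "E \<in> borel_measurable ?N"
      unfolding E_def using kd' by measurable
    have E1: "\<bar>E b\<bar> \<le> 1" for b
      unfolding E_def by (rule abs_integral_le_bound[OF NP]) (use abs_tail_error_le[OF p] in \<open>simp add: abs_square_le_1\<close>)
    \<comment> \<open>The rotation depends only on the fixed vectors \<open>a j\<close>, hence
      \<open>P' b\<close> is again Gaussian and the error term has the same mean as without the
      rotation.\<close>
    have EP: "(\<integral>b. E (P' b) \<partial>?N) = (\<integral>b. E b \<partial>?N)"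
      using integral_distr[OF P(2) Em] dP by simp
    have "(\<integral>b. \<bar>\<integral>g. signed_edge p d b g * F b g \<partial>?N\<bar> \<partial>?N) \<le> (c * (\<integral>b. E (P' b) \<partial>?N) + (\<integral>b. K b \<partial>?N) / c) / 2"
    proof (rule bound)
      show "integrable ?N (\<lambda>b. E (P' b))" by (rule integrable_bounded_prob[OF NP _ E1]) measurable
      have "AE b in distr ?N ?N P'. 0 < (\<Sum>l=k..<d. (b l)\<^sup>2)" unfolding dP by (rule AE_tail_sum_pos[OF kd])
      then have "AE b in ?N. 0 < (\<Sum>l=k..<d. (P' b l)\<^sup>2)" by (rule AE_distrD[OF P(2)])
      then show "AE b in ?N. \<bar>\<integral>g. signed_edge p d b g * F b g \<partial>?N\<bar> \<le> (c * E (P' b) + K b / c) / 2"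
        using AE_space
      proof eventually_elim
        case (elim b)
        note b = elim(2)
        have b': "P' b \<in> space ?N" using measurable_space[OF P(2) b] .
        define G where "G y = F b (P y)" for y
        have Gm[measurable]: "G \<in> borel_measurable ?N" unfolding G_def using b by measurable
        have GC: "\<bar>G y\<bar> \<le> C" for y unfolding G_def by (rule FC)
        \<comment> \<open>The rotated vectors \<open>P' (a j)\<close> are supported on the first
          \<open>k\<close> coordinates, so agreement of \<open>y\<close> and \<open>y'\<close> there
          gives equal inner products with every \<open>a j\<close>, which is all that
          \<open>F\<close> sees.\<close>
        have Gdep: "G y = G y'" if "y \<in> space ?N" "y' \<in> space ?N" "\<And>l. l < k \<Longrightarrow> y l = y' l" for y y'
          unfolding G_def
        proof (rule dep[OF b])
          show "P y \<in> space ?N" "P y' \<in> space ?N" using measurable_space[OF P(1)] that by auto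
          fix j assume j: "j < k"
          have "inner_vec d (a j) (P y) = inner_vec d y (P' (a j))" for y using adj comm by metis
          moreover have "inner_vec d y (P' (a j)) = inner_vec d y' (P' (a j))"
            unfolding inner_vec_def
          proof (rule sum.cong)
            show "y i * P' (a j) i = y' i * P' (a j) i" if "i \<in> {..<d}" for i
              using zero[OF j, of i] \<open>\<And>l. l < k \<Longrightarrow> y l = y' l\<close>[of i] that by (cases "i < k") auto
          qed simp
          ultimately show "inner_vec d (a j) (P y) = inner_vec d (a j) (P y')" by simp
        qed
        have Gi: "integrable ?N G" by (rule integrable_bounded_prob[OF NP Gm GC])
        have "(\<integral>g. signed_edge p d b g * F b g \<partial>?N) = (\<integral>y. signed_edge p d b (P y) * F b (P y) \<partial>?N)"
          by (subst (1) dP(1)[symmetric], rule integral_distr[OF P(1)]) (use b in measurable)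
        also have "\<dots> = (\<integral>y. indicator {threshold p d..} (inner_vec d (P' b) y) * G y - p * G y \<partial>?N)"
          using adj comm by (intro Bochner_Integration.integral_cong refl) (simp add: signed_edge_def G_def algebra_simps)
        also have "\<dots> = (\<integral>y. indicator {threshold p d..} (inner_vec d (P' b) y) * G y \<partial>?N) - (\<integral>y. p * G y \<partial>?N)"
        proof (rule Bochner_Integration.integral_diff)
          show "integrable ?N (\<lambda>y. indicator {threshold p d..} (inner_vec d (P' b) y) * G y)"
            by (rule integrable_bounded_prob[where C = C, OF NP]) (use b' GC C0 in \<open>auto simp: indicator_def\<close>)
        qed (use Gi in simp)
        also have "(\<integral>y. indicator {threshold p d..} (inner_vec d (P' b) y) * G y \<partial>?N)
          = (\<integral>y. normal_tail ((threshold p d - (\<Sum>l<k. P' b l * y l)) / sqrt (\<Sum>l=k..<d. (P' b l)\<^sup>2)) * G y \<partial>?N)"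
          by (rule integral_inner_vec_ge[OF kd' elim(1) Gm GC Gdep b'])
        also have "\<dots> = (\<integral>y. tail_error p d k (P' b) y * G y + p * G y \<partial>?N)"
          by (intro Bochner_Integration.integral_cong refl) (simp add: tail_error_def algebra_simps)
        also have "\<dots> = (\<integral>y. tail_error p d k (P' b) y * G y \<partial>?N) + (\<integral>y. p * G y \<partial>?N)"
        proof (rule Bochner_Integration.integral_add)
          show "integrable ?N (\<lambda>y. tail_error p d k (P' b) y * G y)"
          proof (rule integrable_bounded_prob[where C = C, OF NP])
            show "\<bar>tail_error p d k (P' b) y * G y\<bar> \<le> C" for y
              using mult_mono[OF abs_tail_error_le[OF p, of d k "P' b" y] GC[of y]] by (simp add: abs_mult)
          qed (use b' kd' in measurable)
        qed (use Gi in simp)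
        finally have "\<bar>\<integral>g. signed_edge p d b g * F b g \<partial>?N\<bar> = \<bar>\<integral>y. tail_error p d k (P' b) y * G y \<partial>?N\<bar>" by simp
        also have "\<dots> \<le> (c * E (P' b) + (\<integral>y. (G y)\<^sup>2 \<partial>?N) / c) / 2"
          unfolding E_def using b' kd' abs_tail_error_le[OF p] GC c
          by (intro abs_integral_mult_le[OF NP]) auto
        also have "(\<integral>y. (G y)\<^sup>2 \<partial>?N) = K b"
          unfolding K_def G_def by (subst (2) dP(1)[symmetric], rule integral_distr[OF P(1), symmetric]) (use b in measurable)
        finally show ?case .
      qed
    qed
    also have "\<dots> \<le> (c * edge_rate p d k + (\<integral>b. K b \<partial>?N) / c) / 2"
      using integral_tail_error_square[OF kd p] False c EP
      by (intro divide_right_mono add_right_mono mult_left_mono) (auto simp: E_def edge_rate_def)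
    finally show ?thesis by (simp add: K_def)
  qed
qed

section \<open>Signed paths of length two\<close>

definition signed_path :: "real \<Rightarrow> nat \<Rightarrow> (nat \<Rightarrow> real) \<Rightarrow> (nat \<Rightarrow> real) \<Rightarrow> real" where
  "signed_path p d x z = (\<integral>y. signed_edge p d x y * signed_edge p d z y \<partial>std_normal_vec d)"

lemma abs_signed_path_le:
  assumes "0 < p" "p < 1" shows "\<bar>signed_path p d x z\<bar> \<le> 1"
  unfolding signed_path_def
proof (rule abs_integral_le_bound[OF prob_space_std_normal_vec])
  show "\<bar>signed_edge p d x y * signed_edge p d z y\<bar> \<le> 1" for y
    using mult_mono[OF abs_signed_edge_le[OF assms, of d x y] abs_signed_edge_le[OF assms, of d z y]] by (simp add: abs_mult)
qed

lemma borel_measurable_signed_path[measurable (raw)]: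
  assumes [measurable]: "f \<in> M \<rightarrow>\<^sub>M std_normal_vec d" "g \<in> M \<rightarrow>\<^sub>M std_normal_vec d"
  shows "(\<lambda>x. signed_path p d (f x) (g x)) \<in> borel_measurable M"
proof -
  interpret prob_space "std_normal_vec d" by (rule prob_space_std_normal_vec)
  show ?thesis unfolding signed_path_def by measurable
qed

text \<open>Write \<open>g\<close> for \<open>signed_path p d x z\<close>, the kernel of the squared
  signed adjacency operator. Testing the edge from \<open>x\<close> to \<open>y\<close> against
  \<open>F x y = g * signed_edge p d z y\<close> reproduces \<open>g\<^sup>2\<close>, while
  \<open>F\<close> depends on \<open>y\<close> only through one inner product. With
  \<open>c = 1\<close> the integral of \<open>g\<^sup>2\<close> is at most half of
  \<open>edge_rate p d 1\<close> plus half of itself, which is absorbed.\<close>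

lemma integral_signed_path_square:
  assumes d: "1 \<le> d" and p: "0 < p" "p < 1" and z: "z \<in> space (std_normal_vec d)"
  shows "(\<integral>x. (signed_path p d x z)\<^sup>2 \<partial>std_normal_vec d) \<le> edge_rate p d 1"
proof -
  let ?N = "std_normal_vec d" and ?F = "\<lambda>x y. signed_path p d x z * signed_edge p d z y"
  interpret N: prob_space ?N by (rule prob_space_std_normal_vec)
  note NP = N.prob_space_axioms
  note m = abs_signed_edge_le[OF p] abs_signed_path_le[OF p]
  have FC: "\<bar>?F x y\<bar> \<le> 1" for x y
    using mult_mono[OF m(2)[of d x z] m(1)[of d z y]] by (simp add: abs_mult)
  have Fm: "(\<lambda>(x, y). ?F x y) \<in> borel_measurable (?N \<Otimes>\<^sub>M ?N)" unfolding case_prod_beta using z by measurable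
  have "(\<integral>x. (signed_path p d x z)\<^sup>2 \<partial>?N) = (\<integral>x. \<bar>\<integral>y. signed_edge p d x y * ?F x y \<partial>?N\<bar> \<partial>?N)"
  proof (intro Bochner_Integration.integral_cong refl)
    fix x assume "x \<in> space ?N"
    have "(\<integral>y. signed_edge p d x y * ?F x y \<partial>?N) = (\<integral>y. signed_path p d x z * (signed_edge p d x y * signed_edge p d z y) \<partial>?N)"
      by (simp add: mult_ac)
    also have "\<dots> = (signed_path p d x z)\<^sup>2" by (simp add: signed_path_def power2_eq_square)
    finally show "(signed_path p d x z)\<^sup>2 = \<bar>\<integral>y. signed_edge p d x y * ?F x y \<partial>?N\<bar>" by simp
  qed
  also have "\<dots> \<le> (1 * edge_rate p d 1 + (\<integral>x. \<integral>y. (?F x y)\<^sup>2 \<partial>?N \<partial>?N) / 1) / 2"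
    by (rule signed_edge_correlation[OF d p _ Fm FC, of 1 _ "\<lambda>_. z"]) (auto simp: signed_edge_def)
  finally have "(\<integral>x. (signed_path p d x z)\<^sup>2 \<partial>?N) \<le> (edge_rate p d 1 + (\<integral>x. \<integral>y. (?F x y)\<^sup>2 \<partial>?N \<partial>?N)) / 2" by simp
  moreover have "(\<integral>x. \<integral>y. (?F x y)\<^sup>2 \<partial>?N \<partial>?N) \<le> (\<integral>x. (signed_path p d x z)\<^sup>2 \<partial>?N)"
  proof (rule integral_mono)
    have i: "integrable ?N (\<lambda>y. (signed_edge p d z y)\<^sup>2)"
      by (rule integrable_bounded_prob[where C = 1, OF NP]) (use z m in \<open>auto simp: abs_square_le_1\<close>)
    have le: "(\<integral>y. (?F x y)\<^sup>2 \<partial>?N) \<le> (signed_path p d x z)\<^sup>2" for x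
    proof -
      have "(\<integral>y. (?F x y)\<^sup>2 \<partial>?N) = (signed_path p d x z)\<^sup>2 * (\<integral>y. (signed_edge p d z y)\<^sup>2 \<partial>?N)"
        using i by (simp add: power_mult_distrib)
      also have "\<dots> \<le> (signed_path p d x z)\<^sup>2 * 1"
        using abs_integral_le_bound[OF NP, of "\<lambda>y. (signed_edge p d z y)\<^sup>2" 1] m
        by (intro mult_left_mono) (auto simp: abs_square_le_1)
      finally show ?thesis by simp
    qed
    then show "(\<integral>y. (?F x y)\<^sup>2 \<partial>?N) \<le> (signed_path p d x z)\<^sup>2" for x .
    show i2: "integrable ?N (\<lambda>x. (signed_path p d x z)\<^sup>2)"
      by (rule integrable_bounded_prob[where C = 1, OF NP]) (use z m in \<open>auto simp: abs_square_le_1\<close>)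
    have "(\<lambda>x. \<integral>y. (?F x y)\<^sup>2 \<partial>?N) \<in> borel_measurable ?N" using z by measurable
    then show "integrable ?N (\<lambda>x. \<integral>y. (?F x y)\<^sup>2 \<partial>?N)"
      by (rule Bochner_Integration.integrable_bound[OF i2]) (use le in \<open>auto simp: abs_of_nonneg\<close>)
  qed
  ultimately show ?thesis by simp
qed

subsection \<open>Mixtures of independent edges\<close>

definition bern_mass :: "'e set \<Rightarrow> ('e \<Rightarrow> real) \<Rightarrow> 'e set \<Rightarrow> real" where
  "bern_mass S w \<omega> = (\<Prod>e\<in>S. if e \<in> \<omega> then w e else 1 - w e)"

lemma bern_mass_nonneg: "(\<And>e. e \<in> S \<Longrightarrow> 0 \<le> w e \<and> w e \<le> 1) \<Longrightarrow> 0 \<le> bern_mass S w \<omega>"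
  unfolding bern_mass_def by (intro prod_nonneg) auto

lemma bern_mass_le_1: "(\<And>e. e \<in> S \<Longrightarrow> 0 \<le> w e \<and> w e \<le> 1) \<Longrightarrow> bern_mass S w \<omega> \<le> 1"
  unfolding bern_mass_def by (intro prod_le_1) auto

lemma bern_mass_insert:
  assumes "finite S" "e \<notin> S" "\<omega> \<subseteq> S"
  shows "bern_mass (insert e S) w \<omega> = (1 - w e) * bern_mass S w \<omega>"
    and "bern_mass (insert e S) w (insert e \<omega>) = w e * bern_mass S w \<omega>"
proof -
  show "bern_mass (insert e S) w \<omega> = (1 - w e) * bern_mass S w \<omega>"
    using assms by (auto simp: bern_mass_def)
  have "(\<Prod>f\<in>S. if f = e \<or> f \<in> \<omega> then w f else 1 - w f) = (\<Prod>f\<in>S. if f \<in> \<omega> then w f else 1 - w f)"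
    using assms by (intro prod.cong) auto
  then show "bern_mass (insert e S) w (insert e \<omega>) = w e * bern_mass S w \<omega>"
    using assms by (simp add: bern_mass_def)
qed

lemma sum_Pow_insert:
  assumes "finite S" "e \<notin> S"
  shows "(\<Sum>\<omega>\<in>Pow (insert e S). f \<omega>) = (\<Sum>\<omega>\<in>Pow S. f \<omega> + f (insert e \<omega>))"
proof -
  have "(\<Sum>\<omega>\<in>Pow (insert e S). f \<omega>) = (\<Sum>\<omega>\<in>Pow S. f \<omega>) + (\<Sum>\<omega>\<in>insert e ` Pow S. f \<omega>)"
    unfolding Pow_insert using assms by (intro sum.union_disjoint) auto
  also have "(\<Sum>\<omega>\<in>insert e ` Pow S. f \<omega>) = (\<Sum>\<omega>\<in>Pow S. f (insert e \<omega>))"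
    using assms by (intro sum.reindex_cong[of "insert e"]) (auto intro!: inj_onI)
  finally show ?thesis by (simp add: sum.distrib)
qed

text \<open>Independence of the edges in algebraic form; the expectations of cycle statistics given
  the latent vectors are reduced to it.\<close>

lemma sum_bern_mass_prod:
  assumes "finite S"
  shows "(\<Sum>\<omega>\<in>Pow S. bern_mass S w \<omega> * (\<Prod>e\<in>S. h e (e \<in> \<omega>))) = (\<Prod>e\<in>S. w e * h e True + (1 - w e) * h e False)"
  using assms
proof (induction S)
  case (insert e S)
  have "(\<Sum>\<omega>\<in>Pow (insert e S). bern_mass (insert e S) w \<omega> * (\<Prod>f\<in>insert e S. h f (f \<in> \<omega>)))
    = (\<Sum>\<omega>\<in>Pow S. (w e * h e True + (1 - w e) * h e False) * (bern_mass S w \<omega> * (\<Prod>f\<in>S. h f (f \<in> \<omega>))))"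
    unfolding sum_Pow_insert[OF insert.hyps]
  proof (intro sum.cong refl)
    fix \<omega> assume \<omega>: "\<omega> \<in> Pow S"
    have "(\<Prod>f\<in>S. h f (f \<in> insert e \<omega>)) = (\<Prod>f\<in>S. h f (f \<in> \<omega>))"
    proof (rule prod.cong[OF refl])
      fix f assume "f \<in> S"
      then have "f \<noteq> e" using insert.hyps(2) by auto
      then show "h f (f \<in> insert e \<omega>) = h f (f \<in> \<omega>)" by simp
    qed
    moreover have "e \<notin> \<omega>" using \<omega> insert by auto
    ultimately show "bern_mass (insert e S) w \<omega> * (\<Prod>f\<in>insert e S. h f (f \<in> \<omega>))
        + bern_mass (insert e S) w (insert e \<omega>) * (\<Prod>f\<in>insert e S. h f (f \<in> insert e \<omega>))
      = (w e * h e True + (1 - w e) * h e False) * (bern_mass S w \<omega> * (\<Prod>f\<in>S. h f (f \<in> \<omega>)))"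
      using \<omega> insert.hyps by (simp add: bern_mass_insert algebra_simps)
  qed
  then show ?case using insert by (simp add: sum_distrib_left[symmetric])
qed (simp add: bern_mass_def)

lemma sum_bern_mass: "finite S \<Longrightarrow> (\<Sum>\<omega>\<in>Pow S. bern_mass S w \<omega>) = 1"
  using sum_bern_mass_prod[of S w "\<lambda>_ _. 1"] by simp

lemma finite_vertex_pairs: "finite (vertex_pairs n)"
  by (rule finite_subset[of _ "{1..n} \<times> {1..n}"]) (auto simp: vertex_pairs_def)

lemma pmf_indep_edges:
  assumes "\<And>i j. 0 \<le> w i j \<and> w i j \<le> 1"
  shows "pmf (indep_edges n w) \<omega> = (if \<omega> \<subseteq> vertex_pairs n then bern_mass (vertex_pairs n) (\<lambda>(i, j). w i j) \<omega> else 0)"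
proof -
  note fin = finite_vertex_pairs[of n]
  let ?P = "Pi_pmf (vertex_pairs n) False (\<lambda>(i, j). bernoulli_pmf (w i j))"
  \<comment> \<open>The default value \<open>False\<close> already excludes pairs outside
    \<open>vertex_pairs n\<close>; dropping the explicit restriction makes the map injective, so
    single masses can be read off.\<close>
  have "indep_edges n w = map_pmf (\<lambda>f. {e. f e}) ?P"
    unfolding indep_edges_def
  proof (rule map_pmf_cong[OF refl])
    fix f assume "f \<in> set_pmf ?P"
    then have "f e = False" if "e \<notin> vertex_pairs n" for e
      using subsetD[OF set_Pi_pmf_subset'[OF fin] \<open>f \<in> _\<close>] that by (cases e) (auto simp: PiE_dflt_def)
    then show "{e \<in> vertex_pairs n. f e} = {e. f e}" by auto
  qed
  moreover have "pmf (map_pmf (\<lambda>f. {e. f e}) ?P) {e. e \<in> \<omega>} = pmf ?P (\<lambda>e. e \<in> \<omega>)"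
    by (rule pmf_map_inj') (auto intro!: injI)
  ultimately have "pmf (indep_edges n w) \<omega> = pmf ?P (\<lambda>e. e \<in> \<omega>)" by simp
  also have "\<dots> = (if \<omega> \<subseteq> vertex_pairs n then (\<Prod>e\<in>vertex_pairs n. pmf (case e of (i, j) \<Rightarrow> bernoulli_pmf (w i j)) (e \<in> \<omega>)) else 0)"
    unfolding pmf_Pi[OF fin] by auto
  also have "(\<Prod>e\<in>vertex_pairs n. pmf (case e of (i, j) \<Rightarrow> bernoulli_pmf (w i j)) (e \<in> \<omega>))
    = bern_mass (vertex_pairs n) (\<lambda>(i, j). w i j) \<omega>"
    unfolding bern_mass_def using assms by (intro prod.cong refl) (auto split: prod.splits)
  finally show ?thesis .
qed

lemma prob_indep_edges:
  assumes "\<And>i j. 0 \<le> w i j \<and> w i j \<le> 1"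
  shows "measure (measure_pmf (indep_edges n w)) A
    = (\<Sum>\<omega>\<in>A \<inter> Pow (vertex_pairs n). bern_mass (vertex_pairs n) (\<lambda>(i, j). w i j) \<omega>)"
proof -
  have "measure (measure_pmf (indep_edges n w)) A = measure (measure_pmf (indep_edges n w)) (A \<inter> Pow (vertex_pairs n))"
  proof (rule measure_prob_cong_0)
    show "pmf (indep_edges n w) \<omega> = 0" if "\<omega> \<in> A - A \<inter> Pow (vertex_pairs n)" for \<omega>
      using that by (simp add: pmf_indep_edges[OF assms])
  qed auto
  also have "\<dots> = (\<Sum>\<omega>\<in>A \<inter> Pow (vertex_pairs n). pmf (indep_edges n w) \<omega>)"
    by (rule measure_measure_pmf_finite) (simp add: finite_vertex_pairs)
  also have "\<dots> = (\<Sum>\<omega>\<in>A \<inter> Pow (vertex_pairs n). bern_mass (vertex_pairs n) (\<lambda>(i, j). w i j) \<omega>)"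
    by (intro sum.cong refl) (auto simp: pmf_indep_edges[OF assms])
  finally show ?thesis .
qed

definition mix_mass :: "'x measure \<Rightarrow> ('x \<Rightarrow> 'e \<Rightarrow> real) \<Rightarrow> 'e set \<Rightarrow> 'e set \<Rightarrow> real" where
  "mix_mass M w S \<omega> = (\<integral>x. bern_mass S (w x) \<omega> \<partial>M)"

text \<open>Given the latent variable \<open>x\<close> with law \<open>M\<close>, the edges are independent, and \<open>w x e\<close> is the
  conditional probability of the edge \<open>e\<close>.\<close>

locale edge_mixture =
  fixes M :: "'x measure" and w :: "'x \<Rightarrow> 'e \<Rightarrow> real" and E :: "'e set"
  assumes prob_M: "prob_space M" and fin_E: "finite E"
    and w_meas: "\<And>e. e \<in> E \<Longrightarrow> (\<lambda>x. w x e) \<in> borel_measurable M"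
    and w_bounds: "\<And>x e. e \<in> E \<Longrightarrow> 0 \<le> w x e" "\<And>x e. e \<in> E \<Longrightarrow> w x e \<le> 1"
begin

sublocale prob_space M by (rule prob_M)

lemma bern_meas: "S \<subseteq> E \<Longrightarrow> (\<lambda>x. bern_mass S (w x) \<omega>) \<in> borel_measurable M"
  unfolding bern_mass_def using w_meas by (intro borel_measurable_prod) auto

lemma bern_bounds: "S \<subseteq> E \<Longrightarrow> 0 \<le> bern_mass S (w x) \<omega>" "S \<subseteq> E \<Longrightarrow> bern_mass S (w x) \<omega> \<le> 1"
  using w_bounds by (auto intro!: bern_mass_nonneg bern_mass_le_1)

lemma bern_integrable: "S \<subseteq> E \<Longrightarrow> integrable M (\<lambda>x. bern_mass S (w x) \<omega>)"
  by (rule integrable_bounded_prob[OF prob_M bern_meas, where C = 1]) (use bern_bounds in auto)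

lemma mix_nonneg: "S \<subseteq> E \<Longrightarrow> 0 \<le> mix_mass M w S \<omega>"
  unfolding mix_mass_def using bern_bounds by (intro Bochner_Integration.integral_nonneg) auto

lemma sum_integral_bern:
  assumes "S \<subseteq> E"
  shows "(\<integral>x. (\<Sum>\<omega>\<in>A. F \<omega> * bern_mass S (w x) \<omega>) \<partial>M) = (\<Sum>\<omega>\<in>A. F \<omega> * mix_mass M w S \<omega>)"
  unfolding mix_mass_def using bern_integrable[OF assms] by (subst Bochner_Integration.integral_sum) auto

lemma sum_mix: "S \<subseteq> E \<Longrightarrow> (\<Sum>\<omega>\<in>Pow S. mix_mass M w S \<omega>) = 1"
  using sum_integral_bern[of S "\<lambda>_. 1" "Pow S"] sum_bern_mass[of S] finite_subset[OF _ fin_E]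
  by (simp add: prob_space)

end

section \<open>Relative entropy while edges are revealed\<close>

definition mix_KL :: "'x measure \<Rightarrow> ('x \<Rightarrow> 'e \<Rightarrow> real) \<Rightarrow> real \<Rightarrow> 'e set \<Rightarrow> real" where
  "mix_KL M w p S = (\<Sum>\<omega>\<in>Pow S. mix_mass M w S \<omega> * ln (mix_mass M w S \<omega> / bern_mass S (\<lambda>_. p) \<omega>))"

text \<open>Here \<open>Q\<close> and \<open>P\<close> are the masses of a history under the two
  laws, and \<open>D\<close> is the excess over \<open>p * Q\<close> of the mass with the next edge
  present. Applying \<open>ln x \<le> x - 1\<close> to each outcome bounds the entropy of the new
  edge by its chi-square divergence. If \<open>Q = 0\<close>, the sign conditions force
  \<open>D = 0\<close>, and division by 0 yields the right value 0.\<close>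

lemma entropy_step:
  fixes Q D P p :: real
  assumes "0 < p" "p < 1" "0 < P" "0 \<le> p * Q + D" "0 \<le> (1 - p) * Q - D"
  shows "(p * Q + D) * ln ((p * Q + D) / (p * P)) + ((1 - p) * Q - D) * ln (((1 - p) * Q - D) / ((1 - p) * P))
    \<le> Q * ln (Q / P) + D\<^sup>2 / Q / (p * (1 - p))"
proof (cases "Q = 0")
  case True
  then show ?thesis using assms by simp
next
  case False
  have Q: "0 < Q" using assms False by (smt (verit) left_diff_distrib mult_cancel_right1)
  have 1: "R * ln (R / (r * P)) \<le> R * ln (Q / P) + R * (R / (r * Q) - 1)" if "0 \<le> R" "0 < r" for R r
  proof (cases "R = 0")
    case False
    then have R: "0 < R" using that by simp
    have "ln (R / (r * P)) = ln (Q / P) + ln (R / (r * Q))"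
      using R Q that assms by (simp add: ln_div ln_mult)
    also have "ln (R / (r * Q)) \<le> R / (r * Q) - 1" using R Q that by (intro ln_le_minus_one) simp
    finally show ?thesis using R by (simp add: distrib_left[symmetric])
  qed simp
  have "(p * Q + D) * ((p * Q + D) / (p * Q) - 1) + ((1 - p) * Q - D) * (((1 - p) * Q - D) / ((1 - p) * Q) - 1)
    = D\<^sup>2 / Q / (p * (1 - p))"
    using Q assms by (simp add: divide_simps) (simp add: power2_eq_square algebra_simps)
  moreover have "(p * Q + D) * ln (Q / P) + ((1 - p) * Q - D) * ln (Q / P) = Q * ln (Q / P)"
    by (simp add: algebra_simps)
  ultimately show ?thesis using 1[of "p * Q + D" p] 1[of "(1 - p) * Q - D" "1 - p"] assms by linarith
qed

lemma square_mean_le: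
  fixes F m :: "'a \<Rightarrow> real"
  assumes "finite A" "\<And>a. a \<in> A \<Longrightarrow> 0 \<le> m a" "(\<Sum>a\<in>A. m a) = 1"
  shows "(\<Sum>a\<in>A. F a * m a)\<^sup>2 \<le> (\<Sum>a\<in>A. (F a)\<^sup>2 * m a)"
proof -
  define \<mu> where "\<mu> = (\<Sum>a\<in>A. F a * m a)"
  have "0 \<le> (\<Sum>a\<in>A. (F a - \<mu>)\<^sup>2 * m a)" using assms by (intro sum_nonneg) auto
  also have "\<dots> = (\<Sum>a\<in>A. (F a)\<^sup>2 * m a - 2 * \<mu> * (F a * m a) + \<mu>\<^sup>2 * m a)"
    by (intro sum.cong refl) (simp add: power2_diff algebra_simps)
  also have "\<dots> = (\<Sum>a\<in>A. (F a)\<^sup>2 * m a) - \<mu>\<^sup>2"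
    using assms by (simp add: sum.distrib sum_subtractf sum_distrib_left[symmetric] \<mu>_def[symmetric] power2_eq_square)
  finally show ?thesis by (simp add: \<mu>_def)
qed

context edge_mixture
begin

text \<open>The chain rule for the relative entropy, with the entropy of a single edge bounded by the
  chi-square divergence. The latter is a supremum over test functions \<open>F\<close> of the previous edges.\<close>

lemma mix_KL_insert:
  assumes S: "S \<subseteq> E" "e \<in> E" "e \<notin> S" and p: "0 < p" "p < 1" and q: "0 \<le> q"
    and corr: "\<And>F c. 0 < c \<Longrightarrow> \<bar>\<integral>x. (w x e - p) * (\<Sum>\<omega>\<in>Pow S. F \<omega> * bern_mass S (w x) \<omega>) \<partial>M\<bar>
      \<le> q * (c * \<epsilon> + (\<integral>x. (\<Sum>\<omega>\<in>Pow S. F \<omega> * bern_mass S (w x) \<omega>)\<^sup>2 \<partial>M) / c) / 2"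
  shows "mix_KL M w p (insert e S) \<le> mix_KL M w p S + q\<^sup>2 * \<epsilon> / (p * (1 - p))"
proof -
  have fin: "finite S" using S fin_E finite_subset by auto
  have iS: "insert e S \<subseteq> E" using S by auto
  define Q where "Q = mix_mass M w S"
  define D where "D \<omega> = (\<integral>x. (w x e - p) * bern_mass S (w x) \<omega> \<partial>M)" for \<omega>
  have Q0: "0 \<le> Q \<omega>" for \<omega> unfolding Q_def by (rule mix_nonneg[OF S(1)])
  have we: "\<bar>w x e - p\<bar> \<le> 1" for x using w_bounds[OF S(2), of x] p by linarith
  have iD: "integrable M (\<lambda>x. (w x e - p) * bern_mass S (w x) \<omega>)" for \<omega>
  proof (rule integrable_bounded_prob[OF prob_M, where C = 1])
    show "(\<lambda>x. (w x e - p) * bern_mass S (w x) \<omega>) \<in> borel_measurable M"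
      using w_meas[OF S(2)] bern_meas[OF S(1)] by measurable
    show "\<bar>(w x e - p) * bern_mass S (w x) \<omega>\<bar> \<le> 1" for x
      using mult_mono[OF we[of x], of "\<bar>bern_mass S (w x) \<omega>\<bar>" 1] bern_bounds[OF S(1), of x \<omega>] by (simp add: abs_mult)
  qed
  have ins: "mix_mass M w (insert e S) (insert e \<omega>) = p * Q \<omega> + D \<omega>"
    "mix_mass M w (insert e S) \<omega> = (1 - p) * Q \<omega> - D \<omega>" if "\<omega> \<subseteq> S" for \<omega>
  proof -
    have "mix_mass M w (insert e S) (insert e \<omega>) = (\<integral>x. p * bern_mass S (w x) \<omega> + (w x e - p) * bern_mass S (w x) \<omega> \<partial>M)"
      unfolding mix_mass_def using that S fin by (simp add: bern_mass_insert algebra_simps)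
    then show "mix_mass M w (insert e S) (insert e \<omega>) = p * Q \<omega> + D \<omega>"
      using iD[of \<omega>] bern_integrable[OF S(1), of \<omega>] by (simp add: D_def Q_def mix_mass_def)
    have "mix_mass M w (insert e S) \<omega> = (\<integral>x. (1 - p) * bern_mass S (w x) \<omega> - (w x e - p) * bern_mass S (w x) \<omega> \<partial>M)"
      unfolding mix_mass_def using that S fin by (simp add: bern_mass_insert algebra_simps)
    then show "mix_mass M w (insert e S) \<omega> = (1 - p) * Q \<omega> - D \<omega>"
      using iD[of \<omega>] bern_integrable[OF S(1), of \<omega>] by (simp add: D_def Q_def mix_mass_def)
  qed
  have nn: "0 \<le> p * Q \<omega> + D \<omega>" "0 \<le> (1 - p) * Q \<omega> - D \<omega>" if "\<omega> \<subseteq> S" for \<omega>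
    using mix_nonneg[OF iS, of "insert e \<omega>"] mix_nonneg[OF iS, of \<omega>] ins[OF that] by simp_all
  have pos: "0 < bern_mass S (\<lambda>_. p) \<omega>" for \<omega>
    unfolding bern_mass_def using p by (intro prod_pos) auto
  define X where "X = (\<Sum>\<omega>\<in>Pow S. (D \<omega>)\<^sup>2 / Q \<omega>)"
  \<comment> \<open>\<open>F \<omega>\<close> is the conditional mean of \<open>w x e - p\<close>
    given that the edges of \<open>S\<close> form \<omega>. It is the optimal test function: its
    correlation with \<open>w x e - p\<close> and its squared norm under \<open>Q\<close> are both
    \<open>X\<close>.\<close>
  define F where "F \<omega> = D \<omega> / Q \<omega>" for \<omega>
  let ?Fb = "\<lambda>x. \<Sum>\<omega>\<in>Pow S. F \<omega> * bern_mass S (w x) \<omega>"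
  have FD: "(\<integral>x. (w x e - p) * ?Fb x \<partial>M) = X"
  proof -
    have "(\<integral>x. (w x e - p) * ?Fb x \<partial>M) = (\<integral>x. (\<Sum>\<omega>\<in>Pow S. F \<omega> * ((w x e - p) * bern_mass S (w x) \<omega>)) \<partial>M)"
      by (simp add: sum_distrib_left mult_ac)
    also have "\<dots> = (\<Sum>\<omega>\<in>Pow S. F \<omega> * D \<omega>)"
      unfolding D_def using iD by (subst Bochner_Integration.integral_sum) auto
    also have "\<dots> = X" unfolding X_def F_def by (simp add: power2_eq_square)
    finally show ?thesis .
  qed
  \<comment> \<open>\<open>?Fb x\<close> averages \<open>F\<close> over the edges given
    \<open>x\<close>, so its square is at most the average of the squares.\<close>
  have FF: "(\<integral>x. (?Fb x)\<^sup>2 \<partial>M) \<le> X"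
  proof -
    have le: "(?Fb x)\<^sup>2 \<le> (\<Sum>\<omega>\<in>Pow S. (F \<omega>)\<^sup>2 * bern_mass S (w x) \<omega>)" for x
      using fin bern_bounds(1)[OF S(1)] sum_bern_mass[OF fin] by (intro square_mean_le) auto
    have i: "integrable M (\<lambda>x. \<Sum>\<omega>\<in>Pow S. (F \<omega>)\<^sup>2 * bern_mass S (w x) \<omega>)"
      using bern_integrable[OF S(1)] by (intro Bochner_Integration.integrable_sum integrable_mult_right) auto
    have "?Fb \<in> borel_measurable M" using bern_meas[OF S(1)] by (intro borel_measurable_sum borel_measurable_times) auto
    then have "integrable M (\<lambda>x. (?Fb x)\<^sup>2)"
      by (intro Bochner_Integration.integrable_bound[OF i]) (use le in \<open>auto intro: order_trans[OF _ abs_ge_self]\<close>)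
    then have "(\<integral>x. (?Fb x)\<^sup>2 \<partial>M) \<le> (\<integral>x. (\<Sum>\<omega>\<in>Pow S. (F \<omega>)\<^sup>2 * bern_mass S (w x) \<omega>) \<partial>M)"
      using i le by (intro integral_mono) auto
    also have "\<dots> = (\<Sum>\<omega>\<in>Pow S. (F \<omega>)\<^sup>2 * Q \<omega>)" unfolding Q_def by (rule sum_integral_bern[OF S(1)])
    also have "\<dots> = X" unfolding X_def
    proof (intro sum.cong refl)
      show "(F \<omega>)\<^sup>2 * Q \<omega> = (D \<omega>)\<^sup>2 / Q \<omega>" for \<omega>
        by (cases "Q \<omega> = 0") (auto simp: F_def power2_eq_square)
    qed
    finally show ?thesis .
  qed
  have X: "X \<le> q\<^sup>2 * \<epsilon>"
  proof (cases "q = 0")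
    case True
    then show ?thesis using corr[of 1 F] FD by simp
  next
    case False
    then have q: "0 < q" using q by simp
    \<comment> \<open>The weight \<open>c = q\<close> balances the two terms: \<open>X\<close> is at
      most half of \<open>q\<^sup>2 * \<epsilon> + X\<close>, and half of \<open>X\<close> is
      absorbed.\<close>
    have "X \<le> q * (q * \<epsilon> + (\<integral>x. (?Fb x)\<^sup>2 \<partial>M) / q) / 2" using corr[OF q, of F] FD by linarith
    also have "\<dots> \<le> q * (q * \<epsilon> + X / q) / 2" using FF q by (intro divide_right_mono mult_left_mono add_left_mono) auto
    also have "\<dots> = (q\<^sup>2 * \<epsilon> + X) / 2" using q by (simp add: field_simps power2_eq_square)
    finally show ?thesis by simp
  qed
  have "mix_KL M w p (insert e S) = (\<Sum>\<omega>\<in>Pow S. ((1 - p) * Q \<omega> - D \<omega>) * ln (((1 - p) * Q \<omega> - D \<omega>) / ((1 - p) * bern_mass S (\<lambda>_. p) \<omega>))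
      + (p * Q \<omega> + D \<omega>) * ln ((p * Q \<omega> + D \<omega>) / (p * bern_mass S (\<lambda>_. p) \<omega>)))"
    unfolding mix_KL_def sum_Pow_insert[OF fin S(3)]
    using S fin by (intro sum.cong refl) (auto simp: ins bern_mass_insert)
  also have "\<dots> \<le> (\<Sum>\<omega>\<in>Pow S. Q \<omega> * ln (Q \<omega> / bern_mass S (\<lambda>_. p) \<omega>) + (D \<omega>)\<^sup>2 / Q \<omega> / (p * (1 - p)))"
  proof (rule sum_mono)
    fix \<omega> assume "\<omega> \<in> Pow S"
    then show "((1 - p) * Q \<omega> - D \<omega>) * ln (((1 - p) * Q \<omega> - D \<omega>) / ((1 - p) * bern_mass S (\<lambda>_. p) \<omega>))
      + (p * Q \<omega> + D \<omega>) * ln ((p * Q \<omega> + D \<omega>) / (p * bern_mass S (\<lambda>_. p) \<omega>))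
      \<le> Q \<omega> * ln (Q \<omega> / bern_mass S (\<lambda>_. p) \<omega>) + (D \<omega>)\<^sup>2 / Q \<omega> / (p * (1 - p))"
      using entropy_step[OF p pos nn] by (simp add: add.commute)
  qed
  also have "\<dots> = mix_KL M w p S + X / (p * (1 - p))"
    by (simp add: sum.distrib mix_KL_def Q_def X_def sum_divide_distrib)
  also have "X / (p * (1 - p)) \<le> q\<^sup>2 * \<epsilon> / (p * (1 - p))" using X p by (intro divide_right_mono) auto
  finally show ?thesis by simp
qed

text \<open>Pinsker's inequality up to a constant, through the Hellinger distance.\<close>

lemma total_variation_le_KL:
  assumes S: "S \<subseteq> E" and p: "0 < p" "p < 1"
  shows "(\<Sum>\<omega>\<in>Pow S. \<bar>bern_mass S (\<lambda>_. p) \<omega> - mix_mass M w S \<omega>\<bar>) \<le> 2 * sqrt (mix_KL M w p S)"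
proof -
  have fin: "finite S" using S fin_E finite_subset by auto
  define P Q where "P = bern_mass S (\<lambda>_. p)" and "Q = mix_mass M w S"
  have P: "0 < P \<omega>" for \<omega> unfolding P_def bern_mass_def using p by (intro prod_pos) auto
  have Q: "0 \<le> Q \<omega>" for \<omega> unfolding Q_def by (rule mix_nonneg[OF S])
  have sP: "(\<Sum>\<omega>\<in>Pow S. P \<omega>) = 1" unfolding P_def by (rule sum_bern_mass[OF fin])
  have sQ: "(\<Sum>\<omega>\<in>Pow S. Q \<omega>) = 1" unfolding Q_def by (rule sum_mix[OF S])
  \<comment> \<open>A term of the squared Hellinger distance, estimated by
    \<open>ln x \<le> x - 1\<close> at \<open>x = sqrt (P \<omega> / Q \<omega>)\<close>; the linear
    parts \<open>P \<omega> - Q \<omega>\<close> cancel in the sum.\<close>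
  have hell: "(sqrt (P \<omega>) - sqrt (Q \<omega>))\<^sup>2 \<le> P \<omega> - Q \<omega> + Q \<omega> * ln (Q \<omega> / P \<omega>)" for \<omega>
  proof (cases "Q \<omega> = 0")
    case True then show ?thesis using P[of \<omega>] by simp
  next
    case False
    then have q: "0 < Q \<omega>" using Q[of \<omega>] by simp
    have "ln (sqrt (P \<omega> / Q \<omega>)) \<le> sqrt (P \<omega> / Q \<omega>) - 1" using P[of \<omega>] q by (intro ln_le_minus_one) simp
    then have "- ln (Q \<omega> / P \<omega>) \<le> 2 * (sqrt (P \<omega> / Q \<omega>) - 1)" using P[of \<omega>] q by (simp add: ln_sqrt ln_div)
    then have "Q \<omega> * (- ln (Q \<omega> / P \<omega>)) \<le> Q \<omega> * (2 * (sqrt (P \<omega> / Q \<omega>) - 1))" using q by (intro mult_left_mono) auto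
    also have "\<dots> = 2 * (sqrt (P \<omega>) * sqrt (Q \<omega>)) - 2 * Q \<omega>"
      using q by (simp add: real_sqrt_divide field_simps)
    finally show ?thesis using P[of \<omega>] q by (simp add: power2_diff)
  qed
  have KL: "(\<Sum>\<omega>\<in>Pow S. (sqrt (P \<omega>) - sqrt (Q \<omega>))\<^sup>2) \<le> mix_KL M w p S"
  proof -
    have "(\<Sum>\<omega>\<in>Pow S. (sqrt (P \<omega>) - sqrt (Q \<omega>))\<^sup>2) \<le> (\<Sum>\<omega>\<in>Pow S. P \<omega> - Q \<omega> + Q \<omega> * ln (Q \<omega> / P \<omega>))"
      by (intro sum_mono hell)
    also have "\<dots> = (\<Sum>\<omega>\<in>Pow S. Q \<omega> * ln (Q \<omega> / P \<omega>))"
      by (simp add: sum.distrib sum_subtractf sP sQ)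
    finally show ?thesis by (simp add: mix_KL_def P_def Q_def)
  qed
  have pl: "(\<Sum>\<omega>\<in>Pow S. (sqrt (P \<omega>) + sqrt (Q \<omega>))\<^sup>2) \<le> 4"
  proof -
    have "(\<Sum>\<omega>\<in>Pow S. (sqrt (P \<omega>) + sqrt (Q \<omega>))\<^sup>2) \<le> (\<Sum>\<omega>\<in>Pow S. 2 * P \<omega> + 2 * Q \<omega>)"
    proof (rule sum_mono)
      show "(sqrt (P \<omega>) + sqrt (Q \<omega>))\<^sup>2 \<le> 2 * P \<omega> + 2 * Q \<omega>" for \<omega>
        using power2_add_le[of "sqrt (P \<omega>)" "sqrt (Q \<omega>)"] P[of \<omega>] Q[of \<omega>] by simp
    qed
    then show ?thesis by (simp add: sum.distrib sP sQ flip: sum_distrib_left)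
  qed
  \<comment> \<open>\<open>P - Q\<close> is factored as a difference of squares of roots before
    applying the Cauchy-Schwarz inequality; the sums of roots contribute at most
    \<open>sqrt 4\<close>.\<close>
  have "(\<Sum>\<omega>\<in>Pow S. \<bar>P \<omega> - Q \<omega>\<bar>) = (\<Sum>\<omega>\<in>Pow S. \<bar>sqrt (P \<omega>) - sqrt (Q \<omega>)\<bar> * \<bar>sqrt (P \<omega>) + sqrt (Q \<omega>)\<bar>)"
  proof (intro sum.cong refl)
    fix \<omega>
    have "P \<omega> - Q \<omega> = (sqrt (P \<omega>) - sqrt (Q \<omega>)) * (sqrt (P \<omega>) + sqrt (Q \<omega>))"
      using P[of \<omega>] Q[of \<omega>] by (simp add: algebra_simps)
    then show "\<bar>P \<omega> - Q \<omega>\<bar> = \<bar>sqrt (P \<omega>) - sqrt (Q \<omega>)\<bar> * \<bar>sqrt (P \<omega>) + sqrt (Q \<omega>)\<bar>" by (simp only: abs_mult)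
  qed
  also have "\<dots> \<le> L2_set (\<lambda>\<omega>. sqrt (P \<omega>) - sqrt (Q \<omega>)) (Pow S) * L2_set (\<lambda>\<omega>. sqrt (P \<omega>) + sqrt (Q \<omega>)) (Pow S)"
    by (rule L2_set_mult_ineq)
  also have "\<dots> \<le> sqrt (mix_KL M w p S) * sqrt 4"
    unfolding L2_set_def using KL pl by (intro mult_mono real_sqrt_le_mono) (auto intro!: sum_nonneg order_trans[OF _ KL])
  finally show ?thesis by (simp add: P_def Q_def)
qed

end

subsection \<open>Impossibility\<close>

abbreviation latent :: "nat \<Rightarrow> nat \<Rightarrow> (nat \<Rightarrow> nat \<Rightarrow> real) measure" where
  "latent n d \<equiv> PiM {1..n} (\<lambda>_. std_normal_vec d)"

definition noisy_weight :: "real \<Rightarrow> nat \<Rightarrow> real \<Rightarrow> (nat \<Rightarrow> nat \<Rightarrow> real) \<Rightarrow> nat \<times> nat \<Rightarrow> real" where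
  "noisy_weight p d q x e = p + q * signed_edge p d (x (fst e)) (x (snd e))"

lemma noisy_weight_bounds:
  assumes "0 < p" "p < 1" "0 \<le> q" "q \<le> 1"
  shows "0 \<le> noisy_weight p d q x e" "noisy_weight p d q x e \<le> 1"
proof -
  have "q * p \<le> 1 * p" "q * (1 - p) \<le> 1 * (1 - p)" "0 \<le> q * p" "0 \<le> q * (1 - p)"
    using assms by (auto intro!: mult_right_mono)
  moreover have "noisy_weight p d q x e = p + q * (1 - p) \<or> noisy_weight p d q x e = p - q * p"
    by (auto simp: noisy_weight_def signed_edge_def indicator_def)
  moreover have "p + q * (1 - p) \<le> 1" using \<open>q * (1 - p) \<le> 1 * (1 - p)\<close> by simp
  ultimately show "0 \<le> noisy_weight p d q x e" "noisy_weight p d q x e \<le> 1"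
    using assms by linarith+
qed

lemma noisy_weight_connection_prob:
  "noisy_weight p d q x (i, j) = connection_prob p d q (inner_vec d (x i) (x j))"
  by (simp add: noisy_weight_def connection_prob_def signed_edge_def algebra_simps)

lemma measurable_latent_component:
  assumes "1 \<le> i" "i \<le> n"
  shows "(\<lambda>x. x i) \<in> latent n d \<rightarrow>\<^sub>M std_normal_vec d"
  using assms by (intro measurable_component_singleton) auto

lemma borel_measurable_signed_edge_latent:
  assumes "1 \<le> i" "i \<le> n" "1 \<le> j" "j \<le> n"
  shows "(\<lambda>x. signed_edge p d (x i) (x j)) \<in> borel_measurable (latent n d)"
  using assms by (intro borel_measurable_signed_edge measurable_latent_component)

lemma borel_measurable_noisy_weight:
  assumes "1 \<le> fst e" "fst e \<le> n" "1 \<le> snd e" "snd e \<le> n"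
  shows "(\<lambda>x. noisy_weight p d q x e) \<in> borel_measurable (latent n d)"
  unfolding noisy_weight_def using borel_measurable_signed_edge_latent[OF assms] by measurable

lemma edge_mixture_noisy:
  assumes "0 < p" "p < 1" "0 \<le> q" "q \<le> 1"
  shows "edge_mixture (latent n d) (noisy_weight p d q) (vertex_pairs n)"
proof (rule edge_mixture.intro)
  show "prob_space (latent n d)" by (rule prob_space_PiM) (rule prob_space_std_normal_vec)
  show "(\<lambda>x. noisy_weight p d q x e) \<in> borel_measurable (latent n d)" if "e \<in> vertex_pairs n" for e
    using that by (intro borel_measurable_noisy_weight) (auto simp: vertex_pairs_def)
qed (use noisy_weight_bounds[OF assms] in \<open>auto simp: finite_vertex_pairs\<close>)

text \<open>The mixture is evaluated once: every event becomes a finite sum of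
  \<open>mix_mass\<close> over graphs, and all later arguments about \<open>noisy_rgg\<close> use
  these sums.\<close>

lemma
  assumes pq: "0 < p" "p < 1" "0 \<le> q" "q \<le> 1"
  shows sets_noisy_rgg: "sets (noisy_rgg n p d q) = UNIV"
    and measure_noisy_rgg: "measure (noisy_rgg n p d q) A
      = (\<Sum>\<omega>\<in>A \<inter> Pow (vertex_pairs n). mix_mass (latent n d) (noisy_weight p d q) (vertex_pairs n) \<omega>)"
proof -
  interpret edge_mixture "latent n d" "noisy_weight p d q" "vertex_pairs n" by (rule edge_mixture_noisy[OF pq])
  let ?K = "\<lambda>x. measure_pmf (indep_edges n (\<lambda>i j. connection_prob p d q (inner_vec d (x i) (x j))))"
  have b: "0 \<le> connection_prob p d q (inner_vec d (x i) (x j)) \<and> connection_prob p d q (inner_vec d (x i) (x j)) \<le> 1"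
    for x :: "nat \<Rightarrow> nat \<Rightarrow> real" and i j
    using noisy_weight_bounds[OF pq, of d x "(i, j)"] unfolding noisy_weight_connection_prob by simp
  have Kmass: "measure (?K x) B = (\<Sum>\<omega>\<in>B \<inter> Pow (vertex_pairs n). bern_mass (vertex_pairs n) (noisy_weight p d q x) \<omega>)" for x B
  proof -
    have "(\<lambda>(i, j). connection_prob p d q (inner_vec d (x i) (x j))) = noisy_weight p d q x"
      using noisy_weight_connection_prob by (auto simp: fun_eq_iff)
    then show ?thesis using prob_indep_edges[where n = n and A = B, OF b[of x]] by simp
  qed
  have Kmeas: "(\<lambda>x. measure (?K x) B) \<in> borel_measurable (latent n d)" for B
    unfolding Kmass using bern_meas[OF subset_refl] by (intro borel_measurable_sum) auto
  have K: "?K \<in> latent n d \<rightarrow>\<^sub>M subprob_algebra (count_space UNIV)"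
  proof (rule measurable_subprob_algebra)
    show "subprob_space (?K x)" for x by (rule prob_space_imp_subprob_space) (rule prob_space_measure_pmf)
    show "(\<lambda>x. emeasure (?K x) B) \<in> borel_measurable (latent n d)" for B
      unfolding measure_pmf.emeasure_eq_measure using Kmeas by measurable
  qed simp
  show "sets (noisy_rgg n p d q) = UNIV"
    unfolding noisy_rgg_def using sets_bind[of "latent n d" ?K "count_space UNIV"] not_empty by simp
  have "emeasure (noisy_rgg n p d q) A = (\<integral>\<^sup>+x. emeasure (?K x) A \<partial>latent n d)"
    unfolding noisy_rgg_def by (rule emeasure_bind[OF not_empty K]) simp
  also have "\<dots> = (\<integral>\<^sup>+x. ennreal (measure (?K x) A) \<partial>latent n d)"
    by (simp add: measure_pmf.emeasure_eq_measure)
  also have "\<dots> = ennreal (\<integral>x. measure (?K x) A \<partial>latent n d)"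
  proof (rule nn_integral_eq_integral)
    show "integrable (latent n d) (\<lambda>x. measure (?K x) A)"
      by (rule integrable_bounded_prob[OF prob_M Kmeas, where C = 1]) (simp add: measure_pmf.prob_le_1)
  qed simp
  also have "(\<integral>x. measure (?K x) A \<partial>latent n d)
    = (\<Sum>\<omega>\<in>A \<inter> Pow (vertex_pairs n). mix_mass (latent n d) (noisy_weight p d q) (vertex_pairs n) \<omega>)"
    unfolding Kmass using sum_integral_bern[OF subset_refl, of "\<lambda>_. 1"] by simp
  finally show "measure (noisy_rgg n p d q) A
      = (\<Sum>\<omega>\<in>A \<inter> Pow (vertex_pairs n). mix_mass (latent n d) (noisy_weight p d q) (vertex_pairs n) \<omega>)"
    using mix_nonneg[OF subset_refl] by (intro measure_eq_emeasure_eq_ennreal) (auto intro!: sum_nonneg)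
qed

lemma measure_erdos_renyi:
  assumes "0 < p" "p < 1"
  shows "measure (erdos_renyi n p) A = (\<Sum>\<omega>\<in>A \<inter> Pow (vertex_pairs n). bern_mass (vertex_pairs n) (\<lambda>_. p) \<omega>)"
proof -
  have "(\<lambda>(i, j). p) = (\<lambda>_ :: nat \<times> nat. p)" by auto
  then show ?thesis unfolding erdos_renyi_def using prob_indep_edges[of "\<lambda>i j. p" n A] assms by simp
qed

lemma total_variation_le:
  assumes "0 < p" "p < 1" and "\<And>A. \<bar>measure (erdos_renyi n p) A - measure Q A\<bar> \<le> B"
  shows "total_variation (erdos_renyi n p) Q \<le> B" "0 \<le> total_variation (erdos_renyi n p) Q"
    "\<And>A. \<bar>measure (erdos_renyi n p) A - measure Q A\<bar> \<le> total_variation (erdos_renyi n p) Q"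
proof -
  have s: "sets (erdos_renyi n p) = UNIV" by (simp add: erdos_renyi_def)
  show "total_variation (erdos_renyi n p) Q \<le> B"
    unfolding total_variation_def s by (rule cSUP_least) (use assms in auto)
  show le: "\<bar>measure (erdos_renyi n p) A - measure Q A\<bar> \<le> total_variation (erdos_renyi n p) Q" for A
    unfolding total_variation_def s by (rule cSUP_upper) (use assms in \<open>auto intro!: bdd_aboveI\<close>)
  then show "0 \<le> total_variation (erdos_renyi n p) Q" using order_trans[OF abs_ge_zero] by blast
qed

lemma total_variation_bounds:
  assumes p: "0 < p" "p < 1" and q: "0 \<le> q" "q \<le> 1"
  shows "0 \<le> total_variation (erdos_renyi n p) (noisy_rgg n p d q)"
    "total_variation (erdos_renyi n p) (noisy_rgg n p d q) \<le> 1"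
    "\<bar>measure (erdos_renyi n p) A - measure (noisy_rgg n p d q) A\<bar> \<le> total_variation (erdos_renyi n p) (noisy_rgg n p d q)"
    "measure (noisy_rgg n p d q) (- A) = 1 - measure (noisy_rgg n p d q) A"
proof -
  interpret edge_mixture "latent n d" "noisy_weight p d q" "vertex_pairs n" by (rule edge_mixture_noisy[OF p q])
  have split: "measure (noisy_rgg n p d q) A + measure (noisy_rgg n p d q) (- A) = 1" for A
  proof -
    have "measure (noisy_rgg n p d q) A + measure (noisy_rgg n p d q) (- A)
      = (\<Sum>\<omega>\<in>Pow (vertex_pairs n). mix_mass (latent n d) (noisy_weight p d q) (vertex_pairs n) \<omega>)"
      unfolding measure_noisy_rgg[OF p q]
      by (subst sum.union_disjoint[symmetric]) (auto simp: finite_vertex_pairs intro!: sum.cong)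
    then show ?thesis using sum_mix[OF subset_refl] by simp
  qed
  then show "measure (noisy_rgg n p d q) (- A) = 1 - measure (noisy_rgg n p d q) A" using split[of A] by linarith
  have le1: "measure (noisy_rgg n p d q) A \<le> 1" for A
    using split[of A] measure_nonneg[of "noisy_rgg n p d q" "- A"] by linarith
  have er1: "measure (erdos_renyi n p) A \<le> 1" for A unfolding erdos_renyi_def by (rule measure_pmf.prob_le_1)
  have b: "\<bar>measure (erdos_renyi n p) A - measure (noisy_rgg n p d q) A\<bar> \<le> 1" for A
    using le1[of A] er1[of A] measure_nonneg[of "noisy_rgg n p d q" A] measure_nonneg[of "erdos_renyi n p" A] by linarith
  note tv = total_variation_le[OF p, of n "noisy_rgg n p d q" 1, OF b]
  show "0 \<le> total_variation (erdos_renyi n p) (noisy_rgg n p d q)"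
    "total_variation (erdos_renyi n p) (noisy_rgg n p d q) \<le> 1"
    "\<bar>measure (erdos_renyi n p) A - measure (noisy_rgg n p d q) A\<bar> \<le> total_variation (erdos_renyi n p) (noisy_rgg n p d q)"
    using tv by auto
qed

lemma total_variation_noisy_le:
  assumes pq: "0 < p" "p < 1" "0 \<le> q" "q \<le> 1"
  shows "total_variation (erdos_renyi n p) (noisy_rgg n p d q)
    \<le> 2 * sqrt (mix_KL (latent n d) (noisy_weight p d q) p (vertex_pairs n))"
proof (rule total_variation_le(1)[OF pq(1,2)])
  interpret edge_mixture "latent n d" "noisy_weight p d q" "vertex_pairs n" by (rule edge_mixture_noisy[OF pq])
  fix A
  let ?P = "bern_mass (vertex_pairs n) (\<lambda>_. p)" and ?Q = "mix_mass (latent n d) (noisy_weight p d q) (vertex_pairs n)"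
  have "\<bar>measure (erdos_renyi n p) A - measure (noisy_rgg n p d q) A\<bar> = \<bar>\<Sum>\<omega>\<in>A \<inter> Pow (vertex_pairs n). ?P \<omega> - ?Q \<omega>\<bar>"
    by (simp add: measure_erdos_renyi[OF pq(1,2)] measure_noisy_rgg[OF pq] sum_subtractf)
  also have "\<dots> \<le> (\<Sum>\<omega>\<in>A \<inter> Pow (vertex_pairs n). \<bar>?P \<omega> - ?Q \<omega>\<bar>)" by (rule sum_abs)
  also have "\<dots> \<le> (\<Sum>\<omega>\<in>Pow (vertex_pairs n). \<bar>?P \<omega> - ?Q \<omega>\<bar>)"
    by (rule sum_mono2) (auto simp: finite_vertex_pairs)
  also have "\<dots> \<le> 2 * sqrt (mix_KL (latent n d) (noisy_weight p d q) p (vertex_pairs n))"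
    by (rule total_variation_le_KL[OF subset_refl pq(1,2)])
  finally show "\<bar>measure (erdos_renyi n p) A - measure (noisy_rgg n p d q) A\<bar>
    \<le> 2 * sqrt (mix_KL (latent n d) (noisy_weight p d q) p (vertex_pairs n))" .
qed

section \<open>Entropy bound for the noisy geometric graph\<close>

lemma measurable_update2:
  assumes "x \<in> space (PiM I (\<lambda>_. N))" "i \<in> I" "j \<in> I"
  shows "(\<lambda>(b, g). x(i := b, j := g)) \<in> N \<Otimes>\<^sub>M N \<rightarrow>\<^sub>M PiM I (\<lambda>_. N)"
proof (rule measurable_PiM_single')
  show "(\<lambda>z. (case z of (b, g) \<Rightarrow> x(i := b, j := g)) k) \<in> N \<Otimes>\<^sub>M N \<rightarrow>\<^sub>M N" if "k \<in> I" for k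
    using that assms by (cases "k = j"; cases "k = i") (auto simp: case_prod_beta space_PiM PiE_iff)
qed (use assms in \<open>auto simp: space_PiM PiE_iff extensional_def space_pair_measure fun_upd_def split: if_splits\<close>)

lemma integral_PiM_update2:
  fixes H :: "('i \<Rightarrow> 'a) \<Rightarrow> real"
  assumes I: "finite I" "i \<in> I" "j \<in> I" and N: "prob_space N" and H: "H \<in> borel_measurable (PiM I (\<lambda>_. N))"
    and C: "\<And>x. \<bar>H x\<bar> \<le> C"
  shows "integral\<^sup>L (PiM I (\<lambda>_. N)) H = (\<integral>x. \<integral>b. \<integral>g. H (x(i := b, j := g)) \<partial>N \<partial>N \<partial>PiM I (\<lambda>_. N))"
    and "(\<lambda>x. \<integral>g. H (x(j := g)) \<partial>N) \<in> borel_measurable (PiM I (\<lambda>_. N))"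
proof -
  interpret N: prob_space N by fact
  show m: "(\<lambda>x. \<integral>g. H (x(j := g)) \<partial>N) \<in> borel_measurable (PiM I (\<lambda>_. N))"
    using measurable_compose[OF measurable_PiM_update[OF I(3), of "\<lambda>_. N"] H]
    by (intro N.borel_measurable_lebesgue_integral) (simp add: case_prod_beta)
  have "integral\<^sup>L (PiM I (\<lambda>_. N)) H = (\<integral>x. \<integral>g. H (x(j := g)) \<partial>N \<partial>PiM I (\<lambda>_. N))"
    by (rule integral_PiM_update[OF I(1,3) N H C])
  also have "\<dots> = (\<integral>x. \<integral>b. \<integral>g. H (x(i := b, j := g)) \<partial>N \<partial>N \<partial>PiM I (\<lambda>_. N))"
    by (rule integral_PiM_update[OF I(1,2) N m, where C = C]) (intro abs_integral_le_bound N C)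
  finally show "integral\<^sup>L (PiM I (\<lambda>_. N)) H = (\<integral>x. \<integral>b. \<integral>g. H (x(i := b, j := g)) \<partial>N \<partial>N \<partial>PiM I (\<lambda>_. N))" .
qed

text \<open>In the correlation of the edge \<open>(i, t)\<close> with a function of the edges preceding it in the
  lexicographic order by larger endpoint, the vector \<open>x t\<close> enters the function only through its
  inner products with the vectors \<open>x 1, \<dots>, x (i - 1)\<close>.\<close>

lemma noisy_edge_correlation:
  fixes F :: "(nat \<times> nat) set \<Rightarrow> real"
  assumes pq: "0 < p" "p < 1" "0 \<le> q" "q \<le> 1" and d: "1 \<le> d" and c: "0 < c"
    and it: "1 \<le> i" "i < t" "t \<le> n"
    and S: "S \<subseteq> {(a, b). 1 \<le> a \<and> a < b \<and> (b < t \<or> b = t \<and> a < i)}"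
  defines "Fb \<equiv> \<lambda>x. \<Sum>\<omega>\<in>Pow S. F \<omega> * bern_mass S (noisy_weight p d q x) \<omega>"
  shows "\<bar>\<integral>x. (noisy_weight p d q x (i, t) - p) * Fb x \<partial>latent n d\<bar>
    \<le> q * (c * edge_rate p d n + (\<integral>x. (Fb x)\<^sup>2 \<partial>latent n d) / c) / 2"
proof -
  let ?L = "latent n d" and ?N = "std_normal_vec d"
  interpret edge_mixture ?L "noisy_weight p d q" "vertex_pairs n" by (rule edge_mixture_noisy[OF pq])
  interpret N: prob_space ?N by (rule prob_space_std_normal_vec)
  note NP = N.prob_space_axioms
  have SE: "S \<subseteq> vertex_pairs n" using S it by (auto simp: vertex_pairs_def)
  have I: "finite {1..n}" "i \<in> {1..n}" "t \<in> {1..n}" using it by auto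
  have Fm: "Fb \<in> borel_measurable ?L"
    unfolding Fb_def using bern_meas[OF SE] by (intro borel_measurable_sum borel_measurable_times) auto
  define C where "C = (\<Sum>\<omega>\<in>Pow S. \<bar>F \<omega>\<bar>)"
  have FC: "\<bar>Fb x\<bar> \<le> C" for x
  proof -
    have "\<bar>Fb x\<bar> \<le> (\<Sum>\<omega>\<in>Pow S. \<bar>F \<omega> * bern_mass S (noisy_weight p d q x) \<omega>\<bar>)" unfolding Fb_def by (rule sum_abs)
    also have "\<dots> \<le> C" unfolding C_def
    proof (rule sum_mono)
      show "\<bar>F \<omega> * bern_mass S (noisy_weight p d q x) \<omega>\<bar> \<le> \<bar>F \<omega>\<bar>" for \<omega>
        using mult_left_mono[of "\<bar>bern_mass S (noisy_weight p d q x) \<omega>\<bar>" 1 "\<bar>F \<omega>\<bar>"] bern_bounds[OF SE, of x \<omega>] by (simp add: abs_mult)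
    qed
    finally show ?thesis .
  qed
  have C0: "0 \<le> C" unfolding C_def by (intro sum_nonneg) auto
  define H where "H x = signed_edge p d (x i) (x t) * Fb x" for x
  have Hm: "H \<in> borel_measurable ?L" unfolding H_def using borel_measurable_signed_edge_latent[of i n t p d] Fm it by simp
  have HC: "\<bar>H x\<bar> \<le> C" for x
    unfolding H_def using mult_mono[OF abs_signed_edge_le[OF pq(1,2)] FC] by (simp add: abs_mult)
  let ?F = "\<lambda>x b g. Fb (x(i := b, t := g))"
  let ?J = "\<lambda>x. \<integral>b. \<bar>\<integral>g. signed_edge p d b g * ?F x b g \<partial>?N\<bar> \<partial>?N"
  have pt: "?J x \<le> (c * edge_rate p d n + (\<integral>b. \<integral>g. (?F x b g)\<^sup>2 \<partial>?N \<partial>?N) / c) / 2" if x: "x \<in> space ?L" for x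
  proof -
    have "?J x \<le> (c * edge_rate p d (i - 1) + (\<integral>b. \<integral>g. (?F x b g)\<^sup>2 \<partial>?N \<partial>?N) / c) / 2"
    \<comment> \<open>The vectors \<open>x 1, ..., x (i - 1)\<close> are passed as a family indexed
      from 0, hence \<open>Suc j\<close> and \<open>k = i - 1\<close>.\<close>
    proof (rule signed_edge_correlation[OF d pq(1,2) c _ FC, of _ _ "\<lambda>j. x (Suc j)"])
      show "(\<lambda>(b, g). ?F x b g) \<in> borel_measurable (?N \<Otimes>\<^sub>M ?N)"
        using measurable_compose[OF measurable_update2[OF x I(2,3)] Fm] by (simp add: case_prod_beta)
    next
      fix b g g' assume eq: "\<And>j. j < i - 1 \<Longrightarrow> inner_vec d (x (Suc j)) g = inner_vec d (x (Suc j)) g'"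
      \<comment> \<open>An edge of \<open>S\<close> that avoids \<open>t\<close> is not affected by
        \<open>g\<close>. One that ends in \<open>t\<close> comes from some \<open>a < i\<close>, so
        \<open>x a\<close> has not been replaced by \<open>b\<close>, and the assumption on inner
        products applies at \<open>j = a - 1\<close>.\<close>
      have "noisy_weight p d q (x(i := b, t := g)) e = noisy_weight p d q (x(i := b, t := g')) e" if "e \<in> S" for e
      proof -
        obtain a b' where e: "e = (a, b')" by force
        with that S have "1 \<le> a" "a < b'" "b' < t \<or> b' = t \<and> a < i" by auto
        then show ?thesis
          using eq[of "a - 1"] it by (auto simp: e noisy_weight_def signed_edge_def)
      qed
      then show "?F x b g = ?F x b g'" unfolding Fb_def bern_mass_def by (simp cong: if_cong)
    qed
    also have "\<dots> \<le> (c * edge_rate p d n + (\<integral>b. \<integral>g. (?F x b g)\<^sup>2 \<partial>?N \<partial>?N) / c) / 2"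
    proof -
      have "edge_const p * (real (i - 1) + 1) / real d \<le> edge_const p * (real n + 1) / real d"
        using edge_const_ge[OF pq(1,2)] it by (intro divide_right_mono mult_left_mono) auto
      then have "edge_rate p d (i - 1) \<le> edge_rate p d n" by (simp add: edge_rate_def)
      then show ?thesis using c by (simp add: mult_left_mono)
    qed
    finally show ?thesis .
  qed
  have F2m: "(\<lambda>x. (Fb x)\<^sup>2) \<in> borel_measurable ?L" using Fm by measurable
  have F2C: "\<bar>(Fb x)\<^sup>2\<bar> \<le> C\<^sup>2" for x using FC[of x] C0 by (simp add: abs_le_square_iff[symmetric])
  have inner_le: "\<bar>\<integral>b. \<integral>g. H (x(i := b, t := g)) \<partial>?N \<partial>?N\<bar> \<le> ?J x" for x
    using integral_abs_bound[of ?N "\<lambda>b. \<integral>g. H (x(i := b, t := g)) \<partial>?N"] it by (simp add: H_def)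
  note H2 = integral_PiM_update2[OF I NP Hm HC]
  note F22 = integral_PiM_update2[OF I NP F2m F2C]
  have m2: "(\<lambda>x. \<integral>b. \<integral>g. h (x(i := b, t := g)) \<partial>?N \<partial>?N) \<in> borel_measurable ?L"
    if "(\<lambda>x. \<integral>g. h (x(t := g)) \<partial>?N) \<in> borel_measurable ?L" for h :: "_ \<Rightarrow> real"
    using measurable_compose[OF measurable_PiM_update[OF I(2), of "\<lambda>_. ?N"] that]
    by (intro N.borel_measurable_lebesgue_integral) (simp add: case_prod_beta)
  have "(\<integral>x. (noisy_weight p d q x (i, t) - p) * Fb x \<partial>?L) = q * integral\<^sup>L ?L H"
    by (simp add: noisy_weight_def H_def[abs_def] mult.assoc)
  then have "\<bar>\<integral>x. (noisy_weight p d q x (i, t) - p) * Fb x \<partial>?L\<bar> = q * \<bar>\<integral>x. \<integral>b. \<integral>g. H (x(i := b, t := g)) \<partial>?N \<partial>?N \<partial>?L\<bar>"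
    using pq H2(1) by (simp add: abs_mult)
  moreover have "\<bar>\<integral>x. \<integral>b. \<integral>g. H (x(i := b, t := g)) \<partial>?N \<partial>?N \<partial>?L\<bar> \<le> (c * edge_rate p d n + (\<integral>x. (Fb x)\<^sup>2 \<partial>?L) / c) / 2"
  proof -
    have "\<bar>\<integral>x. \<integral>b. \<integral>g. H (x(i := b, t := g)) \<partial>?N \<partial>?N \<partial>?L\<bar> \<le> (\<integral>x. \<bar>\<integral>b. \<integral>g. H (x(i := b, t := g)) \<partial>?N \<partial>?N\<bar> \<partial>?L)"
      by (rule integral_abs_bound)
    also have "\<dots> \<le> (\<integral>x. (c * edge_rate p d n + (\<integral>b. \<integral>g. (?F x b g)\<^sup>2 \<partial>?N \<partial>?N) / c) / 2 \<partial>?L)"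
    proof (rule integral_mono)
      show "integrable ?L (\<lambda>x. \<bar>\<integral>b. \<integral>g. H (x(i := b, t := g)) \<partial>?N \<partial>?N\<bar>)"
        by (intro integrable_abs integrable_bounded_prob[OF prob_M m2[OF H2(2)], where C = C] abs_integral_le_bound NP HC)
      have "integrable ?L (\<lambda>x. \<integral>b. \<integral>g. (?F x b g)\<^sup>2 \<partial>?N \<partial>?N)"
        by (intro integrable_bounded_prob[OF prob_M m2[OF F22(2)], where C = "C\<^sup>2"] abs_integral_le_bound NP F2C)
      then show "integrable ?L (\<lambda>x. (c * edge_rate p d n + (\<integral>b. \<integral>g. (?F x b g)\<^sup>2 \<partial>?N \<partial>?N) / c) / 2)"
        by (auto simp del: One_nat_def)
      show "\<bar>\<integral>b. \<integral>g. H (x(i := b, t := g)) \<partial>?N \<partial>?N\<bar> \<le> (c * edge_rate p d n + (\<integral>b. \<integral>g. (?F x b g)\<^sup>2 \<partial>?N \<partial>?N) / c) / 2"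
        if "x \<in> space ?L" for x
        using order_trans[OF inner_le pt[OF that]] .
    qed
    also have "\<dots> = (c * edge_rate p d n + (\<integral>x. (Fb x)\<^sup>2 \<partial>?L) / c) / 2"
    proof -
      have "integrable ?L (\<lambda>x. \<integral>b. \<integral>g. (?F x b g)\<^sup>2 \<partial>?N \<partial>?N)"
        by (intro integrable_bounded_prob[OF prob_M m2[OF F22(2)], where C = "C\<^sup>2"] abs_integral_le_bound NP F2C)
      then show ?thesis using F22(1) prob_space by (simp del: One_nat_def)
    qed
    finally show ?thesis .
  qed
  then have "q * \<bar>\<integral>x. \<integral>b. \<integral>g. H (x(i := b, t := g)) \<partial>?N \<partial>?N \<partial>?L\<bar> \<le> q * ((c * edge_rate p d n + (\<integral>x. (Fb x)\<^sup>2 \<partial>?L) / c) / 2)"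
    by (rule mult_left_mono[OF _ pq(3)])
  ultimately show ?thesis by (simp only: times_divide_eq_right)
qed

text \<open>One application of \<open>mix_KL_insert\<close> per edge, in the order of revelation;
  there are at most \<open>n\<^sup>2\<close> edges and each is charged the same amount.\<close>

lemma mix_KL_noisy_le:
  assumes pq: "0 < p" "p < 1" "0 \<le> q" "q \<le> 1" and d: "1 \<le> d"
  shows "mix_KL (latent n d) (noisy_weight p d q) p (vertex_pairs n)
    \<le> (real n)\<^sup>2 * (q\<^sup>2 * edge_rate p d n / (p * (1 - p)))"
proof -
  interpret edge_mixture "latent n d" "noisy_weight p d q" "vertex_pairs n" by (rule edge_mixture_noisy[OF pq])
  define \<delta> where "\<delta> = q\<^sup>2 * edge_rate p d n / (p * (1 - p))"
  have \<delta>: "0 \<le> \<delta>" using pq edge_rate_bounds(3)[of p d n] by (simp add: \<delta>_def)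
  \<comment> \<open>\<open>T t i\<close> is the set of pairs that precede \<open>(i, t)\<close>. A
    row is finished at \<open>i = t\<close>, hence \<open>T (Suc t) 1 = T t t\<close>, and
    \<open>T (Suc n) 1\<close> consists of all pairs.\<close>
  define T where "T t i = {(a, b). 1 \<le> a \<and> a < b \<and> (b < t \<or> b = t \<and> a < i)}" for t i :: nat
  let ?KL = "mix_KL (latent n d) (noisy_weight p d q) p"
  have TE: "T t i \<subseteq> vertex_pairs n" if "t \<le> n" for t i using that by (auto simp: T_def vertex_pairs_def)
  have row: "?KL (T t i) \<le> ?KL (T t 1) + real (i - 1) * \<delta>" if "1 \<le> i" "i \<le> t" "t \<le> n" for t i
    using that
  proof (induction i rule: dec_induct)
    case (step i)
    have "T t (Suc i) = insert (i, t) (T t i)" using step by (auto simp: T_def)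
    moreover have "?KL (insert (i, t) (T t i)) \<le> ?KL (T t i) + q\<^sup>2 * edge_rate p d n / (p * (1 - p))"
    proof (rule mix_KL_insert[OF TE _ _ pq(1,2,3)])
      show "(i, t) \<in> vertex_pairs n" using step by (auto simp: vertex_pairs_def)
      show "(i, t) \<notin> T t i" by (simp add: T_def)
      fix F :: "(nat \<times> nat) set \<Rightarrow> real" and c :: real assume "0 < c"
      then show "\<bar>\<integral>x. (noisy_weight p d q x (i, t) - p) * (\<Sum>\<omega>\<in>Pow (T t i). F \<omega> * bern_mass (T t i) (noisy_weight p d q x) \<omega>) \<partial>latent n d\<bar>
        \<le> q * (c * edge_rate p d n + (\<integral>x. (\<Sum>\<omega>\<in>Pow (T t i). F \<omega> * bern_mass (T t i) (noisy_weight p d q x) \<omega>)\<^sup>2 \<partial>latent n d) / c) / 2"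
        using step by (intro noisy_edge_correlation[OF pq d]) (auto simp: T_def)
    qed (use step in simp)
    ultimately have "?KL (T t (Suc i)) \<le> ?KL (T t i) + \<delta>" by (simp add: \<delta>_def)
    also have "\<dots> \<le> ?KL (T t 1) + real (i - 1) * \<delta> + \<delta>" using step by simp
    also have "\<dots> = ?KL (T t 1) + real (Suc i - 1) * \<delta>" using step by (simp add: algebra_simps of_nat_diff)
    finally show ?case .
  qed simp
  have all: "?KL (T t 1) \<le> real (t - 1) * (real n * \<delta>)" if "1 \<le> t" "t \<le> Suc n" for t
    using that
  proof (induction t rule: dec_induct)
    case base
    have "T 1 1 = {}" by (auto simp: T_def)
    then show ?case using \<delta> prob_space by (simp add: mix_KL_def mix_mass_def bern_mass_def)
  next
    case (step t)
    have "T (Suc t) 1 = T t t" by (auto simp: T_def)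
    then have "?KL (T (Suc t) 1) \<le> ?KL (T t 1) + real (t - 1) * \<delta>" using row[of t t] step by simp
    also have "\<dots> \<le> real (t - 1) * (real n * \<delta>) + real n * \<delta>"
      using step \<delta> by (intro add_mono mult_right_mono) auto
    finally show ?case using step by (simp add: algebra_simps of_nat_diff)
  qed
  have "vertex_pairs n = T (Suc n) 1" by (auto simp: T_def vertex_pairs_def)
  then have "?KL (vertex_pairs n) \<le> (real n)\<^sup>2 * \<delta>" using all[of "Suc n"] by (simp add: power2_eq_square)
  then show ?thesis by (simp add: \<delta>_def)
qed

text \<open>Both alternatives start from the bound by \<open>(n * q)\<^sup>2\<close> times the rate:
  the first takes the rate to be at most 1, the second at most a constant times
  \<open>n / d\<close>.\<close>

lemma total_variation_tendsto_0:
  fixes d :: "nat \<Rightarrow> nat" and q :: "nat \<Rightarrow> real"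
  assumes p: "0 < p" "p < 1" and d: "\<And>n. d n \<ge> 1" and q: "\<And>n. 0 \<le> q n \<and> q n \<le> 1"
    and lim: "(\<lambda>n. real n * q n) \<longlonglongrightarrow> 0 \<or> (\<lambda>n. real n ^ 3 * q n ^ 2 / real (d n)) \<longlonglongrightarrow> 0"
  shows "(\<lambda>n. total_variation (erdos_renyi n p) (noisy_rgg n p (d n) (q n))) \<longlonglongrightarrow> 0"
proof -
  define TV where "TV n = total_variation (erdos_renyi n p) (noisy_rgg n p (d n) (q n))" for n
  define c where "c = 1 / (p * (1 - p))"
  have c: "0 < c" using p by (simp add: c_def)
  have up: "TV n \<le> 2 * sqrt (c * ((real n * q n)\<^sup>2 * edge_rate p (d n) n))" for n
  proof -
    have "TV n \<le> 2 * sqrt (mix_KL (latent n (d n)) (noisy_weight p (d n) (q n)) p (vertex_pairs n))"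
      unfolding TV_def using total_variation_noisy_le[OF p] q by simp
    also have "\<dots> \<le> 2 * sqrt ((real n)\<^sup>2 * ((q n)\<^sup>2 * edge_rate p (d n) n / (p * (1 - p))))"
      using mix_KL_noisy_le[OF p] q d by (intro mult_left_mono real_sqrt_le_mono) auto
    finally show ?thesis by (simp add: c_def power_mult_distrib mult_ac)
  qed
  have TV0: "0 \<le> TV n" for n
    unfolding TV_def using total_variation_bounds(1)[OF p] q by simp
  have main: "TV \<longlonglongrightarrow> 0" if X: "X \<longlonglongrightarrow> 0" and le: "\<And>n. TV n \<le> 2 * sqrt (X n)" for X
  proof (rule tendsto_sandwich[of "\<lambda>_. 0" _ _ "\<lambda>n. 2 * sqrt (X n)"])
    show "(\<lambda>n. 2 * sqrt (X n)) \<longlonglongrightarrow> 0" using tendsto_mult_right_zero[OF tendsto_real_sqrt[OF X, simplified]] by simp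
  qed (use TV0 le in auto)
  from lim show ?thesis
  proof
    assume "(\<lambda>n. real n * q n) \<longlonglongrightarrow> 0"
    then have "(\<lambda>n. c * (real n * q n)\<^sup>2) \<longlonglongrightarrow> c * 0\<^sup>2" by (intro tendsto_intros)
    then have "TV \<longlonglongrightarrow> 0"
    proof (intro main[where X = "\<lambda>n. c * (real n * q n)\<^sup>2"])
      fix n
      have "c * ((real n * q n)\<^sup>2 * edge_rate p (d n) n) \<le> c * ((real n * q n)\<^sup>2 * 1)"
        using c edge_rate_bounds(1) by (intro mult_left_mono) auto
      then show "TV n \<le> 2 * sqrt (c * (real n * q n)\<^sup>2)"
        using order_trans[OF up[of n]] by simp
    qed simp
    then show ?thesis unfolding TV_def .
  next
    assume *: "(\<lambda>n. real n ^ 3 * q n ^ 2 / real (d n)) \<longlonglongrightarrow> 0"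
    define c' where "c' = c * (2 * edge_const p)"
    have "(\<lambda>n. c' * (real n ^ 3 * q n ^ 2 / real (d n))) \<longlonglongrightarrow> c' * 0" by (intro tendsto_intros *)
    then have "TV \<longlonglongrightarrow> 0"
    proof (intro main[where X = "\<lambda>n. c' * (real n ^ 3 * q n ^ 2 / real (d n))"])
      fix n
      have "c * ((real n * q n)\<^sup>2 * edge_rate p (d n) n) \<le> c' * (real n ^ 3 * q n ^ 2 / real (d n))"
      proof (cases "n = 0")
        case False
        have "edge_rate p (d n) n \<le> edge_const p * (real n + 1) / real (d n)" by (rule edge_rate_bounds(2))
        also have "\<dots> \<le> edge_const p * (2 * real n) / real (d n)"
          using False edge_const_ge[OF p] by (intro divide_right_mono mult_left_mono) auto
        finally have "c * ((real n * q n)\<^sup>2 * edge_rate p (d n) n) \<le> c * ((real n * q n)\<^sup>2 * (edge_const p * (2 * real n) / real (d n)))"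
          using c by (intro mult_left_mono) auto
        also have "\<dots> = c' * (real n ^ 3 * q n ^ 2 / real (d n))"
          by (simp add: c'_def power_mult_distrib power3_eq_cube power2_eq_square mult_ac)
        finally show ?thesis .
      qed simp
      then show "TV n \<le> 2 * sqrt (c' * (real n ^ 3 * q n ^ 2 / real (d n)))"
        using order_trans[OF up[of n]] by simp
    qed simp
    then show ?thesis unfolding TV_def .
  qed
qed

section \<open>Strict positivity of the mean signed four-cycle\<close>

lemma integral_swap_bounded:
  fixes f :: "'a \<Rightarrow> 'b \<Rightarrow> real"
  assumes "prob_space A" "prob_space B" "(\<lambda>(x, y). f x y) \<in> borel_measurable (A \<Otimes>\<^sub>M B)" "\<And>x y. \<bar>f x y\<bar> \<le> C"
  shows "(\<integral>x. \<integral>y. f x y \<partial>B \<partial>A) = (\<integral>y. \<integral>x. f x y \<partial>A \<partial>B)"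
proof -
  interpret A: prob_space A by fact
  interpret B: prob_space B by fact
  interpret AB: pair_prob_space A B ..
  show ?thesis
    by (rule AB.Fubini_integral[symmetric])
       (rule integrable_bounded_prob[OF AB.prob_space_axioms assms(3), where C = C], use assms(4) in auto)
qed

definition four_cycle_mean :: "real \<Rightarrow> nat \<Rightarrow> real" where
  "four_cycle_mean p d = (\<integral>x. \<integral>z. (signed_path p d x z)\<^sup>2 \<partial>std_normal_vec d \<partial>std_normal_vec d)"

text \<open>If the mean vanished, then the signed adjacency operator would be zero, so that being adjacent
  would be independent of every product event \<open>A \<times> B\<close>, hence of itself.\<close>

lemma four_cycle_mean_pos:
  assumes d: "1 \<le> d" and p: "0 < p" "p < 1"
  shows "0 < four_cycle_mean p d"
proof (rule ccontr)
  let ?N = "std_normal_vec d"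
  interpret N: prob_space ?N by (rule prob_space_std_normal_vec)
  note NP = N.prob_space_axioms
  interpret NN: pair_prob_space ?N ?N ..
  assume "\<not> 0 < four_cycle_mean p d"
  moreover have "0 \<le> four_cycle_mean p d" unfolding four_cycle_mean_def by (intro Bochner_Integration.integral_nonneg) auto
  ultimately have zero: "(\<integral>x. \<integral>z. (signed_path p d x z)\<^sup>2 \<partial>?N \<partial>?N) = 0" by (simp add: four_cycle_mean_def[symmetric])
  let ?\<sigma> = "signed_edge p d"
  note m = abs_signed_edge_le[OF p] abs_signed_path_le[OF p]
  have path0: "AE x in ?N. AE z in ?N. signed_path p d x z = 0"
  proof -
    have i: "integrable ?N (\<lambda>z. (signed_path p d x z)\<^sup>2)" if "x \<in> space ?N" for x
      by (rule integrable_bounded_prob[where C = 1, OF NP]) (use that m in \<open>auto simp: abs_square_le_1\<close>)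
    have "integrable ?N (\<lambda>x. \<integral>z. (signed_path p d x z)\<^sup>2 \<partial>?N)"
    proof (rule integrable_bounded_prob[where C = 1, OF NP])
      show "\<bar>\<integral>z. (signed_path p d x z)\<^sup>2 \<partial>?N\<bar> \<le> 1" for x
        by (rule abs_integral_le_bound[OF NP]) (use m in \<open>simp add: abs_square_le_1\<close>)
    qed measurable
    then have "AE x in ?N. (\<integral>z. (signed_path p d x z)\<^sup>2 \<partial>?N) = 0"
      using zero by (subst (asm) integral_nonneg_eq_0_iff_AE) auto
    then show ?thesis
      using AE_space
    proof eventually_elim
      case (elim x)
      then have "AE z in ?N. (signed_path p d x z)\<^sup>2 = 0"
        using integral_nonneg_eq_0_iff_AE[OF i[OF elim(2)]] by simp
      then show ?case by simp
    qed
  qed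
  \<comment> \<open>\<open>T\<close> is the signed adjacency operator applied to the indicator of
    \<open>A\<close>. Its squared norm is the pairing of that indicator with the squared operator
    applied to it, which vanishes by \<open>path0\<close>.\<close>
  have T0: "AE y in ?N. (\<integral>x. indicator A x * ?\<sigma> x y \<partial>?N) = 0" if A[measurable]: "A \<in> sets ?N" for A
  proof -
    define T where "T y = (\<integral>x. indicator A x * ?\<sigma> x y \<partial>?N)" for y
    have Tm[measurable]: "T \<in> borel_measurable ?N" unfolding T_def by measurable
    have b: "\<bar>indicator A x * ?\<sigma> x y\<bar> \<le> 1" for x y using m(1)[of d x y] by (auto simp: indicator_def)
    have T1: "\<bar>T y\<bar> \<le> 1" for y unfolding T_def by (rule abs_integral_le_bound[OF NP b])
    have bT: "\<bar>indicator A z * ?\<sigma> z y * T y\<bar> \<le> 1" for z y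
      using mult_mono[OF b[of z y] T1[of y]] by (simp add: abs_mult)
    have "(\<integral>y. (T y)\<^sup>2 \<partial>?N) = (\<integral>y. \<integral>z. indicator A z * ?\<sigma> z y * T y \<partial>?N \<partial>?N)"
      by (simp add: T_def power2_eq_square)
    also have "\<dots> = (\<integral>z. \<integral>y. indicator A z * ?\<sigma> z y * T y \<partial>?N \<partial>?N)"
      using bT by (intro integral_swap_bounded[OF NP NP, where C = 1]) (auto simp: case_prod_beta)
    also have "\<dots> = (\<integral>z. 0 \<partial>?N)"
    proof (rule integral_cong_AE)
      show "AE z in ?N. (\<integral>y. indicator A z * ?\<sigma> z y * T y \<partial>?N) = 0"
        using path0 AE_space
      proof eventually_elim
        case (elim z)
        note z = elim(2)
        have "(\<integral>y. ?\<sigma> z y * T y \<partial>?N) = (\<integral>y. \<integral>x. ?\<sigma> z y * (indicator A x * ?\<sigma> x y) \<partial>?N \<partial>?N)"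
          by (simp add: T_def)
        also have "\<dots> = (\<integral>x. \<integral>y. ?\<sigma> z y * (indicator A x * ?\<sigma> x y) \<partial>?N \<partial>?N)"
        proof (rule integral_swap_bounded[OF NP NP, where C = 1])
          show "(\<lambda>(y, x). ?\<sigma> z y * (indicator A x * ?\<sigma> x y)) \<in> borel_measurable (?N \<Otimes>\<^sub>M ?N)"
            unfolding case_prod_beta using z by measurable
          show "\<bar>?\<sigma> z y * (indicator A x * ?\<sigma> x y)\<bar> \<le> 1" for x y
            using mult_mono[OF m(1)[of d z y] b[of x y]] by (simp add: abs_mult)
        qed
        also have "\<dots> = (\<integral>x. indicator A x * signed_path p d z x \<partial>?N)"
          by (simp add: signed_path_def mult_ac)
        also have "\<dots> = (\<integral>x. 0 \<partial>?N)"
        proof (rule integral_cong_AE)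
          show "AE x in ?N. indicator A x * signed_path p d z x = 0" using elim(1) by eventually_elim simp
        qed (use z in measurable)
        finally show ?case by (simp add: mult.assoc)
      qed
    qed measurable
    finally have "(\<integral>y. (T y)\<^sup>2 \<partial>?N) = 0" by simp
    moreover have "integrable ?N (\<lambda>y. (T y)\<^sup>2)"
      by (rule integrable_bounded_prob[where C = 1, OF NP]) (use T1 in \<open>auto simp: abs_square_le_1\<close>)
    ultimately have "AE y in ?N. (T y)\<^sup>2 = 0" by (subst (asm) integral_nonneg_eq_0_iff_AE) auto
    then show ?thesis unfolding T_def by simp
  qed
  define E where "E = {z \<in> space (?N \<Otimes>\<^sub>M ?N). inner_vec d (fst z) (snd z) \<ge> threshold p d}"
  have E[measurable]: "E \<in> sets (?N \<Otimes>\<^sub>M ?N)" unfolding E_def by measurable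
  have PE: "measure (?N \<Otimes>\<^sub>M ?N) E = p"
    using prob_inner_vec_ge[OF d, of "threshold p d"] inner_tail_threshold[OF d p] by (simp add: E_def)
  have rect: "measure (?N \<Otimes>\<^sub>M ?N) (E \<inter> (A \<times> B)) = p * (measure ?N A * measure ?N B)"
    if A[measurable]: "A \<in> sets ?N" and B[measurable]: "B \<in> sets ?N" for A B
  proof -
    have "measure (?N \<Otimes>\<^sub>M ?N) (E \<inter> (A \<times> B)) = (\<integral>z. indicator (E \<inter> (A \<times> B)) z \<partial>(?N \<Otimes>\<^sub>M ?N))" by simp
    also have "\<dots> = (\<integral>z. indicator B (snd z) * (indicator A (fst z) * (?\<sigma> (fst z) (snd z) + p)) \<partial>(?N \<Otimes>\<^sub>M ?N))"
      by (intro Bochner_Integration.integral_cong refl) (auto simp: indicator_def E_def signed_edge_def)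
    also have "\<dots> = (\<integral>y. \<integral>x. indicator B y * (indicator A x * (?\<sigma> x y + p)) \<partial>?N \<partial>?N)"
    proof -
      have "integrable (?N \<Otimes>\<^sub>M ?N) (\<lambda>(x, y). indicator B y * (indicator A x * (?\<sigma> x y + p)))"
        by (rule integrable_bounded_prob[where C = 1, OF NN.prob_space_axioms])
           (use p in \<open>auto simp: indicator_def signed_edge_def case_prod_beta\<close>)
      from NN.integral_snd[OF this] show ?thesis by (simp add: case_prod_beta')
    qed
    also have "\<dots> = (\<integral>y. indicator B y * (p * measure ?N A) \<partial>?N)"
    proof (rule integral_cong_AE)
      show "AE y in ?N. (\<integral>x. indicator B y * (indicator A x * (?\<sigma> x y + p)) \<partial>?N) = indicator B y * (p * measure ?N A)"
        using T0[OF A] AE_space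
      proof eventually_elim
        case (elim y)
        have "integrable ?N (\<lambda>x. indicator A x * ?\<sigma> x y)"
          by (rule integrable_bounded_prob[where C = 1, OF NP]) (use elim m in \<open>auto simp: indicator_def\<close>)
        moreover have "integrable ?N (\<lambda>x. indicator A x * p)"
          by (rule integrable_bounded_prob[where C = p, OF NP]) (use p in \<open>auto simp: indicator_def\<close>)
        ultimately have "(\<integral>x. indicator A x * (?\<sigma> x y + p) \<partial>?N) = p * measure ?N A"
          using elim by (simp add: distrib_left)
        then show ?case by simp
      qed
    qed measurable
    also have "\<dots> = p * (measure ?N A * measure ?N B)" by simp
    finally show ?thesis .
  qed
  \<comment> \<open>The law of a pair conditioned on adjacency. It agrees with the product law on
    rectangles, hence everywhere, and evaluating both at the adjacency event \<open>E\<close> gives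
    \<open>p = 1\<close>.\<close>
  let ?D = "density (?N \<Otimes>\<^sub>M ?N) (\<lambda>z. ennreal (1 / p) * indicator E z)"
  have Demeas: "emeasure ?D X = ennreal (1 / p * measure (?N \<Otimes>\<^sub>M ?N) (E \<inter> X))" if X[measurable]: "X \<in> sets (?N \<Otimes>\<^sub>M ?N)" for X
  proof -
    have "emeasure ?D X = (\<integral>\<^sup>+z. ennreal (1 / p) * indicator (E \<inter> X) z \<partial>(?N \<Otimes>\<^sub>M ?N))"
      by (subst emeasure_density) (auto intro!: nn_integral_cong simp: indicator_def)
    also have "\<dots> = ennreal (1 / p) * emeasure (?N \<Otimes>\<^sub>M ?N) (E \<inter> X)"
      by (subst nn_integral_cmult_indicator) auto
    also have "\<dots> = ennreal (1 / p * measure (?N \<Otimes>\<^sub>M ?N) (E \<inter> X))"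
      using p by (simp add: NN.P.emeasure_eq_measure ennreal_mult[symmetric])
    finally show ?thesis .
  qed
  have "?N \<Otimes>\<^sub>M ?N = ?D"
  proof (rule pair_measure_eqI)
    fix A B assume AB: "A \<in> sets ?N" "B \<in> sets ?N"
    then show "emeasure ?N A * emeasure ?N B = emeasure ?D (A \<times> B)"
      using p rect[OF AB] by (subst Demeas) (auto simp: N.emeasure_eq_measure ennreal_mult[symmetric])
  qed (auto intro: N.sigma_finite_measure_axioms)
  then have "emeasure (?N \<Otimes>\<^sub>M ?N) E = emeasure ?D E" by simp
  then have "ennreal p = ennreal (1 / p * p)"
    using Demeas[OF E] PE by (simp add: NN.P.emeasure_eq_measure)
  then show False using p by simp
qed

subsection \<open>Signed triangles and four-cycles of latent vectors\<close>

text \<open>The value is \<open>std_normal_density t\<close>, the first Hermite coefficient of the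
  indicator of a half-line. Only a lower bound, uniform for bounded \<open>t\<close>, is
  used.\<close>

definition half_mean :: "real \<Rightarrow> real" where
  "half_mean t = (\<integral>v. indicator {t..} v * v \<partial>std_normal_distribution)"

lemma integrable_indicator_mult_std_normal:
  "A \<in> sets borel \<Longrightarrow> integrable std_normal_distribution (\<lambda>v. indicator A v * v)"
  using integrable_real_mult_indicator[of A std_normal_distribution "\<lambda>v. v"] std_normal_moments(1) by (simp add: mult.commute)

text \<open>For \<open>t \<ge> 0\<close> only the part with \<open>v \<ge> a\<close> is kept. For
  \<open>t < 0\<close> the mean 0 of \<open>v\<close> turns the integral into minus the one over
  \<open>v < t\<close>, where only \<open>v < - a\<close> is kept.\<close>

lemma half_mean_ge:
  assumes "\<bar>t\<bar> \<le> a" "0 < a"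
  shows "a * min (normal_tail a) (1 - normal_tail (- a)) \<le> half_mean t"
proof -
  interpret prob_space std_normal_distribution by (rule prob_space_std_normal_distribution)
  note i = integrable_indicator_mult_std_normal
  have const: "integrable std_normal_distribution (\<lambda>v. indicator A v * a)" if "A \<in> sets borel" for A
    by (rule integrable_bounded_prob[where C = a, OF prob_space_axioms]) (use that assms in \<open>auto simp: indicator_def\<close>)
  show ?thesis
  proof (cases "0 \<le> t")
    case True
    have "a * normal_tail a = (\<integral>v. indicator {a..} v * a \<partial>std_normal_distribution)"
      by (simp add: normal_tail_def)
    also have "\<dots> \<le> half_mean t"
      unfolding half_mean_def
      by (rule integral_mono[OF const i]) (use assms True in \<open>auto simp: indicator_def\<close>)
    finally show ?thesis using assms(2) by (smt (verit) min_le_iff_disj mult_left_mono)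
  next
    case False
    have "(\<integral>v. v \<partial>std_normal_distribution) = half_mean t + (\<integral>v. indicator {..<t} v * v \<partial>std_normal_distribution)"
    proof -
      have "(\<integral>v. v \<partial>std_normal_distribution) = (\<integral>v. indicator {t..} v * v + indicator {..<t} v * v \<partial>std_normal_distribution)"
        by (intro Bochner_Integration.integral_cong refl) (auto simp: indicator_def)
      then show ?thesis
        unfolding half_mean_def by (simp only: Bochner_Integration.integral_add[OF i[of "{t..}"] i[of "{..<t}"]] atLeast_borel lessThan_borel)
    qed
    then have "half_mean t = - (\<integral>v. indicator {..<t} v * v \<partial>std_normal_distribution)"
      using std_normal_moments(2) by simp
    also have "\<dots> = (\<integral>v. - (indicator {..<t} v * v) \<partial>std_normal_distribution)" by simp
    finally have eq: "half_mean t = (\<integral>v. - (indicator {..<t} v * v) \<partial>std_normal_distribution)" .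
    have "space std_normal_distribution - {- a..} = {..< - a}" by auto
    then have "1 - normal_tail (- a) = prob {..< - a}"
      unfolding normal_tail_def using prob_compl[of "{- a..}"] by simp
    then have "a * (1 - normal_tail (- a)) = (\<integral>v. indicator {..< - a} v * a \<partial>std_normal_distribution)"
      by simp
    also have "\<dots> \<le> half_mean t"
      unfolding eq
    proof (rule integral_mono[OF const])
      show "integrable std_normal_distribution (\<lambda>v. - (indicator {..<t} v * v))" using i[of "{..<t}"] by simp
    qed (use assms False in \<open>auto simp: indicator_def\<close>)
    finally show ?thesis using assms(2) by (smt (verit) min_le_iff_disj mult_left_mono)
  qed
qed

lemma half_mean_const_pos:
  "0 < a \<Longrightarrow> 0 < a * min (normal_tail a) (1 - normal_tail (- a))"
  using normal_tail_strict_antimono[of a "a + 1"] normal_tail_strict_antimono[of "- a - 1" "- a"]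
    normal_tail_bounds[of "a + 1"] normal_tail_bounds[of "- a - 1"] by simp

text \<open>A negative \<rho> turns the half-line around, which by the mean 0 of \<open>v\<close>
  only changes the sign of the integral; the square removes the sign. The endpoint is a null
  set.\<close>

lemma scaled_half_mean_square:
  assumes "\<rho> \<noteq> 0"
  shows "(\<integral>v. indicator {u..} (\<rho> * v) * v \<partial>std_normal_distribution)\<^sup>2 = (half_mean (u / \<rho>))\<^sup>2"
proof (cases "\<rho> > 0")
  case True
  then have "indicator {u..} (\<rho> * v) = (indicator {u / \<rho>..} v :: real)" for v
    by (auto simp: indicator_def field_simps)
  then show ?thesis by (simp add: half_mean_def)
next
  case False
  then have neg: "\<rho> < 0" using assms by simp
  note i = integrable_indicator_mult_std_normal
  have "AE v in lborel. v \<noteq> u / \<rho>" by (rule AE_lborel_singleton)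
  then have "AE v in lborel. 0 < ennreal (std_normal_density v) \<longrightarrow> v \<noteq> u / \<rho>" by eventually_elim simp
  then have ae: "AE v in std_normal_distribution. v \<noteq> u / \<rho>" by (subst AE_density) auto
  have "(\<integral>v. indicator {u..} (\<rho> * v) * v \<partial>std_normal_distribution) = (\<integral>v. v - indicator {u / \<rho>..} v * v \<partial>std_normal_distribution)"
  proof (rule integral_cong_AE)
    show "AE v in std_normal_distribution. indicator {u..} (\<rho> * v) * v = v - indicator {u / \<rho>..} v * v"
      using ae by eventually_elim (use neg in \<open>auto simp: indicator_def field_simps\<close>)
  qed auto
  also have "\<dots> = - half_mean (u / \<rho>)"
    unfolding half_mean_def using i[of "{u / \<rho>..}"] std_normal_moments(1,2) by simp
  finally show ?thesis by simp
qed

text \<open>A second-order expansion of the Gaussian tail; \<open>m\<close> and \<open>l\<close> are the first two Hermite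
  coefficients of the function \<open>f\<close>.\<close>

lemma integral_normal_tail_expansion:
  fixes f :: "real \<Rightarrow> real"
  assumes f[measurable]: "f \<in> borel_measurable borel" and f1: "\<And>v. \<bar>f v\<bar> \<le> 1" and s: "0 < s" and p: "0 < p" "p < 1"
  defines "m \<equiv> (\<integral>v. f v \<partial>std_normal_distribution)" and "l \<equiv> (\<integral>v. f v * v \<partial>std_normal_distribution)"
  shows "(\<integral>v. \<integral>w. f v * f w * (normal_tail ((u - v * w) / s) - p) \<partial>std_normal_distribution \<partial>std_normal_distribution)
    \<ge> l\<^sup>2 * (std_normal_density (u / s) / s) - m\<^sup>2 - 1 / s\<^sup>2"
proof -
  let ?\<gamma> = std_normal_distribution
  interpret prob_space ?\<gamma> by (rule prob_space_std_normal_distribution)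
  note NP = prob_space_axioms
  define c where "c = normal_tail (u / s) - p"
  define \<kappa> where "\<kappa> = std_normal_density (u / s) / s"
  have fm: "integrable ?\<gamma> f" by (rule integrable_bounded_prob[OF NP _ f1]) simp
  have fl: "integrable ?\<gamma> (\<lambda>v. f v * v)"
  proof (rule Bochner_Integration.integrable_bound)
    show "integrable ?\<gamma> (\<lambda>v. v)" by (rule std_normal_moments)
    show "AE v in ?\<gamma>. norm (f v * v) \<le> norm v" using f1 by (auto simp: abs_mult intro!: mult_left_le_one_le)
  qed simp
  \<comment> \<open>Taylor's formula with increment \<open>v * w / s\<close>: after integration the
    constant term gives \<open>m\<^sup>2 * c\<close> and the linear term
    \<open>l\<^sup>2 * \<kappa>\<close>; the remainder is at most
    \<open>v\<^sup>2 * w\<^sup>2 / s\<^sup>2\<close>, whose mean is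
    \<open>1 / s\<^sup>2\<close>.\<close>
  have pt: "f v * f w * c + (f v * v) * (f w * w) * \<kappa> - (v\<^sup>2 * w\<^sup>2) / s\<^sup>2 \<le> f v * f w * (normal_tail ((u - v * w) / s) - p)" for v w
  proof -
    define e where "e = v * w / s"
    define R where "R = normal_tail (u / s - e) - normal_tail (u / s) - std_normal_density (u / s) * e"
    have R: "\<bar>R\<bar> \<le> e\<^sup>2" unfolding R_def by (rule normal_tail_taylor)
    have "f v * f w * (normal_tail ((u - v * w) / s) - p) = f v * f w * (c + std_normal_density (u / s) * e + R)"
      by (simp add: c_def R_def e_def diff_divide_distrib)
    also have "\<dots> = f v * f w * c + (f v * v) * (f w * w) * \<kappa> + f v * f w * R"
      by (simp add: \<kappa>_def e_def algebra_simps)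
    finally have 1: "f v * f w * (normal_tail ((u - v * w) / s) - p) = f v * f w * c + (f v * v) * (f w * w) * \<kappa> + f v * f w * R" .
    have "\<bar>f v * f w\<bar> \<le> 1" using mult_mono[OF f1[of v] f1[of w]] by (simp add: abs_mult)
    then have "\<bar>f v * f w * R\<bar> \<le> e\<^sup>2" using R mult_mono[of "\<bar>f v * f w\<bar>" 1 "\<bar>R\<bar>" "e\<^sup>2"] by (simp add: abs_mult)
    moreover have "e\<^sup>2 = v\<^sup>2 * w\<^sup>2 / s\<^sup>2" by (simp add: e_def power_divide power_mult_distrib)
    ultimately show ?thesis using 1 by linarith
  qed
  have c1: "\<bar>c\<bar> \<le> 1" using normal_tail_bounds[of "u / s"] p by (simp add: c_def abs_le_iff)
  have b: "\<bar>f v * f w * (normal_tail ((u - v * w) / s) - p)\<bar> \<le> 1" for v w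
  proof -
    have "\<bar>normal_tail ((u - v * w) / s) - p\<bar> \<le> 1" using normal_tail_bounds[of "(u - v * w) / s"] p by (simp add: abs_le_iff)
    moreover have "\<bar>f v * f w\<bar> \<le> 1" using mult_mono[OF f1[of v] f1[of w]] by (simp add: abs_mult)
    ultimately show ?thesis using mult_mono[of "\<bar>f v * f w\<bar>" 1 "\<bar>normal_tail ((u - v * w) / s) - p\<bar>" 1] by (simp add: abs_mult)
  qed
  have inner: "f v * m * c + (f v * v) * l * \<kappa> - v\<^sup>2 / s\<^sup>2 \<le> (\<integral>w. f v * f w * (normal_tail ((u - v * w) / s) - p) \<partial>?\<gamma>)" for v
  proof -
    have i: "integrable ?\<gamma> (\<lambda>w. f v * f w * c + (f v * v) * (f w * w) * \<kappa> - (v\<^sup>2 * w\<^sup>2) / s\<^sup>2)"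
      using fm fl std_normal_moments(3) by auto
    have "f v * m * c + (f v * v) * l * \<kappa> - v\<^sup>2 / s\<^sup>2 = (\<integral>w. f v * f w * c + (f v * v) * (f w * w) * \<kappa> - (v\<^sup>2 * w\<^sup>2) / s\<^sup>2 \<partial>?\<gamma>)"
      using fm fl std_normal_moments(3,4) by (simp add: m_def l_def)
    also have "\<dots> \<le> (\<integral>w. f v * f w * (normal_tail ((u - v * w) / s) - p) \<partial>?\<gamma>)"
      by (rule integral_mono[OF i integrable_bounded_prob[OF NP _ b]]) (use pt in auto)
    finally show ?thesis .
  qed
  have io: "integrable ?\<gamma> (\<lambda>v. f v * m * c + (f v * v) * l * \<kappa> - v\<^sup>2 / s\<^sup>2)"
    using fm fl std_normal_moments(3) by auto
  have "m * m * c + l * l * \<kappa> - 1 / s\<^sup>2 = (\<integral>v. f v * m * c + (f v * v) * l * \<kappa> - v\<^sup>2 / s\<^sup>2 \<partial>?\<gamma>)"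
    using fm fl std_normal_moments(3,4) by (simp add: m_def[symmetric] l_def[symmetric])
  also have "\<dots> \<le> (\<integral>v. \<integral>w. f v * f w * (normal_tail ((u - v * w) / s) - p) \<partial>?\<gamma> \<partial>?\<gamma>)"
  proof (rule integral_mono[OF io _ inner])
    have m2: "(\<lambda>(v, w). f v * f w * (normal_tail ((u - v * w) / s) - p)) \<in> borel_measurable (?\<gamma> \<Otimes>\<^sub>M ?\<gamma>)"
    proof -
      have "(\<lambda>(v, w). f v * f w * (normal_tail ((u - v * w) / s) - p)) \<in> borel_measurable (borel \<Otimes>\<^sub>M borel)" by measurable
      moreover have "sets (?\<gamma> \<Otimes>\<^sub>M ?\<gamma>) = sets (borel \<Otimes>\<^sub>M (borel :: real measure))" by (intro sets_pair_measure_cong) auto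
      ultimately show ?thesis by (simp cong: measurable_cong_sets)
    qed
    show "integrable ?\<gamma> (\<lambda>v. \<integral>w. f v * f w * (normal_tail ((u - v * w) / s) - p) \<partial>?\<gamma>)"
      by (rule integrable_bounded_prob[OF NP borel_measurable_lebesgue_integral[OF m2] abs_integral_le_bound[OF NP b]])
  qed
  finally have "m * m * c + l * l * \<kappa> - 1 / s\<^sup>2 \<le> (\<integral>v. \<integral>w. f v * f w * (normal_tail ((u - v * w) / s) - p) \<partial>?\<gamma> \<partial>?\<gamma>)" .
  moreover have "- (m * m) \<le> m * m * c" using mult_left_mono[of "-1" c "m * m"] c1 by (simp add: abs_le_iff)
  ultimately show ?thesis by (simp add: power2_eq_square \<kappa>_def)
qed

section \<open>Lower bound for the mean signed triangle\<close>

definition triangle_mean :: "real \<Rightarrow> nat \<Rightarrow> real" where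
  "triangle_mean p d = (\<integral>y. \<integral>x. \<integral>z. signed_edge p d x y * signed_edge p d z y * signed_edge p d x z
     \<partial>std_normal_vec d \<partial>std_normal_vec d \<partial>std_normal_vec d)"

definition tail_sq :: "nat \<Rightarrow> (nat \<Rightarrow> real) \<Rightarrow> real" where
  "tail_sq d x = (\<Sum>l=1..<d. (x l)\<^sup>2)"

text \<open>Rotating the centre \<open>y\<close> of the triangle into the first coordinate axis makes the two edges at
  \<open>y\<close> functions of the first coordinates of \<open>x\<close> and \<open>z\<close> only.\<close>

lemma triangle_rotation:
  assumes d: "2 \<le> d" and p: "0 < p" "p < 1"
  obtains \<rho> where "\<rho>\<^sup>2 = inner_vec d y y"
    "(\<integral>x. \<integral>z. signed_edge p d x y * signed_edge p d z y * signed_edge p d x z \<partial>std_normal_vec d \<partial>std_normal_vec d)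
     = (\<integral>x. \<integral>v. \<integral>w. (indicator {threshold p d..} (\<rho> * v) - p) * (indicator {threshold p d..} (\<rho> * w) - p)
         * (normal_tail ((threshold p d - v * w) / sqrt (tail_sq d x)) - p) \<partial>std_normal_distribution \<partial>std_normal_distribution \<partial>std_normal_vec d)"
    "(\<integral>x. signed_edge p d x y \<partial>std_normal_vec d) = (\<integral>v. indicator {threshold p d..} (\<rho> * v) - p \<partial>std_normal_distribution)"
proof -
  let ?N = "std_normal_vec d" and ?\<gamma> = std_normal_distribution
  interpret N: prob_space ?N by (rule prob_space_std_normal_vec)
  interpret G: prob_space ?\<gamma> by (rule prob_space_std_normal_distribution)
  note NP = N.prob_space_axioms and GP = G.prob_space_axioms
  define u where "u = threshold p d"
  have d1: "1 < d" using d by simp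
  obtain P P' where PP: "isometry_pair d P P'" and zero: "\<And>i. 1 \<le> i \<Longrightarrow> i < d \<Longrightarrow> P' y i = 0"
    using isometry_pair_triangular[of 1 d "\<lambda>_. y"] d by auto
  have P: "P \<in> ?N \<rightarrow>\<^sub>M ?N" "distr ?N ?N P = ?N" "\<And>x z. inner_vec d (P x) (P z) = inner_vec d x z"
    "\<And>x z. inner_vec d (P x) z = inner_vec d x (P' z)" "\<And>x z. inner_vec d (P' x) (P' z) = inner_vec d x z"
    using PP by (auto simp: isometry_pair_def)
  define \<rho> where "\<rho> = P' y 0"
  have axis: "inner_vec d x (P' y) = \<rho> * x 0" for x
  proof -
    have "inner_vec d x (P' y) = (\<Sum>i\<in>{0}. x i * P' y i)"
      unfolding inner_vec_def using d zero by (intro sum.mono_neutral_right) auto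
    then show ?thesis by (simp add: \<rho>_def)
  qed
  define f where "f v = indicator {u..} (\<rho> * v) - p" for v
  have f[measurable]: "f \<in> borel_measurable borel" unfolding f_def by measurable
  have f1: "\<bar>f v\<bar> \<le> 1" for v using p by (auto simp: f_def indicator_def)
  have sf: "signed_edge p d (P x) y = f (x 0)" for x by (simp add: signed_edge_def P(4) axis f_def u_def)
  have sP: "signed_edge p d (P x) (P z) = signed_edge p d x z" for x z by (simp add: signed_edge_def P(3))
  have rho2: "\<rho>\<^sup>2 = inner_vec d y y"
    using axis[of "P' y"] P(5)[of y y] by (simp add: \<rho>_def power2_eq_square)
  have distrP: "(\<integral>x. h x \<partial>?N) = (\<integral>x. h (P x) \<partial>?N)" if "h \<in> borel_measurable ?N" for h :: "_ \<Rightarrow> real"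
    using integral_distr[OF P(1) that] P(2) by simp
  have f0: "(\<lambda>x. f (x 0)) \<in> borel_measurable ?N"
    using measurable_compose[OF borel_measurable_component_std_normal_vec[of 0 d] f] d by simp
  have comp: "(\<integral>x. h (x 0) \<partial>?N) = (\<integral>v. h v \<partial>?\<gamma>)" if "h \<in> borel_measurable borel" for h :: "real \<Rightarrow> real"
    unfolding std_normal_vec_def using d that by (intro integral_PiM_component GP) auto
  \<comment> \<open>\<open>y\<close> is an arbitrary function; its restriction lies in the space and
    has the same inner products, which gives measurability in the other argument.\<close>
  let ?y = "restrict y {..<d}"
  have yy: "inner_vec d x ?y = inner_vec d x y" for x unfolding inner_vec_def by (rule sum.cong) auto
  have ysp: "?y \<in> space ?N" by (auto simp: space_std_normal_vec)
  have se_y: "signed_edge p d x ?y = signed_edge p d x y" for x by (simp add: signed_edge_def yy)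
  have seym: "(\<lambda>x. signed_edge p d x y) \<in> borel_measurable ?N"
    unfolding se_y[symmetric] using ysp by measurable
  have third: "(\<integral>x. signed_edge p d x y \<partial>?N) = (\<integral>v. f v \<partial>?\<gamma>)"
    using distrP[OF seym] comp[OF f] by (simp add: sf)
  have tri: "(\<integral>x. \<integral>z. signed_edge p d x y * signed_edge p d z y * signed_edge p d x z \<partial>?N \<partial>?N)
    = (\<integral>x. \<integral>z. f (x 0) * f (z 0) * signed_edge p d x z \<partial>?N \<partial>?N)"
  proof -
    have m2: "(\<lambda>(x, z). signed_edge p d x y * signed_edge p d z y * signed_edge p d x z) \<in> borel_measurable (?N \<Otimes>\<^sub>M ?N)"
      unfolding se_y[symmetric] case_prod_beta using ysp by measurable
    have "(\<integral>x. \<integral>z. signed_edge p d x y * signed_edge p d z y * signed_edge p d x z \<partial>?N \<partial>?N)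
      = (\<integral>x. \<integral>z. signed_edge p d (P x) y * signed_edge p d z y * signed_edge p d (P x) z \<partial>?N \<partial>?N)"
      by (rule distrP) (rule N.borel_measurable_lebesgue_integral[OF m2])
    also have "\<dots> = (\<integral>x. \<integral>z. signed_edge p d (P x) y * signed_edge p d (P z) y * signed_edge p d (P x) (P z) \<partial>?N \<partial>?N)"
    proof (rule Bochner_Integration.integral_cong[OF refl])
      fix x assume x: "x \<in> space ?N"
      show "(\<integral>z. signed_edge p d (P x) y * signed_edge p d z y * signed_edge p d (P x) z \<partial>?N)
        = (\<integral>z. signed_edge p d (P x) y * signed_edge p d (P z) y * signed_edge p d (P x) (P z) \<partial>?N)"
        by (rule distrP) (use measurable_Pair2[OF m2 measurable_space[OF P(1) x]] in simp)
    qed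
    finally show ?thesis by (simp add: sf sP)
  qed
  have inner: "AE x in ?N. (\<integral>z. f (x 0) * f (z 0) * signed_edge p d x z \<partial>?N)
     = (\<integral>w. f (x 0) * f w * (normal_tail ((u - x 0 * w) / sqrt (tail_sq d x)) - p) \<partial>?\<gamma>)"
    using AE_tail_sum_pos[OF d1] AE_space
  proof eventually_elim
    case (elim x)
    have i: "integrable ?N (\<lambda>z. f (z 0))" by (rule integrable_bounded_prob[OF NP f0 f1])
    have i2: "integrable ?N (\<lambda>z. indicator {u..} (inner_vec d x z) * f (z 0))"
      by (rule integrable_bounded_prob[OF NP, where C = 1]) (use f0 f1 elim in \<open>auto simp: indicator_def\<close>)
    have "(\<integral>z. signed_edge p d x z * f (z 0) \<partial>?N) = (\<integral>z. indicator {u..} (inner_vec d x z) * f (z 0) - p * f (z 0) \<partial>?N)"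
      by (simp add: signed_edge_def u_def algebra_simps)
    also have "\<dots> = (\<integral>z. indicator {u..} (inner_vec d x z) * f (z 0) \<partial>?N) - (\<integral>z. p * f (z 0) \<partial>?N)"
      using i i2 by (intro Bochner_Integration.integral_diff) auto
    also have "(\<integral>z. indicator {u..} (inner_vec d x z) * f (z 0) \<partial>?N)
      = (\<integral>z. normal_tail ((u - (\<Sum>l<1. x l * z l)) / sqrt (\<Sum>l=1..<d. (x l)\<^sup>2)) * f (z 0) \<partial>?N)"
      by (rule integral_inner_vec_ge[OF _ _ f0 f1]) (use d elim in auto)
    also have "\<dots> = (\<integral>w. normal_tail ((u - x 0 * w) / sqrt (tail_sq d x)) * f w \<partial>?\<gamma>)"
      using comp[of "\<lambda>w. normal_tail ((u - x 0 * w) / sqrt (tail_sq d x)) * f w"] by (simp add: tail_sq_def)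
    also have "(\<integral>z. p * f (z 0) \<partial>?N) = (\<integral>w. p * f w \<partial>?\<gamma>)" by (rule comp) measurable
    also have "(\<integral>w. normal_tail ((u - x 0 * w) / sqrt (tail_sq d x)) * f w \<partial>?\<gamma>) - (\<integral>w. p * f w \<partial>?\<gamma>)
      = (\<integral>w. normal_tail ((u - x 0 * w) / sqrt (tail_sq d x)) * f w - p * f w \<partial>?\<gamma>)"
    proof (rule Bochner_Integration.integral_diff[symmetric])
      show "integrable ?\<gamma> (\<lambda>w. p * f w)" using integrable_bounded_prob[OF GP, of f 1] f1 by simp
      show "integrable ?\<gamma> (\<lambda>w. normal_tail ((u - x 0 * w) / sqrt (tail_sq d x)) * f w)"
      proof (rule integrable_bounded_prob[OF GP, where C = 1])
        show "\<bar>normal_tail ((u - x 0 * w) / sqrt (tail_sq d x)) * f w\<bar> \<le> 1" for w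
          using mult_mono[OF normal_tail_bounds(2)[of "(u - x 0 * w) / sqrt (tail_sq d x)"] f1[of w]] normal_tail_bounds(1)
          by (simp add: abs_mult)
      qed simp
    qed
    finally have "(\<integral>z. signed_edge p d x z * f (z 0) \<partial>?N) = (\<integral>w. f w * (normal_tail ((u - x 0 * w) / sqrt (tail_sq d x)) - p) \<partial>?\<gamma>)"
      by (simp add: algebra_simps)
    then have "f (x 0) * (\<integral>z. signed_edge p d x z * f (z 0) \<partial>?N) = f (x 0) * (\<integral>w. f w * (normal_tail ((u - x 0 * w) / sqrt (tail_sq d x)) - p) \<partial>?\<gamma>)"
      by simp
    then show ?case
      by (simp only: integral_mult_right_zero[symmetric] mult_ac)
  qed
  let ?K = "\<lambda>v x. \<integral>w. f v * f w * (normal_tail ((u - v * w) / sqrt (tail_sq d x)) - p) \<partial>?\<gamma>"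
  have tsm: "tail_sq d \<in> borel_measurable ?N" unfolding tail_sq_def[abs_def] by measurable
  have bK: "\<bar>f v * f w * (normal_tail ((u - v * w) / s) - p)\<bar> \<le> 1" for v w s
  proof -
    have "\<bar>normal_tail ((u - v * w) / s) - p\<bar> \<le> 1" using normal_tail_bounds[of "(u - v * w) / s"] p by (simp add: abs_le_iff)
    moreover have "\<bar>f v * f w\<bar> \<le> 1" using mult_mono[OF f1[of v] f1[of w]] by (simp add: abs_mult)
    ultimately show ?thesis using mult_mono[of "\<bar>f v * f w\<bar>" 1 "\<bar>normal_tail ((u - v * w) / s) - p\<bar>" 1] by (simp add: abs_mult)
  qed
  have Km: "(\<lambda>x. ?K (x 0) x) \<in> borel_measurable ?N"
  proof (rule G.borel_measurable_lebesgue_integral)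
    have [measurable]: "(\<lambda>z. fst z 0) \<in> borel_measurable (?N \<Otimes>\<^sub>M ?\<gamma>)"
      using measurable_compose[OF measurable_fst borel_measurable_component_std_normal_vec[of 0 d]] d by simp
    have [measurable]: "(\<lambda>z. tail_sq d (fst z)) \<in> borel_measurable (?N \<Otimes>\<^sub>M ?\<gamma>)"
      by (rule measurable_compose[OF measurable_fst tsm])
    have [measurable]: "snd \<in> borel_measurable (?N \<Otimes>\<^sub>M ?\<gamma>)"
      using measurable_snd[of ?N ?\<gamma>] by simp
    show "(\<lambda>(x, w). f (x 0) * f w * (normal_tail ((u - x 0 * w) / sqrt (tail_sq d x)) - p)) \<in> borel_measurable (?N \<Otimes>\<^sub>M ?\<gamma>)"
      unfolding case_prod_beta by measurable
  qed
  have "(\<integral>x. \<integral>z. f (x 0) * f (z 0) * signed_edge p d x z \<partial>?N \<partial>?N) = (\<integral>x. ?K (x 0) x \<partial>?N)"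
  proof (rule integral_cong_AE[OF _ Km inner])
    show "(\<lambda>x. \<integral>z. f (x 0) * f (z 0) * signed_edge p d x z \<partial>?N) \<in> borel_measurable ?N"
    proof (rule N.borel_measurable_lebesgue_integral)
      have [measurable]: "(\<lambda>z. f (fst z 0)) \<in> borel_measurable (?N \<Otimes>\<^sub>M ?N)" "(\<lambda>z. f (snd z 0)) \<in> borel_measurable (?N \<Otimes>\<^sub>M ?N)"
        using measurable_compose[OF measurable_fst f0] measurable_compose[OF measurable_snd f0] by auto
      show "(\<lambda>(x, z). f (x 0) * f (z 0) * signed_edge p d x z) \<in> borel_measurable (?N \<Otimes>\<^sub>M ?N)"
        unfolding case_prod_beta by measurable
    qed
  qed
  \<comment> \<open>Coordinate 0 of \<open>x\<close> is resampled as \<open>v\<close>;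
    \<open>tail_sq d x\<close> involves only the coordinates from 1 on.\<close>
  also have "\<dots> = (\<integral>x. \<integral>v. ?K v x \<partial>?\<gamma> \<partial>?N)"
  proof -
    have "(\<integral>x. ?K (x 0) x \<partial>PiM {..<d} (\<lambda>_. ?\<gamma>)) = (\<integral>x. \<integral>v. ?K ((x(0 := v)) 0) (x(0 := v)) \<partial>?\<gamma> \<partial>PiM {..<d} (\<lambda>_. ?\<gamma>))"
      using d Km by (intro integral_PiM_update[where C = 1] GP) (auto simp: std_normal_vec_def[symmetric] intro!: abs_integral_le_bound[OF GP] bK)
    moreover have "tail_sq d (x(0 := v)) = tail_sq d x" for x v
      unfolding tail_sq_def by (rule sum.cong) auto
    ultimately show ?thesis by (simp add: std_normal_vec_def)
  qed
  finally show thesis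
    using that[of \<rho>] rho2 tri third by (simp add: f_def u_def)
qed

text \<open>The absorption argument of \<open>integral_signed_path_square\<close> with
  \<open>k = 0\<close>: the test function is the signed degree itself, constant in the second
  vector.\<close>

lemma integral_signed_degree_square:
  assumes d: "1 \<le> d" and p: "0 < p" "p < 1"
  shows "(\<integral>y. (\<integral>x. signed_edge p d x y \<partial>std_normal_vec d)\<^sup>2 \<partial>std_normal_vec d) \<le> edge_rate p d 0"
proof -
  let ?N = "std_normal_vec d"
  interpret N: prob_space ?N by (rule prob_space_std_normal_vec)
  note NP = N.prob_space_axioms
  define D where "D y = (\<integral>x. signed_edge p d y x \<partial>?N)" for y
  have Dm[measurable]: "D \<in> borel_measurable ?N" unfolding D_def by measurable
  have D1: "\<bar>D y\<bar> \<le> 1" for y unfolding D_def by (rule abs_integral_le_bound[OF NP abs_signed_edge_le[OF p]])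
  have "(\<integral>y. (D y)\<^sup>2 \<partial>?N) = (\<integral>y. \<bar>\<integral>x. signed_edge p d y x * D y \<partial>?N\<bar> \<partial>?N)"
    by (simp add: D_def power2_eq_square abs_mult)
  also have "\<dots> \<le> (1 * edge_rate p d 0 + (\<integral>y. \<integral>x. (D y)\<^sup>2 \<partial>?N \<partial>?N) / 1) / 2"
    by (rule signed_edge_correlation[OF d p, of 1 "\<lambda>y x. D y" 1 0]) (use D1 in \<open>auto simp: case_prod_beta\<close>)
  also have "\<dots> = (edge_rate p d 0 + (\<integral>y. (D y)\<^sup>2 \<partial>?N)) / 2" by (simp add: N.prob_space)
  finally show ?thesis by (simp add: D_def signed_edge_commute)
qed

lemma std_normal_density_ge:
  assumes "x\<^sup>2 \<le> 2 * K"
  shows "exp (- K) / sqrt (2 * pi) \<le> std_normal_density x"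
  unfolding std_normal_density_def using assms by (simp add: divide_right_mono)

text \<open>As long as \<open>tail_sq d x\<close> and the squared length of \<open>y\<close> are
  comparable to \<open>d\<close>, the threshold divided by either length is at most
  \<open>sqrt (2 * K)\<close>; \<open>c\<close> and \<open>l0\<close> are the resulting lower bounds
  for the density factor and the Hermite coefficient. Atypical lengths are charged to squared
  deviations. The 26 is 2 from the Taylor remainder and 24 from the deviation of \<open>x\<close>;
  \<open>48 \<le> d\<close> makes \<open>24 / d\<close> at most one half.\<close>

lemma triangle_centre_ge:
  assumes d: "48 \<le> d" and p: "0 < p" "p < 1"
  defines "K \<equiv> 1 / (p * (1 - p))"
  defines "l0 \<equiv> sqrt (2 * K) * min (normal_tail (sqrt (2 * K))) (1 - normal_tail (- sqrt (2 * K)))"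
  defines "c \<equiv> exp (- K) / sqrt (2 * pi) / sqrt (2 * d)"
  shows "(\<integral>x. \<integral>z. signed_edge p d x y * signed_edge p d z y * signed_edge p d x z \<partial>std_normal_vec d \<partial>std_normal_vec d)
    \<ge> c * l0\<^sup>2 / 2 * (1 - 4 * (real d - (\<Sum>l=0..<d. (y l)\<^sup>2))\<^sup>2 / (real d)\<^sup>2)
      - (\<integral>x. signed_edge p d x y \<partial>std_normal_vec d)\<^sup>2 - 26 / d"
proof -
  let ?N = "std_normal_vec d" and ?\<gamma> = std_normal_distribution
  interpret N: prob_space ?N by (rule prob_space_std_normal_vec)
  interpret G: prob_space ?\<gamma> by (rule prob_space_std_normal_distribution)
  note NP = N.prob_space_axioms and GP = G.prob_space_axioms
  have d2: "2 \<le> d" and d1: "1 \<le> d" using d by auto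
  define u where "u = threshold p d"
  have K: "0 < K" using p by (simp add: K_def)
  have c0: "0 \<le> c" by (simp add: c_def)
  have u2: "u\<^sup>2 \<le> K * d" using threshold_square_le[OF d1 p] by (simp add: u_def K_def)
  obtain \<rho> where rho: "\<rho>\<^sup>2 = inner_vec d y y"
    and tri: "(\<integral>x. \<integral>z. signed_edge p d x y * signed_edge p d z y * signed_edge p d x z \<partial>?N \<partial>?N)
     = (\<integral>x. \<integral>v. \<integral>w. (indicator {u..} (\<rho> * v) - p) * (indicator {u..} (\<rho> * w) - p)
         * (normal_tail ((u - v * w) / sqrt (tail_sq d x)) - p) \<partial>?\<gamma> \<partial>?\<gamma> \<partial>?N)"
    and deg: "(\<integral>x. signed_edge p d x y \<partial>?N) = (\<integral>v. indicator {u..} (\<rho> * v) - p \<partial>?\<gamma>)"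
    using triangle_rotation[OF d2 p, of y] unfolding u_def by blast
  define f where "f v = indicator {u..} (\<rho> * v) - p" for v
  have f[measurable]: "f \<in> borel_measurable borel" unfolding f_def by measurable
  have f1: "\<bar>f v\<bar> \<le> 1" for v using p by (auto simp: f_def indicator_def)
  define m where "m = (\<integral>v. f v \<partial>?\<gamma>)"
  define l where "l = (\<integral>v. f v * v \<partial>?\<gamma>)"
  let ?I = "\<lambda>x. \<integral>v. \<integral>w. f v * f w * (normal_tail ((u - v * w) / sqrt (tail_sq d x)) - p) \<partial>?\<gamma> \<partial>?\<gamma>"
  \<comment> \<open>\<open>h x\<close> is nonnegative, and at least 1 once
    \<open>tail_sq d x\<close> leaves \<open>{d / 2..2 * d}\<close>. Subtracting it makes the bound
    \<open>pt\<close> trivial there, because the inner integral is at least -1.\<close>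
  define h where "h x = 4 * (real d - tail_sq d x)\<^sup>2 / (real d)\<^sup>2" for x
  have bK: "\<bar>f v * f w * (normal_tail t - p)\<bar> \<le> 1" for v w t
  proof -
    have "\<bar>normal_tail t - p\<bar> \<le> 1" using normal_tail_bounds[of t] p by (simp add: abs_le_iff)
    moreover have "\<bar>f v * f w\<bar> \<le> 1" using mult_mono[OF f1[of v] f1[of w]] by (simp add: abs_mult)
    ultimately show ?thesis using mult_mono[of "\<bar>f v * f w\<bar>" 1 "\<bar>normal_tail t - p\<bar>" 1] by (simp add: abs_mult)
  qed
  have I1: "\<bar>?I x\<bar> \<le> 1" for x by (intro abs_integral_le_bound[OF GP] bK)
  have h0: "0 \<le> h x" for x by (simp add: h_def)
  have pt: "l\<^sup>2 * c * (1 - h x) - m\<^sup>2 - 2 / d - h x \<le> ?I x" for x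
  proof (cases "tail_sq d x \<in> {d / 2..2 * d}")
    case True
    define s where "s = sqrt (tail_sq d x)"
    have s: "0 < s" "s\<^sup>2 = tail_sq d x" using True d by (auto simp: s_def)
    have "l\<^sup>2 * (std_normal_density (u / s) / s) - m\<^sup>2 - 1 / s\<^sup>2 \<le> ?I x"
      unfolding l_def m_def s_def[symmetric] by (rule integral_normal_tail_expansion[OF f f1 s(1) p])
    moreover have "c \<le> std_normal_density (u / s) / s"
    proof -
      have "(u / s)\<^sup>2 = u\<^sup>2 / tail_sq d x" using s by (simp add: power_divide)
      also have "\<dots> \<le> K * d / (d / 2)" using True u2 d K by (intro frac_le) auto
      finally have "(u / s)\<^sup>2 \<le> 2 * K" using d by simp
      then have "exp (- K) / sqrt (2 * pi) \<le> std_normal_density (u / s)" by (rule std_normal_density_ge)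
      moreover have "s \<le> sqrt (2 * d)" unfolding s_def using True by (intro real_sqrt_le_mono) simp
      ultimately show ?thesis unfolding c_def using s by (intro frac_le) auto
    qed
    then have "l\<^sup>2 * c \<le> l\<^sup>2 * (std_normal_density (u / s) / s)" by (intro mult_left_mono) auto
    moreover have "1 / s\<^sup>2 \<le> 2 / d"
    proof -
      have "1 / s\<^sup>2 \<le> 1 / (real d / 2)" unfolding s(2) using True d by (intro divide_left_mono) auto
      then show ?thesis by simp
    qed
    moreover have "l\<^sup>2 * c * (1 - h x) \<le> l\<^sup>2 * c * 1" using h0[of x] c0 by (intro mult_left_mono) auto
    ultimately show ?thesis using h0[of x] by linarith
  next
    case False
    have "real d / 2 \<le> \<bar>real d - tail_sq d x\<bar>" using False by auto
    then have "(real d / 2)\<^sup>2 \<le> (real d - tail_sq d x)\<^sup>2" by (simp add: abs_le_square_iff[symmetric])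
    then have "1 \<le> h x" using d by (simp add: h_def power_divide field_simps)
    moreover from this have "l\<^sup>2 * c * (1 - h x) \<le> 0" using c0 by (intro mult_nonneg_nonpos) auto
    moreover have "0 \<le> m\<^sup>2" "0 \<le> 2 / real d" by auto
    ultimately show ?thesis using I1[of x] by linarith
  qed
  have hi: "integrable ?N h" and hE: "(\<integral>x. h x \<partial>?N) \<le> 24 / d"
  proof -
    note dev = integral_tail_sum_deviation[OF d1]
    have "h x = 4 / (real d)\<^sup>2 * (real d - (\<Sum>l=1..<d. (x l)\<^sup>2))\<^sup>2" for x by (simp add: h_def tail_sq_def)
    then have heq: "h = (\<lambda>x. 4 / (real d)\<^sup>2 * (real d - (\<Sum>l=1..<d. (x l)\<^sup>2))\<^sup>2)" by auto
    show "integrable ?N h" unfolding heq using dev(1) by (intro integrable_mult_right) auto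
    have "(\<integral>x. h x \<partial>?N) \<le> 4 / (real d)\<^sup>2 * (2 * (real 1)\<^sup>2 + 4 * real d)"
      unfolding heq using dev(2) by (subst integral_mult_right_zero) (intro mult_left_mono, auto)
    also have "\<dots> \<le> 4 / (real d)\<^sup>2 * (6 * real d)" using d by (intro mult_left_mono) auto
    finally show "(\<integral>x. h x \<partial>?N) \<le> 24 / d" using d by (simp add: power2_eq_square)
  qed
  have main: "l\<^sup>2 * c / 2 - m\<^sup>2 - 26 / d \<le> (\<integral>x. ?I x \<partial>?N)"
  proof -
    have tsm: "tail_sq d \<in> borel_measurable ?N" unfolding tail_sq_def[abs_def] by measurable
    have [measurable]: "snd \<in> borel_measurable (M \<Otimes>\<^sub>M ?\<gamma>)" for M :: "'b measure" using measurable_snd[of M ?\<gamma>] by simp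
    have Im: "?I \<in> borel_measurable ?N"
    proof (rule G.borel_measurable_lebesgue_integral)
      have "(\<lambda>(z, w). f (snd z) * f w * (normal_tail ((u - snd z * w) / sqrt (tail_sq d (fst z))) - p)) \<in> borel_measurable ((?N \<Otimes>\<^sub>M ?\<gamma>) \<Otimes>\<^sub>M ?\<gamma>)"
      proof -
        have [measurable]: "(\<lambda>z. tail_sq d (fst (fst z))) \<in> borel_measurable ((?N \<Otimes>\<^sub>M ?\<gamma>) \<Otimes>\<^sub>M ?\<gamma>)"
          by (intro measurable_compose[OF _ tsm] measurable_compose[OF measurable_fst measurable_fst])
        have [measurable]: "(\<lambda>z. snd (fst z)) \<in> borel_measurable ((?N \<Otimes>\<^sub>M ?\<gamma>) \<Otimes>\<^sub>M ?\<gamma>)"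
          by (rule measurable_compose[OF measurable_fst]) measurable
        show ?thesis unfolding case_prod_beta' by measurable
      qed
      from G.borel_measurable_lebesgue_integral[OF this]
      show "(\<lambda>(x, v). \<integral>w. f v * f w * (normal_tail ((u - v * w) / sqrt (tail_sq d x)) - p) \<partial>?\<gamma>) \<in> borel_measurable (?N \<Otimes>\<^sub>M ?\<gamma>)"
        by (simp add: case_prod_beta')
    qed
    have "l\<^sup>2 * c / 2 - m\<^sup>2 - 26 / d \<le> l\<^sup>2 * c * (1 - (\<integral>x. h x \<partial>?N)) - m\<^sup>2 - 2 / d - (\<integral>x. h x \<partial>?N)"
    proof -
      have "24 / real d \<le> 1 / 2" using d by (simp add: field_simps)
      then have "l\<^sup>2 * c * (1 / 2) \<le> l\<^sup>2 * c * (1 - (\<integral>x. h x \<partial>?N))" using hE c0 by (intro mult_left_mono) auto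
      then show ?thesis using hE by simp
    qed
    also have "\<dots> = (\<integral>x. l\<^sup>2 * c * (1 - h x) - m\<^sup>2 - 2 / d - h x \<partial>?N)" using hi by (simp add: N.prob_space)
    also have "\<dots> \<le> (\<integral>x. ?I x \<partial>?N)"
      by (rule integral_mono[OF _ integrable_bounded_prob[OF NP Im I1] pt]) (use hi in auto)
    finally show ?thesis .
  qed
  have l_eq: "l = (\<integral>v. indicator {u..} (\<rho> * v) * v \<partial>?\<gamma>)"
  proof -
    have "{v. u \<le> \<rho> * v} \<in> sets borel" by measurable
    then have "integrable ?\<gamma> (\<lambda>v. indicator {v. u \<le> \<rho> * v} v * v)" by (rule integrable_indicator_mult_std_normal)
    then have i: "integrable ?\<gamma> (\<lambda>v. indicator {u..} (\<rho> * v) * v)" by (simp add: indicator_def)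
    have "l = (\<integral>v. indicator {u..} (\<rho> * v) * v - p * v \<partial>?\<gamma>)" by (simp add: l_def f_def left_diff_distrib)
    then show ?thesis using i std_normal_moments(1,2) by simp
  qed
  define h0 where "h0 = 4 * (real d - (\<Sum>l=0..<d. (y l)\<^sup>2))\<^sup>2 / (real d)\<^sup>2"
  have l2: "l0\<^sup>2 * (1 - h0) \<le> l\<^sup>2"
  proof (cases "inner_vec d y y \<ge> d / 2")
    case True
    then have r0: "\<rho> \<noteq> 0" using rho d by auto
    have "(u / \<rho>)\<^sup>2 = u\<^sup>2 / inner_vec d y y" using rho by (simp add: power_divide)
    also have "\<dots> \<le> K * d / (d / 2)" using True u2 d K by (intro frac_le) auto
    finally have "(u / \<rho>)\<^sup>2 \<le> 2 * K" using d by simp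
    then have "\<bar>u / \<rho>\<bar> \<le> sqrt (2 * K)" by (rule real_le_rsqrt[of "\<bar>_\<bar>", simplified power2_abs])
    then have "l0 \<le> half_mean (u / \<rho>)" unfolding l0_def using K by (intro half_mean_ge) auto
    moreover have "0 < l0" unfolding l0_def using K by (intro half_mean_const_pos) auto
    ultimately have "l0\<^sup>2 \<le> (half_mean (u / \<rho>))\<^sup>2" by (intro power_mono) auto
    also have "\<dots> = l\<^sup>2" unfolding l_eq by (rule scaled_half_mean_square[OF r0, symmetric])
    finally have "l0\<^sup>2 \<le> l\<^sup>2" .
    moreover have "l0\<^sup>2 * (1 - h0) \<le> l0\<^sup>2 * 1" by (intro mult_left_mono) (auto simp: h0_def)
    ultimately show ?thesis by linarith
  next
    case False
    have "inner_vec d y y = (\<Sum>l=0..<d. (y l)\<^sup>2)" by (simp add: inner_vec_def power2_eq_square lessThan_atLeast0)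
    then have "real d / 2 \<le> real d - (\<Sum>l=0..<d. (y l)\<^sup>2)" using False by simp
    then have "(real d / 2)\<^sup>2 \<le> (real d - (\<Sum>l=0..<d. (y l)\<^sup>2))\<^sup>2" by (intro power_mono) auto
    then have "1 \<le> h0" using d by (simp add: h0_def power_divide field_simps)
    then have "l0\<^sup>2 * (1 - h0) \<le> 0" by (intro mult_nonneg_nonpos) auto
    then show ?thesis using zero_le_power2[of l] by linarith
  qed
  have fin: "c * l0\<^sup>2 / 2 * (1 - h0) \<le> l\<^sup>2 * c / 2"
    using mult_left_mono[OF l2, of "c / 2"] c0 by (simp add: mult_ac)
  have tri': "(\<integral>x. \<integral>z. signed_edge p d x y * signed_edge p d z y * signed_edge p d x z \<partial>?N \<partial>?N) = (\<integral>x. ?I x \<partial>?N)"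
    using tri by (simp only: f_def)
  have deg': "(\<integral>x. signed_edge p d x y \<partial>?N) = m" using deg by (simp only: m_def f_def)
  show ?thesis unfolding tri' deg' h0_def[symmetric] using main fin by linarith
qed

text \<open>\<open>triangle_centre_ge\<close> is integrated over the centre: the main term is of
  order \<open>1 / sqrt d\<close>, whereas squared signed degrees and remainders contribute only
  \<open>O(1 / d)\<close>. For small \<open>d\<close> the error may exceed the main term, hence the
  bound \<open>D\<close>.\<close>

lemma triangle_mean_ge:
  assumes p: "0 < p" "p < 1"
  shows "\<exists>\<kappa> > 0. \<exists>D. \<forall>d \<ge> D. \<kappa> / sqrt d \<le> triangle_mean p d"
proof -
  define K where "K = 1 / (p * (1 - p))"
  define l0 where "l0 = sqrt (2 * K) * min (normal_tail (sqrt (2 * K))) (1 - normal_tail (- sqrt (2 * K)))"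
  have K: "0 < K" using p by (simp add: K_def)
  have l0: "0 < l0" unfolding l0_def using K by (intro half_mean_const_pos) auto
  \<comment> \<open>A factor 1/2 is lost to the length of \<open>x\<close> and another to the length
    of \<open>y\<close>, hence the division by 4.\<close>
  define \<kappa> where "\<kappa> = exp (- K) / sqrt (2 * pi) / sqrt 2 * l0\<^sup>2 / 4"
  have \<kappa>: "0 < \<kappa>" using l0 by (simp add: \<kappa>_def)
  define C where "C = edge_const p + 26"
  have C: "0 < C" using edge_const_ge[OF p] by (simp add: C_def)
  \<comment> \<open>48 is required by \<open>triangle_centre_ge\<close>; beyond
    \<open>(2 * C / \<kappa>)\<^sup>2\<close> the error \<open>C / d\<close> is at most half of the
    main term.\<close>
  define D where "D = max 48 (nat \<lceil>(2 * C / \<kappa>)\<^sup>2\<rceil>)"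
  have "\<kappa> / 2 / sqrt d \<le> triangle_mean p d" if "D \<le> d" for d
  proof -
    let ?N = "std_normal_vec d"
    interpret N: prob_space ?N by (rule prob_space_std_normal_vec)
    note NP = N.prob_space_axioms
    have d: "48 \<le> d" and dC: "(2 * C / \<kappa>)\<^sup>2 \<le> d" using that by (auto simp: D_def nat_le_iff ceiling_le_iff)
    have d1: "1 \<le> d" using d by simp
    define c where "c = exp (- K) / sqrt (2 * pi) / sqrt (2 * real d)"
    have c0: "0 \<le> c" by (simp add: c_def)
    let ?A = "\<lambda>y. \<integral>x. \<integral>z. signed_edge p d x y * signed_edge p d z y * signed_edge p d x z \<partial>?N \<partial>?N"
    let ?dev = "\<lambda>y :: nat \<Rightarrow> real. (real d - (\<Sum>l=0..<d. (y l)\<^sup>2))\<^sup>2"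
    let ?deg = "\<lambda>y. (\<integral>x. signed_edge p d x y \<partial>?N)\<^sup>2"
    have b: "\<bar>signed_edge p d x y * signed_edge p d z y * signed_edge p d x z\<bar> \<le> 1" for x y z
    proof -
      note s = abs_signed_edge_le[OF p, of d]
      have "\<bar>signed_edge p d x y * signed_edge p d z y\<bar> \<le> 1" using mult_mono[OF s[of x y] s[of z y]] by (simp add: abs_mult)
      then show ?thesis using mult_mono[OF _ s[of x z], of "\<bar>signed_edge p d x y * signed_edge p d z y\<bar>" 1] by (simp add: abs_mult)
    qed
    have Ai: "integrable ?N ?A"
    proof (rule integrable_bounded_prob[OF NP, where C = 1])
      show "\<bar>?A y\<bar> \<le> 1" for y by (intro abs_integral_le_bound[OF NP] b)
    qed measurable
    have degi: "integrable ?N ?deg"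
    proof (rule integrable_bounded_prob[OF NP, where C = 1])
      have "\<bar>\<integral>x. signed_edge p d x y \<partial>?N\<bar> \<le> 1" for y by (rule abs_integral_le_bound[OF NP abs_signed_edge_le[OF p]])
      then show "\<bar>?deg y\<bar> \<le> 1" for y by (simp add: abs_square_le_1)
    qed measurable
    have deg: "(\<integral>y. ?deg y \<partial>?N) \<le> edge_const p / d"
      using integral_signed_degree_square[OF d1 p] edge_rate_bounds(2)[of p d 0] by simp
    note dev = integral_tail_sum_deviation[of 0 d, simplified]
    have devE: "4 * (\<integral>y. ?dev y \<partial>?N) / (real d)\<^sup>2 \<le> 1 / 2"
    proof -
      have "4 * (\<integral>y. ?dev y \<partial>?N) / (real d)\<^sup>2 \<le> 4 * (4 * real d) / (real d)\<^sup>2"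
        using dev(2) by (intro divide_right_mono mult_left_mono) auto
      also have "\<dots> = 16 / d" using d by (simp add: power2_eq_square)
      also have "\<dots> \<le> 1 / 2" using d by (simp add: field_simps)
      finally show ?thesis .
    qed
    have "c * l0\<^sup>2 / 2 * (1 / 2) \<le> c * l0\<^sup>2 / 2 * (1 - 4 * (\<integral>y. ?dev y \<partial>?N) / (real d)\<^sup>2)"
      using devE c0 by (intro mult_left_mono) auto
    moreover have "c * l0\<^sup>2 / 2 * (1 - 4 * (\<integral>y. ?dev y \<partial>?N) / (real d)\<^sup>2) - (\<integral>y. ?deg y \<partial>?N) - 26 / d
      = (\<integral>y. c * l0\<^sup>2 / 2 * (1 - 4 * ?dev y / (real d)\<^sup>2) - ?deg y - 26 / d \<partial>?N)"
      using dev(1) degi by (simp add: N.prob_space)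
    moreover have "\<dots> \<le> (\<integral>y. ?A y \<partial>?N)"
    proof (rule integral_mono[OF _ Ai])
      show "integrable ?N (\<lambda>y. c * l0\<^sup>2 / 2 * (1 - 4 * ?dev y / (real d)\<^sup>2) - ?deg y - 26 / d)"
        using dev(1) degi by auto
      show "c * l0\<^sup>2 / 2 * (1 - 4 * ?dev y / (real d)\<^sup>2) - ?deg y - 26 / d \<le> ?A y" for y
        using triangle_centre_ge[OF d p, of y] by (simp only: c_def l0_def K_def)
    qed
    ultimately have "c * l0\<^sup>2 / 4 - edge_const p / d - 26 / d \<le> triangle_mean p d"
      using deg unfolding triangle_mean_def by linarith
    moreover have "c * l0\<^sup>2 / 4 = \<kappa> / sqrt d" by (simp add: c_def \<kappa>_def real_sqrt_mult)
    ultimately have "\<kappa> / sqrt d - C / d \<le> triangle_mean p d" by (simp add: C_def add_divide_distrib)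
    moreover have "C / d \<le> \<kappa> / 2 / sqrt d"
    proof -
      have "2 * C / \<kappa> \<le> sqrt d" using dC by (rule real_le_rsqrt)
      then have "C \<le> \<kappa> / 2 * sqrt d" using \<kappa> by (simp add: field_simps)
      then have "C / d \<le> \<kappa> / 2 * sqrt d / d" by (intro divide_right_mono) auto
      also have "\<dots> = \<kappa> / 2 / sqrt d"
        using d real_sqrt_mult_self[of "real d"] by (simp add: field_simps)
      finally show ?thesis .
    qed
    ultimately show ?thesis by simp
  qed
  then show ?thesis using \<kappa> by (intro exI[of _ "\<kappa> / 2"]) auto
qed

subsection \<open>Counting signed cycles\<close>

definition cycle_vertex :: "nat \<Rightarrow> nat \<Rightarrow> nat \<Rightarrow> nat" where
  "cycle_vertex m i a = i * m + a + 1"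

text \<open>Position \<open>i\<close> of a cycle is taken from the \<open>i\<close>-th block of \<open>m\<close> consecutive vertices, and
  \<open>v i\<close> is the index of the chosen vertex within its block.\<close>

definition cycle_edge :: "nat \<Rightarrow> nat \<Rightarrow> (nat \<Rightarrow> nat) \<Rightarrow> nat \<Rightarrow> nat \<times> nat" where
  "cycle_edge l m v i =
     (let a = cycle_vertex m i (v i); b = cycle_vertex m (Suc i mod l) (v (Suc i mod l)) in (min a b, max a b))"

lemma cycle_vertex_inject:
  assumes "a < m" "b < m"
  shows "cycle_vertex m i a = cycle_vertex m j b \<longleftrightarrow> i = j \<and> a = b"
proof
  assume "cycle_vertex m i a = cycle_vertex m j b"
  then have eq: "i * m + a = j * m + b" by (simp add: cycle_vertex_def)
  have "(i * m + a) div m = i" "(j * m + b) div m = j" using assms by auto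
  then have "i = j" using eq by metis
  then show "i = j \<and> a = b" using eq by simp
qed simp

lemma cycle_vertex_range:
  assumes "i < l" "a < m" "l * m \<le> n"
  shows "1 \<le> cycle_vertex m i a" "cycle_vertex m i a \<le> n"
proof -
  have "i * m + a + 1 \<le> (i + 1) * m" using assms by simp
  also have "\<dots> \<le> l * m" using assms by (intro mult_right_mono) auto
  finally show "cycle_vertex m i a \<le> n" using assms by (simp add: cycle_vertex_def)
qed (simp add: cycle_vertex_def)

lemma Suc_mod_cycle:
  assumes "l = 3 \<or> l = (4 :: nat)" "i < l" "j < l"
  shows "Suc i mod l \<noteq> i" "\<not> (i = Suc j mod l \<and> Suc i mod l = j)" "Suc i mod l = Suc j mod l \<longleftrightarrow> i = j" "Suc i mod l < l"
proof -
  have "(l = 3 \<and> i \<in> {0, 1, 2} \<and> j \<in> {0, 1, 2}) \<or> (l = 4 \<and> i \<in> {0, 1, 2, 3} \<and> j \<in> {0, 1, 2, 3})"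
    using assms by auto
  then show "Suc i mod l \<noteq> i" "\<not> (i = Suc j mod l \<and> Suc i mod l = j)" "Suc i mod l = Suc j mod l \<longleftrightarrow> i = j" "Suc i mod l < l"
    by (elim disjE conjE insertE emptyE; simp)+
qed

text \<open>The blocks of its two endpoints determine the position of an edge in its cycle, so two
  cycles can share an edge only at the same position. Matching the endpoints crosswise would make
  \<open>i\<close> and \<open>j\<close> successors of each other, which a cycle of length 3 or 4
  excludes.\<close>

lemma cycle_edge_inject:
  assumes l: "l = 3 \<or> l = 4" and v: "v \<in> {..<l} \<rightarrow> {..<m}" "w \<in> {..<l} \<rightarrow> {..<m}" and ij: "i < l" "j < l"
  shows "cycle_edge l m v i = cycle_edge l m w j \<longleftrightarrow> i = j \<and> v i = w i \<and> v (Suc i mod l) = w (Suc i mod l)"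
proof
  assume eq: "cycle_edge l m v i = cycle_edge l m w j"
  note s = Suc_mod_cycle(4)[OF l ij] Suc_mod_cycle(4)[OF l ij(2,1)]
  let ?a = "cycle_vertex m i (v i)" and ?b = "cycle_vertex m (Suc i mod l) (v (Suc i mod l))"
  let ?c = "cycle_vertex m j (w j)" and ?e = "cycle_vertex m (Suc j mod l) (w (Suc j mod l))"
  have "?a = ?c \<and> ?b = ?e \<or> ?a = ?e \<and> ?b = ?c"
    using eq by (auto simp: cycle_edge_def Let_def min_def max_def split: if_splits)
  then show "i = j \<and> v i = w i \<and> v (Suc i mod l) = w (Suc i mod l)"
  proof
    assume "?a = ?c \<and> ?b = ?e"
    then show ?thesis using v ij s by (auto simp: cycle_vertex_inject Pi_iff)
  next
    assume "?a = ?e \<and> ?b = ?c"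
    moreover have "v i < m" "v (Suc i mod l) < m" "w j < m" "w (Suc j mod l) < m" using v ij s by auto
    ultimately have "i = Suc j mod l" "Suc i mod l = j" using cycle_vertex_inject by metis+
    then show ?thesis using Suc_mod_cycle(2)[OF l ij] by blast
  qed
qed (auto simp: cycle_edge_def)

lemma cycle_edge_in_vertex_pairs:
  assumes l: "l = 3 \<or> l = 4" and v: "v \<in> {..<l} \<rightarrow> {..<m}" and i: "i < l" and n: "l * m \<le> n"
  shows "cycle_edge l m v i \<in> vertex_pairs n"
proof -
  note s = Suc_mod_cycle(4)[OF l i i]
  have "v i < m" "v (Suc i mod l) < m" using v i s by auto
  moreover have "cycle_vertex m i (v i) \<noteq> cycle_vertex m (Suc i mod l) (v (Suc i mod l))"
    using calculation Suc_mod_cycle(1)[OF l i i] by (simp add: cycle_vertex_inject)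
  ultimately show ?thesis
    using cycle_vertex_range[OF i _ n] cycle_vertex_range[OF s _ n]
    by (auto simp: cycle_edge_def vertex_pairs_def Let_def min_def max_def)
qed

definition latent_edge :: "real \<Rightarrow> nat \<Rightarrow> nat \<Rightarrow> nat \<Rightarrow> (nat \<Rightarrow> nat \<Rightarrow> real) \<Rightarrow> (nat \<Rightarrow> nat) \<Rightarrow> nat \<Rightarrow> real" where
  "latent_edge p d l m x v i =
     signed_edge p d (x (cycle_vertex m i (v i))) (x (cycle_vertex m (Suc i mod l) (v (Suc i mod l))))"

lemma noisy_weight_cycle_edge:
  "noisy_weight p d q x (cycle_edge l m v i) = p + q * latent_edge p d l m x v i"
  by (auto simp: noisy_weight_def cycle_edge_def latent_edge_def Let_def min_def max_def signed_edge_commute[of _ _ "x (cycle_vertex m (Suc i mod l) (v (Suc i mod l)))"])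

text \<open>The contribution of the single cycle \<open>v\<close>; the test statistic
  \<open>count\<close> sums it over all \<open>v\<close>. Under \<open>G(n, p)\<close> the factors
  are independent with mean 0.\<close>

definition signed_count :: "real \<Rightarrow> nat \<Rightarrow> nat \<Rightarrow> (nat \<Rightarrow> nat) \<Rightarrow> graph \<Rightarrow> real" where
  "signed_count p l m v \<omega> = (\<Prod>i<l. of_bool (cycle_edge l m v i \<in> \<omega>) - p)"

text \<open>The conditional expectation of the product of two signed edges \<open>i\<close>, which may coincide.\<close>

definition pair_factor :: "real \<Rightarrow> ('e \<Rightarrow> real) \<Rightarrow> 'e \<Rightarrow> 'e \<Rightarrow> real" where
  "pair_factor p w e f = (if e = f then w e * (1 - p)\<^sup>2 + (1 - w e) * p\<^sup>2 else (w e - p) * (w f - p))"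

text \<open>Edges at different positions are distinct by \<open>inj\<close>, so the expectation
  factorises over positions.\<close>

lemma sum_bern_mass_pairs:
  fixes e e' :: "nat \<Rightarrow> 'e"
  assumes S: "finite S" "\<And>i. i < l \<Longrightarrow> e i \<in> S" "\<And>i. i < l \<Longrightarrow> e' i \<in> S"
    and inj: "\<And>i j. \<lbrakk>i < l; j < l; e i = e j \<or> e i = e' j \<or> e' i = e' j\<rbrakk> \<Longrightarrow> i = j"
  shows "(\<Sum>\<omega>\<in>Pow S. bern_mass S w \<omega> * ((\<Prod>i<l. of_bool (e i \<in> \<omega>) - p) * (\<Prod>i<l. of_bool (e' i \<in> \<omega>) - p)))
    = (\<Prod>i<l. pair_factor p w (e i) (e' i))"
proof -
  \<comment> \<open>\<open>g i f\<close> collects what position \<open>i\<close> contributes to the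
    edge \<open>f\<close> from either cycle, and \<open>h f\<close> multiplies over positions. This
    brings the product into the edgewise form of \<open>sum_bern_mass_prod\<close>.\<close>
  define g where "g i f b = (if e i = f then of_bool b - p else 1) * (if e' i = f then of_bool b - p else 1)" for i f b
  define h where "h f b = (\<Prod>i<l. g i f b)" for f b
  have single: "(\<Prod>f\<in>S. if a = f then (of_bool (f \<in> \<omega>) - p) else 1) = of_bool (a \<in> \<omega>) - p" if "a \<in> S" for a \<omega>
    using S(1) that by (simp add: prod.delta')
  have "(\<Prod>i<l. of_bool (e i \<in> \<omega>) - p) * (\<Prod>i<l. of_bool (e' i \<in> \<omega>) - p) = (\<Prod>f\<in>S. h f (f \<in> \<omega>))" for \<omega>
  proof -
    have "(\<Prod>f\<in>S. h f (f \<in> \<omega>)) = (\<Prod>i<l. \<Prod>f\<in>S. g i f (f \<in> \<omega>))" unfolding h_def by (rule prod.swap)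
    also have "\<dots> = (\<Prod>i<l. (of_bool (e i \<in> \<omega>) - p) * (of_bool (e' i \<in> \<omega>) - p))"
      using S single by (intro prod.cong refl) (simp add: g_def prod.distrib)
    finally show ?thesis by (simp add: prod.distrib)
  qed
  then have "(\<Sum>\<omega>\<in>Pow S. bern_mass S w \<omega> * ((\<Prod>i<l. of_bool (e i \<in> \<omega>) - p) * (\<Prod>i<l. of_bool (e' i \<in> \<omega>) - p)))
    = (\<Prod>f\<in>S. w f * h f True + (1 - w f) * h f False)"
    using sum_bern_mass_prod[OF S(1), of w h] by simp
  also have "\<dots> = (\<Prod>f\<in>(\<Union>i<l. {e i, e' i}). w f * h f True + (1 - w f) * h f False)"
  proof (rule prod.mono_neutral_right)
    show "\<forall>f\<in>S - (\<Union>i<l. {e i, e' i}). w f * h f True + (1 - w f) * h f False = 1"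
    proof
      fix f assume "f \<in> S - (\<Union>i<l. {e i, e' i})"
      then have "h f b = 1" for b unfolding h_def g_def by (intro prod.neutral) auto
      then show "w f * h f True + (1 - w f) * h f False = 1" by simp
    qed
  qed (use S in auto)
  also have "\<dots> = (\<Prod>i<l. \<Prod>f\<in>{e i, e' i}. w f * h f True + (1 - w f) * h f False)"
  proof (rule prod.UNION_disjoint)
    show "\<forall>i\<in>{..<l}. \<forall>j\<in>{..<l}. i \<noteq> j \<longrightarrow> {e i, e' i} \<inter> {e j, e' j} = {}"
    proof (intro ballI impI)
      fix i j assume "i \<in> {..<l}" "j \<in> {..<l}" "i \<noteq> j"
      then show "{e i, e' i} \<inter> {e j, e' j} = {}" using inj[of i j] inj[of j i] by auto
    qed
  qed auto
  also have "\<dots> = (\<Prod>i<l. pair_factor p w (e i) (e' i))"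
  proof (intro prod.cong refl)
    fix i assume i: "i \<in> {..<l}"
    have hf: "h f b = g i f b" if "f \<in> {e i, e' i}" for f b
    proof -
      have "(\<Prod>j\<in>{..<l} - {i}. g j f b) = 1"
      proof (rule prod.neutral, intro ballI)
        fix j assume "j \<in> {..<l} - {i}"
        then have "e j \<noteq> f" "e' j \<noteq> f" using that i inj[of i j] inj[of j i] by auto
        then show "g j f b = 1" by (simp add: g_def)
      qed
      then show ?thesis unfolding h_def using i by (subst prod.remove[of _ i]) auto
    qed
    show "(\<Prod>f\<in>{e i, e' i}. w f * h f True + (1 - w f) * h f False) = pair_factor p w (e i) (e' i)"
    proof (cases "e i = e' i")
      case True
      then show ?thesis using hf by (simp add: g_def pair_factor_def power2_eq_square)
    next
      case False
      then have "(\<Prod>f\<in>{e i, e' i}. w f * h f True + (1 - w f) * h f False)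
        = (w (e i) * (1 - p) + (1 - w (e i)) * (- p)) * (w (e' i) * (1 - p) + (1 - w (e' i)) * (- p))"
        using hf by (simp add: g_def)
      also have "\<dots> = (w (e i) - p) * (w (e' i) - p)" by (simp add: algebra_simps)
      finally show ?thesis using False by (simp add: pair_factor_def)
    qed
  qed
  finally show ?thesis .
qed

lemma sum_bern_mass_edges:
  fixes e :: "nat \<Rightarrow> 'e"
  assumes S: "finite S" "\<And>i. i < l \<Longrightarrow> e i \<in> S" and inj: "inj_on e {..<l}"
  shows "(\<Sum>\<omega>\<in>Pow S. bern_mass S w \<omega> * (\<Prod>i<l. of_bool (e i \<in> \<omega>) - p)) = (\<Prod>i<l. w (e i) - p)"
proof -
  define h where "h f b = (if f \<in> e ` {..<l} then of_bool b - p else 1)" for f b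
  have "(\<Prod>i<l. of_bool (e i \<in> \<omega>) - p) = (\<Prod>f\<in>S. h f (f \<in> \<omega>))" for \<omega>
  proof -
    have "(\<Prod>f\<in>S. h f (f \<in> \<omega>)) = (\<Prod>f\<in>e ` {..<l}. of_bool (f \<in> \<omega>) - p)"
      using S by (intro prod.mono_neutral_cong_right) (auto simp: h_def)
    then show ?thesis by (simp add: prod.reindex[OF inj])
  qed
  then have "(\<Sum>\<omega>\<in>Pow S. bern_mass S w \<omega> * (\<Prod>i<l. of_bool (e i \<in> \<omega>) - p)) = (\<Prod>f\<in>S. w f * h f True + (1 - w f) * h f False)"
    using sum_bern_mass_prod[OF S(1), of w h] by simp
  also have "\<dots> = (\<Prod>f\<in>e ` {..<l}. w f - p)"
    using S by (intro prod.mono_neutral_cong_right) (auto simp: h_def algebra_simps)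
  finally show ?thesis by (simp add: prod.reindex[OF inj])
qed

section \<open>Moments of single cycles and of pairs of cycles\<close>

definition cycle_mean :: "real \<Rightarrow> nat \<Rightarrow> nat \<Rightarrow> real" where
  "cycle_mean p d l = (\<integral>y. (\<Prod>i<l. signed_edge p d (y i) (y (Suc i mod l))) \<partial>PiM {..<l} (\<lambda>_. std_normal_vec d))"

text \<open>\<open>m\<close> is the block length and \<open>l\<close> the cycle length. The value
  \<open>q = 0\<close> is included, so the law of \<open>G(n, p)\<close> is an instance too.\<close>

locale cycle_count =
  fixes p :: real and d :: nat and q :: real and n l m :: nat
  assumes pq: "0 < p" "p < 1" "0 \<le> q" "q \<le> 1" and d: "1 \<le> d" and l: "l = 3 \<or> l = 4" and lm: "l * m \<le> n"
begin

abbreviation "N \<equiv> std_normal_vec d"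
abbreviation "L \<equiv> latent n d"
abbreviation "V \<equiv> {..<l} \<rightarrow>\<^sub>E {..<m}"

sublocale edge_mixture L "noisy_weight p d q" "vertex_pairs n" by (rule edge_mixture_noisy[OF pq])

sublocale N: prob_space N by (rule prob_space_std_normal_vec)

definition mean :: "(graph \<Rightarrow> real) \<Rightarrow> real" where
  "mean F = (\<Sum>\<omega>\<in>Pow (vertex_pairs n). F \<omega> * mix_mass L (noisy_weight p d q) (vertex_pairs n) \<omega>)"

lemma V_less: "v \<in> V \<Longrightarrow> i < l \<Longrightarrow> v i < m" by auto

lemma V_Pi: "v \<in> V \<Longrightarrow> v \<in> {..<l} \<rightarrow> {..<m}" by auto

lemma vertex_in:
  assumes "v \<in> V" "i < l" shows "cycle_vertex m i (v i) \<in> {1..n}"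
  using cycle_vertex_range[OF assms(2) V_less[OF assms] lm] by simp

lemma latent_edge_measurable:
  assumes "v \<in> V" "i < l"
  shows "(\<lambda>x. latent_edge p d l m x v i) \<in> borel_measurable L"
  unfolding latent_edge_def
  using vertex_in[OF assms] vertex_in[OF assms(1) Suc_mod_cycle(4)[OF l assms(2,2)]]
  by (intro borel_measurable_signed_edge_latent) auto

lemma abs_latent_edge: "\<bar>latent_edge p d l m x v i\<bar> \<le> 1"
  unfolding latent_edge_def by (rule abs_signed_edge_le[OF pq(1,2)])

definition factor :: "(nat \<Rightarrow> nat) \<Rightarrow> (nat \<Rightarrow> nat) \<Rightarrow> (nat \<Rightarrow> nat \<Rightarrow> real) \<Rightarrow> nat \<Rightarrow> real" where
  "factor v w x i = (if v i = w i \<and> v (Suc i mod l) = w (Suc i mod l)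
     then (p + q * latent_edge p d l m x v i) * (1 - p)\<^sup>2 + (1 - (p + q * latent_edge p d l m x v i)) * p\<^sup>2
     else q\<^sup>2 * (latent_edge p d l m x v i * latent_edge p d l m x w i))"

lemma factor_measurable:
  assumes "v \<in> V" "w \<in> V" "i < l"
  shows "(\<lambda>x. factor v w x i) \<in> borel_measurable L"
  unfolding factor_def using latent_edge_measurable[OF assms(1,3)] latent_edge_measurable[OF assms(2,3)] by measurable

lemma abs_factor:
  "\<bar>factor v w x i\<bar> \<le> (if v i = w i \<and> v (Suc i mod l) = w (Suc i mod l) then 1 else q\<^sup>2)"
proof (cases "v i = w i \<and> v (Suc i mod l) = w (Suc i mod l)")
  case True
  define u where "u = p + q * latent_edge p d l m x v i"
  have w: "0 \<le> u" "u \<le> 1"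
    using noisy_weight_bounds[OF pq, of d x "cycle_edge l m v i"] by (simp_all add: noisy_weight_cycle_edge u_def)
  have "(1 - p)\<^sup>2 \<le> 1" "p\<^sup>2 \<le> 1" using pq by (auto simp: abs_square_le_1)
  then have "u * (1 - p)\<^sup>2 + (1 - u) * p\<^sup>2 \<le> u * 1 + (1 - u) * 1" using w by (intro add_mono mult_left_mono) auto
  moreover have "0 \<le> u * (1 - p)\<^sup>2 + (1 - u) * p\<^sup>2" using w by (intro add_nonneg_nonneg mult_nonneg_nonneg) auto
  ultimately show ?thesis using True by (simp add: factor_def u_def[symmetric])
next
  case False
  have "\<bar>latent_edge p d l m x v i * latent_edge p d l m x w i\<bar> \<le> 1"
    using mult_mono[OF abs_latent_edge[of x v i] abs_latent_edge[of x w i]] by (simp add: abs_mult)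
  then have "q\<^sup>2 * \<bar>latent_edge p d l m x v i * latent_edge p d l m x w i\<bar> \<le> q\<^sup>2 * 1" by (intro mult_left_mono) auto
  moreover have "factor v w x i = q\<^sup>2 * (latent_edge p d l m x v i * latent_edge p d l m x w i)"
    unfolding factor_def by (rule if_not_P[OF False])
  ultimately show ?thesis unfolding if_not_P[OF False] by (simp add: abs_mult)
qed

lemma mean_conv:
  "mean F = (\<integral>x. (\<Sum>\<omega>\<in>Pow (vertex_pairs n). bern_mass (vertex_pairs n) (noisy_weight p d q x) \<omega> * F \<omega>) \<partial>L)"
  unfolding mean_def using sum_integral_bern[OF subset_refl, of F "Pow (vertex_pairs n)"] by (simp add: mult.commute)

lemma cycle_edge_inj: "v \<in> V \<Longrightarrow> inj_on (cycle_edge l m v) {..<l}"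
  using cycle_edge_inject[OF l V_Pi V_Pi] by (auto intro!: inj_onI)

lemma mean_signed_count:
  assumes v: "v \<in> V"
  shows "mean (signed_count p l m v) = q ^ l * (\<integral>x. (\<Prod>i<l. latent_edge p d l m x v i) \<partial>L)"
proof -
  have "(\<Sum>\<omega>\<in>Pow (vertex_pairs n). bern_mass (vertex_pairs n) (noisy_weight p d q x) \<omega> * signed_count p l m v \<omega>)
    = q ^ l * (\<Prod>i<l. latent_edge p d l m x v i)" for x
  proof -
    have "(\<Sum>\<omega>\<in>Pow (vertex_pairs n). bern_mass (vertex_pairs n) (noisy_weight p d q x) \<omega> * signed_count p l m v \<omega>)
      = (\<Prod>i<l. noisy_weight p d q x (cycle_edge l m v i) - p)"
      unfolding signed_count_def
      by (rule sum_bern_mass_edges[OF finite_vertex_pairs cycle_edge_in_vertex_pairs[OF l V_Pi[OF v] _ lm] cycle_edge_inj[OF v]])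
    also have "\<dots> = q ^ l * (\<Prod>i<l. latent_edge p d l m x v i)"
      by (simp add: noisy_weight_cycle_edge prod.distrib)
    finally show ?thesis .
  qed
  then show ?thesis unfolding mean_conv by simp
qed

lemma mean_signed_count_mult:
  assumes v: "v \<in> V" and w: "w \<in> V"
  shows "mean (\<lambda>\<omega>. signed_count p l m v \<omega> * signed_count p l m w \<omega>) = (\<integral>x. (\<Prod>i<l. factor v w x i) \<partial>L)"
proof -
  note inj = cycle_edge_inject[OF l V_Pi V_Pi]
  have "(\<Sum>\<omega>\<in>Pow (vertex_pairs n). bern_mass (vertex_pairs n) (noisy_weight p d q x) \<omega> * (signed_count p l m v \<omega> * signed_count p l m w \<omega>))
    = (\<Prod>i<l. factor v w x i)" for x
  proof -
    have "(\<Sum>\<omega>\<in>Pow (vertex_pairs n). bern_mass (vertex_pairs n) (noisy_weight p d q x) \<omega> * (signed_count p l m v \<omega> * signed_count p l m w \<omega>))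
      = (\<Prod>i<l. pair_factor p (noisy_weight p d q x) (cycle_edge l m v i) (cycle_edge l m w i))"
      unfolding signed_count_def
    proof (rule sum_bern_mass_pairs[OF finite_vertex_pairs])
      fix i j assume "i < l" "j < l" "cycle_edge l m v i = cycle_edge l m v j \<or> cycle_edge l m v i = cycle_edge l m w j \<or> cycle_edge l m w i = cycle_edge l m w j"
      then show "i = j" using inj[OF v v] inj[OF v w] inj[OF w w] by blast
    qed (use cycle_edge_in_vertex_pairs[OF l V_Pi _ lm] v w in auto)
    also have "\<dots> = (\<Prod>i<l. factor v w x i)"
    proof (intro prod.cong refl)
      fix i assume "i \<in> {..<l}"
      then have "cycle_edge l m v i = cycle_edge l m w i \<longleftrightarrow> v i = w i \<and> v (Suc i mod l) = w (Suc i mod l)"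
        using inj[OF v w, of i i] by simp
      then show "pair_factor p (noisy_weight p d q x) (cycle_edge l m v i) (cycle_edge l m w i) = factor v w x i"
        by (simp add: pair_factor_def factor_def noisy_weight_cycle_edge power2_eq_square)
    qed
    finally show ?thesis .
  qed
  then show ?thesis unfolding mean_conv by simp
qed

text \<open>A shared edge forces a shared first vertex, so factor \<open>i\<close> can be bounded
  through \<open>v i = w i\<close> alone. The weight is then a product over positions, which
  \<open>sum_overlap\<close> sums exactly.\<close>

definition overlap_weight :: "(nat \<Rightarrow> nat) \<Rightarrow> (nat \<Rightarrow> nat) \<Rightarrow> real" where
  "overlap_weight v w = (\<Prod>i<l. if v i = w i then 1 else q\<^sup>2)"

lemma abs_mean_signed_count_mult:
  assumes v: "v \<in> V" and w: "w \<in> V"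
  shows "\<bar>mean (\<lambda>\<omega>. signed_count p l m v \<omega> * signed_count p l m w \<omega>)\<bar> \<le> overlap_weight v w"
  unfolding mean_signed_count_mult[OF v w]
proof (rule abs_integral_le_bound[OF prob_M])
  have q1: "q\<^sup>2 \<le> 1" using pq by (simp add: abs_square_le_1)
  show "\<bar>\<Prod>i<l. factor v w x i\<bar> \<le> overlap_weight v w" for x
    unfolding abs_prod overlap_weight_def
  proof (rule prod_mono)
    show "0 \<le> \<bar>factor v w x i\<bar> \<and> \<bar>factor v w x i\<bar> \<le> (if v i = w i then 1 else q\<^sup>2)" for i
      using abs_factor[of v w x i] q1 by (auto split: if_splits)
  qed
qed

text \<open>The cycle visits distinct vertices, so its latent vectors are independent and the mean
  does not depend on \<open>v\<close>.\<close>

lemma integral_cycle: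
  assumes v: "v \<in> V"
  shows "(\<integral>x. (\<Prod>i<l. latent_edge p d l m x v i) \<partial>L) = cycle_mean p d l"
proof -
  let ?f = "\<lambda>i. cycle_vertex m i (v i)"
  let ?h = "\<lambda>y. \<Prod>i<l. signed_edge p d (y i) (y (Suc i mod l))"
  let ?P = "PiM {..<l} (\<lambda>_. N)"
  have inj: "inj_on ?f {..<l}" using V_less[OF v] by (auto intro!: inj_onI simp: cycle_vertex_inject)
  have dist: "distr L ?P (\<lambda>x. \<lambda>i\<in>{..<l}. x (?f i)) = ?P"
    using distr_PiM_reindex[of "{1..n}" "\<lambda>_. N" ?f "{..<l}"] inj vertex_in[OF v] N.prob_space_axioms by auto
  have hm: "?h \<in> borel_measurable ?P"
    using Suc_mod_cycle(4)[OF l]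
    by (intro borel_measurable_prod borel_measurable_signed_edge measurable_component_singleton) auto
  have fm: "(\<lambda>x. \<lambda>i\<in>{..<l}. x (?f i)) \<in> L \<rightarrow>\<^sub>M ?P"
    using vertex_in[OF v] by (intro measurable_restrict measurable_component_singleton) auto
  have "cycle_mean p d l = (\<integral>x. ?h (\<lambda>i\<in>{..<l}. x (?f i)) \<partial>L)"
    unfolding cycle_mean_def by (subst dist[symmetric]) (rule integral_distr[OF fm hm])
  also have "\<dots> = (\<integral>x. (\<Prod>i<l. latent_edge p d l m x v i) \<partial>L)"
    using Suc_mod_cycle(4)[OF l] by (intro Bochner_Integration.integral_cong refl prod.cong) (auto simp: latent_edge_def)
  finally show ?thesis by simp
qed

text \<open>Vertex-disjoint cycles are independent: resampling the vectors at the vertices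
  \<open>J\<close> of \<open>w\<close> leaves the factor of \<open>v\<close> alone and renews that
  of \<open>w\<close>. Such pairs therefore contribute nothing to the variance of the count.\<close>

lemma mean_disjoint:
  assumes v: "v \<in> V" and w: "w \<in> V" and dis: "\<And>i. i < l \<Longrightarrow> v i \<noteq> w i"
  shows "mean (\<lambda>\<omega>. signed_count p l m v \<omega> * signed_count p l m w \<omega>) = (q ^ l * cycle_mean p d l)\<^sup>2"
proof -
  let ?F = "\<lambda>x u. \<Prod>i<l. latent_edge p d l m x u i"
  define J where "J = (\<lambda>i. cycle_vertex m i (w i)) ` {..<l}"
  have Fm: "(\<lambda>x. ?F x u) \<in> borel_measurable L" if "u \<in> V" for u
    using latent_edge_measurable[OF that] by (intro borel_measurable_prod) auto
  have F1: "\<bar>?F x u\<bar> \<le> 1" for x u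
    unfolding abs_prod using abs_latent_edge by (intro prod_le_1) auto
  have "(\<Prod>i<l. factor v w x i) = (q ^ l)\<^sup>2 * (?F x v * ?F x w)" for x
  proof -
    have "(\<Prod>i<l. factor v w x i) = (\<Prod>i<l. q\<^sup>2 * (latent_edge p d l m x v i * latent_edge p d l m x w i))"
      using dis by (intro prod.cong refl) (auto simp: factor_def)
    then show ?thesis by (simp add: prod.distrib power_mult[symmetric] mult.commute)
  qed
  then have "mean (\<lambda>\<omega>. signed_count p l m v \<omega> * signed_count p l m w \<omega>) = (q ^ l)\<^sup>2 * (\<integral>x. ?F x v * ?F x w \<partial>L)"
    unfolding mean_signed_count_mult[OF v w] by simp
  also have "(\<integral>x. ?F x v * ?F x w \<partial>L)
    = (\<integral>x. \<integral>y. ?F (\<lambda>i. if i \<in> J then y i else x i) v * ?F (\<lambda>i. if i \<in> J then y i else x i) w \<partial>L \<partial>L)"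
  proof (rule integral_PiM_override[where C = 1])
    show "\<bar>?F x v * ?F x w\<bar> \<le> 1" for x using mult_mono[OF F1[of x v] F1[of x w]] by (simp add: abs_mult)
  qed (use Fm[OF v] Fm[OF w] N.prob_space_axioms in auto)
  also have "\<dots> = (\<integral>x. \<integral>y. ?F x v * ?F y w \<partial>L \<partial>L)"
  proof (intro Bochner_Integration.integral_cong refl)
    fix x y :: "nat \<Rightarrow> nat \<Rightarrow> real"
    note s = Suc_mod_cycle(4)[OF l]
    have "cycle_vertex m i (v i) \<notin> J" if "i < l" for i
      using that dis V_less[OF v] V_less[OF w] by (auto simp: J_def cycle_vertex_inject)
    then have "?F (\<lambda>i. if i \<in> J then y i else x i) v = ?F x v"
      using s by (intro prod.cong refl) (auto simp: latent_edge_def)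
    moreover have "?F (\<lambda>i. if i \<in> J then y i else x i) w = ?F y w"
      using s by (intro prod.cong refl) (auto simp: latent_edge_def J_def)
    ultimately show "?F (\<lambda>i. if i \<in> J then y i else x i) v * ?F (\<lambda>i. if i \<in> J then y i else x i) w = ?F x v * ?F y w" by simp
  qed
  also have "\<dots> = cycle_mean p d l * cycle_mean p d l" by (simp only: integral_mult_right_zero integral_mult_left_zero integral_cycle[OF v] integral_cycle[OF w])
  finally show ?thesis by (simp add: power2_eq_square mult_ac)
qed

end

lemma measurable_integral_update2:
  fixes H :: "('i \<Rightarrow> 'a) \<Rightarrow> real"
  assumes "i \<in> I" "j \<in> I" "prob_space N" "H \<in> borel_measurable (PiM I (\<lambda>_. N))"
  shows "(\<lambda>x. \<integral>b. \<integral>g. H (x(i := b, j := g)) \<partial>N \<partial>N) \<in> borel_measurable (PiM I (\<lambda>_. N))"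
proof -
  interpret N: prob_space N by fact
  have m: "(\<lambda>x. \<integral>g. H (x(j := g)) \<partial>N) \<in> borel_measurable (PiM I (\<lambda>_. N))"
    using measurable_compose[OF measurable_PiM_update[OF assms(2), of "\<lambda>_. N"] assms(4)]
    by (intro N.borel_measurable_lebesgue_integral) (simp add: case_prod_beta)
  show ?thesis
    using measurable_compose[OF measurable_PiM_update[OF assms(1), of "\<lambda>_. N"] m]
    by (intro N.borel_measurable_lebesgue_integral) (simp add: case_prod_beta)
qed

lemma four_cycle_mean_le:
  assumes d: "1 \<le> d" and p: "0 < p" "p < 1"
  shows "four_cycle_mean p d \<le> edge_rate p d 1"
proof -
  let ?N = "std_normal_vec d"
  interpret N: prob_space ?N by (rule prob_space_std_normal_vec)
  have comm: "signed_path p d x z = signed_path p d z x" for x z by (simp add: signed_path_def mult.commute)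
  have b: "\<bar>(signed_path p d x z)\<^sup>2\<bar> \<le> 1" for x z using abs_signed_path_le[OF p] by (simp add: abs_square_le_1)
  have "four_cycle_mean p d \<le> (\<integral>x. edge_rate p d 1 \<partial>?N)"
    unfolding four_cycle_mean_def
  proof (rule integral_mono)
    show "integrable ?N (\<lambda>x. \<integral>z. (signed_path p d x z)\<^sup>2 \<partial>?N)"
    proof (rule integrable_bounded_prob[OF N.prob_space_axioms, where C = 1])
      show "\<bar>\<integral>z. (signed_path p d x z)\<^sup>2 \<partial>?N\<bar> \<le> 1" for x by (rule abs_integral_le_bound[OF N.prob_space_axioms b])
    qed measurable
    show "(\<integral>z. (signed_path p d x z)\<^sup>2 \<partial>?N) \<le> edge_rate p d 1" if "x \<in> space ?N" for x
      using integral_signed_path_square[OF d p that] by (simp add: comm[of x])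
  qed simp
  then show ?thesis by (simp add: N.prob_space)
qed

lemma integral_signed_path_components:
  assumes p: "0 < p" "p < 1" and I: "finite I" "i \<in> I" "j \<in> I" "i \<noteq> j"
  shows "(\<integral>x. (signed_path p d (x i) (x j))\<^sup>2 \<partial>PiM I (\<lambda>_. std_normal_vec d)) = four_cycle_mean p d"
proof -
  let ?N = "std_normal_vec d"
  interpret N: prob_space ?N by (rule prob_space_std_normal_vec)
  interpret P: prob_space "PiM I (\<lambda>_. ?N)" by (rule prob_space_PiM) (rule prob_space_std_normal_vec)
  have b: "\<bar>(signed_path p d x z)\<^sup>2\<bar> \<le> 1" for x z using abs_signed_path_le[OF p] by (simp add: abs_square_le_1)
  have "(\<lambda>x. (signed_path p d (x i) (x j))\<^sup>2) \<in> borel_measurable (PiM I (\<lambda>_. ?N))"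
    using I by (intro borel_measurable_power borel_measurable_signed_path measurable_component_singleton) auto
  from integral_PiM_update2(1)[OF I(1-3) N.prob_space_axioms this b]
  show ?thesis using I(4) by (simp add: four_cycle_mean_def P.prob_space)
qed

text \<open>Integrating out the opposite vertices 1 and 3 leaves the square of the signed path
  kernel between 0 and 2.\<close>

lemma cycle_mean_4:
  assumes d: "1 \<le> d" and p: "0 < p" "p < 1"
  shows "cycle_mean p d 4 = four_cycle_mean p d"
proof -
  let ?N = "std_normal_vec d" and ?\<sigma> = "signed_edge p d"
  let ?P = "PiM {..<4 :: nat} (\<lambda>_. ?N)"
  interpret N: prob_space ?N by (rule prob_space_std_normal_vec)
  define H where "H y = (?\<sigma> (y 0) (y 1) * ?\<sigma> (y 2) (y 1)) * (?\<sigma> (y 0) (y 3) * ?\<sigma> (y 2) (y 3))" for y :: "nat \<Rightarrow> nat \<Rightarrow> real"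
  have s: "\<bar>?\<sigma> x y * ?\<sigma> z y\<bar> \<le> 1" for x y z
    using mult_mono[OF abs_signed_edge_le[OF p, of d x y] abs_signed_edge_le[OF p, of d z y]] by (simp add: abs_mult)
  have H1: "\<bar>H y\<bar> \<le> 1" for y
    unfolding H_def using mult_mono[OF s[of "y 0" "y 1" "y 2"] s[of "y 0" "y 3" "y 2"]] by (simp add: abs_mult)
  have Hm: "H \<in> borel_measurable ?P"
    unfolding H_def by (intro borel_measurable_times borel_measurable_signed_edge measurable_component_singleton) auto
  have "(\<Prod>i<4. ?\<sigma> (y i) (y (Suc i mod 4))) = H y" for y
  proof -
    define g where "g i = ?\<sigma> (y i) (y (Suc i mod 4))" for i
    have "(\<Prod>i<4. g i) = g 0 * g 1 * g 2 * g 3" by (simp add: eval_nat_numeral)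
    moreover have "g 0 = ?\<sigma> (y 0) (y 1)" "g 1 = ?\<sigma> (y 1) (y 2)" "g 2 = ?\<sigma> (y 2) (y 3)" "g 3 = ?\<sigma> (y 3) (y 0)"
      by (simp_all add: g_def numeral_2_eq_2[symmetric])
    ultimately have "(\<Prod>i<4. ?\<sigma> (y i) (y (Suc i mod 4))) = ?\<sigma> (y 0) (y 1) * ?\<sigma> (y 1) (y 2) * ?\<sigma> (y 2) (y 3) * ?\<sigma> (y 3) (y 0)"
      by (simp only: g_def)
    also have "\<dots> = H y"
      unfolding H_def signed_edge_commute[of p d "y 1" "y 2"] signed_edge_commute[of p d "y 3" "y 0"] by (simp only: mult_ac)
    finally show ?thesis .
  qed
  then have "cycle_mean p d 4 = (\<integral>y. H y \<partial>?P)" by (simp add: cycle_mean_def)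
  also have "\<dots> = (\<integral>y. \<integral>b. \<integral>g. H (y(1 := b, 3 := g)) \<partial>?N \<partial>?N \<partial>?P)"
    by (rule integral_PiM_update2(1)[OF _ _ _ N.prob_space_axioms Hm H1]) auto
  also have "\<dots> = (\<integral>y. (signed_path p d (y 0) (y 2))\<^sup>2 \<partial>?P)"
    by (simp add: H_def signed_path_def power2_eq_square)
  also have "\<dots> = four_cycle_mean p d"
    by (rule integral_signed_path_components[OF p]) auto
  finally show ?thesis .
qed

lemma cycle_mean_3:
  assumes p: "0 < p" "p < 1"
  shows "cycle_mean p d 3 = triangle_mean p d"
proof -
  let ?N = "std_normal_vec d" and ?\<sigma> = "signed_edge p d"
  let ?P = "PiM {..<3 :: nat} (\<lambda>_. ?N)"
  interpret N: prob_space ?N by (rule prob_space_std_normal_vec)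
  interpret P: prob_space ?P by (rule prob_space_PiM) (rule prob_space_std_normal_vec)
  note NP = N.prob_space_axioms
  define H where "H y = ?\<sigma> (y 1) (y 0) * ?\<sigma> (y 2) (y 0) * ?\<sigma> (y 1) (y 2)" for y :: "nat \<Rightarrow> nat \<Rightarrow> real"
  have H1: "\<bar>H y\<bar> \<le> 1" for y
  proof -
    note s = abs_signed_edge_le[OF p, of d]
    have "\<bar>?\<sigma> (y 1) (y 0) * ?\<sigma> (y 2) (y 0)\<bar> \<le> 1" using mult_mono[OF s s] by (simp add: abs_mult)
    then show ?thesis unfolding H_def
      using mult_mono[OF _ s, of "\<bar>?\<sigma> (y 1) (y 0) * ?\<sigma> (y 2) (y 0)\<bar>" 1 "y 1" "y 2"] by (simp add: abs_mult)
  qed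
  have Hm: "H \<in> borel_measurable ?P"
    unfolding H_def by (intro borel_measurable_times borel_measurable_signed_edge measurable_component_singleton) auto
  have "(\<Prod>i<3. ?\<sigma> (y i) (y (Suc i mod 3))) = H y" for y
  proof -
    define g where "g i = ?\<sigma> (y i) (y (Suc i mod 3))" for i
    have "(\<Prod>i<3. g i) = g 0 * g 1 * g 2" by (simp add: eval_nat_numeral)
    moreover have "g 0 = ?\<sigma> (y 0) (y 1)" "g 1 = ?\<sigma> (y 1) (y 2)" "g 2 = ?\<sigma> (y 2) (y 0)"
      by (simp_all add: g_def numeral_2_eq_2[symmetric])
    ultimately have "(\<Prod>i<3. ?\<sigma> (y i) (y (Suc i mod 3))) = ?\<sigma> (y 0) (y 1) * ?\<sigma> (y 1) (y 2) * ?\<sigma> (y 2) (y 0)"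
      by (simp only: g_def)
    also have "\<dots> = H y"
      unfolding H_def signed_edge_commute[of p d "y 0" "y 1"] by (simp only: mult_ac)
    finally show ?thesis .
  qed
  then have "cycle_mean p d 3 = (\<integral>y. H y \<partial>?P)" by (simp add: cycle_mean_def)
  also have "\<dots> = (\<integral>y. \<integral>b. \<integral>g. H (y(1 := b, 2 := g)) \<partial>?N \<partial>?N \<partial>?P)"
    by (rule integral_PiM_update2(1)[OF _ _ _ NP Hm H1]) auto
  also have "\<dots> = (\<integral>y. \<integral>a. \<integral>b. \<integral>g. H ((y(0 := a))(1 := b, 2 := g)) \<partial>?N \<partial>?N \<partial>?N \<partial>?P)"
  proof (rule integral_PiM_update[where C = 1])
    show "(\<lambda>y. \<integral>b. \<integral>g. H (y(1 := b, 2 := g)) \<partial>?N \<partial>?N) \<in> borel_measurable ?P"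
      by (rule measurable_integral_update2[OF _ _ NP Hm]) auto
    show "\<bar>\<integral>b. \<integral>g. H (y(1 := b, 2 := g)) \<partial>?N \<partial>?N\<bar> \<le> 1" for y
      by (intro abs_integral_le_bound[OF NP] H1)
  qed (auto intro: NP)
  also have "\<dots> = triangle_mean p d" by (simp add: H_def triangle_mean_def P.prob_space)
  finally show ?thesis .
qed

context cycle_count
begin

lemma overlap_weight_nonneg: "0 \<le> overlap_weight v w"
  unfolding overlap_weight_def by (intro prod_nonneg) auto

text \<open>If a vertex of one triangle does not belong to the other, then the two edges at this vertex and
  the two edges at its counterpart integrate to a product of two signed path counts.\<close>

lemma abs_mean_triangles:
  assumes l3: "l = 3" and v: "v \<in> V" and w: "w \<in> V" and ne: "v \<noteq> w"
  shows "\<bar>mean (\<lambda>\<omega>. signed_count p l m v \<omega> * signed_count p l m w \<omega>)\<bar> \<le> edge_rate p d 1 * overlap_weight v w"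
proof -
  have q1: "q\<^sup>2 \<le> 1" using pq by (simp add: abs_square_le_1)
  obtain i where i: "i < 3" "v i \<noteq> w i"
  proof -
    have "\<exists>i\<in>{..<l}. v i \<noteq> w i" using v w ne by (metis PiE_ext)
    then show ?thesis using that l3 by auto
  qed
  \<comment> \<open>The remaining positions in cyclic order: the edges at positions \<open>k\<close>
    and \<open>i\<close> meet vertex \<open>i\<close>, and the edge at position \<open>j\<close> is
    opposite to it.\<close>
  define j k where "j = Suc i mod 3" and "k = Suc j mod 3"
  have "i = 0 \<or> i = 1 \<or> i = 2" using i by auto
  then have ijk: "j < 3" "k < 3" "i \<noteq> j" "i \<noteq> k" "j \<noteq> k" "Suc k mod 3 = i" "{..<3} = {i, j, k}"
    by (auto simp: j_def k_def)
  have three: "(\<Prod>i<l. h i) = h i * (h j * h k)" for h :: "nat \<Rightarrow> real"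
    using ijk l3 by simp
  let ?\<sigma> = "signed_edge p d"
  let ?g = "signed_path p d"
  let ?v = "\<lambda>i. cycle_vertex m i (v i)" and ?w = "\<lambda>i. cycle_vertex m i (w i)"
  have less: "v i < m" "v j < m" "v k < m" "w i < m" "w j < m" "w k < m"
    using V_less[OF v] V_less[OF w] i ijk l3 by auto
  have inI: "?v i \<in> {1..n}" "?v j \<in> {1..n}" "?v k \<in> {1..n}" "?w i \<in> {1..n}" "?w j \<in> {1..n}" "?w k \<in> {1..n}"
    using vertex_in[OF v] vertex_in[OF w] i ijk l3 by auto
  have neq: "?v i \<noteq> ?w i" "?v j \<noteq> ?v i" "?v k \<noteq> ?v i" "?w j \<noteq> ?v i" "?w k \<noteq> ?v i"
    "?v j \<noteq> ?w i" "?v k \<noteq> ?w i" "?w j \<noteq> ?w i" "?w k \<noteq> ?w i" "?v j \<noteq> ?v k" "?w j \<noteq> ?w k"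
    using less i ijk by (simp_all add: cycle_vertex_inject)
  define H where "H x = (\<Prod>i<l. factor v w x i)" for x
  define \<phi> where "\<phi> x = factor v w x j" for x
  define t where "t = (if v j = w j \<and> v k = w k then 1 else q\<^sup>2)"
  have \<phi>: "\<bar>\<phi> x\<bar> \<le> t" for x
    using abs_factor[of v w x j] l3 by (simp add: \<phi>_def t_def k_def)
  have t: "0 \<le> t" by (simp add: t_def)
  have Hm: "H \<in> borel_measurable L"
    unfolding H_def using factor_measurable[OF v w] by (intro borel_measurable_prod) auto
  have \<phi>m: "\<phi> \<in> borel_measurable L" unfolding \<phi>_def using factor_measurable[OF v w] ijk l3 by auto
  have H1: "\<bar>H x\<bar> \<le> 1" for x
    unfolding H_def abs_prod
  proof (rule prod_le_1)
    show "0 \<le> \<bar>factor v w x i\<bar> \<and> \<bar>factor v w x i\<bar> \<le> 1" for i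
      using abs_factor[of v w x i] q1 by (auto split: if_splits)
  qed
  have upd: "H (x(?v i := \<alpha>, ?w i := \<beta>))
    = q ^ 4 * \<phi> x * ((?\<sigma> (x (?v j)) \<alpha> * ?\<sigma> (x (?v k)) \<alpha>) * (?\<sigma> (x (?w j)) \<beta> * ?\<sigma> (x (?w k)) \<beta>))" for x \<alpha> \<beta>
  proof -
    let ?x = "x(?v i := \<alpha>, ?w i := \<beta>)"
    have x: "?x (?v i) = \<alpha>" "?x (?w i) = \<beta>" "?x (?v j) = x (?v j)" "?x (?v k) = x (?v k)" "?x (?w j) = x (?w j)" "?x (?w k) = x (?w k)"
      using neq by auto
    have nfi: "\<not> (v i = w i \<and> v (Suc i mod l) = w (Suc i mod l))" "\<not> (v k = w k \<and> v (Suc k mod l) = w (Suc k mod l))"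
      using i ijk l3 by auto
    have fi: "factor v w ?x i = q\<^sup>2 * (?\<sigma> \<alpha> (x (?v j)) * ?\<sigma> \<beta> (x (?w j)))"
      unfolding factor_def if_not_P[OF nfi(1)] using x l3 by (simp add: latent_edge_def j_def[symmetric])
    have fk: "factor v w ?x k = q\<^sup>2 * (?\<sigma> (x (?v k)) \<alpha> * ?\<sigma> (x (?w k)) \<beta>)"
      unfolding factor_def if_not_P[OF nfi(2)] using x l3 ijk by (simp add: latent_edge_def)
    have fj: "factor v w ?x j = \<phi> x"
      unfolding factor_def \<phi>_def using x l3 by (simp add: latent_edge_def k_def[symmetric])
    have "H ?x = (q\<^sup>2 * q\<^sup>2) * \<phi> x * ((?\<sigma> (x (?v j)) \<alpha> * ?\<sigma> (x (?v k)) \<alpha>) * (?\<sigma> (x (?w j)) \<beta> * ?\<sigma> (x (?w k)) \<beta>))"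
      unfolding H_def three fi fj fk by (simp add: signed_edge_commute[of p d \<alpha>] signed_edge_commute[of p d \<beta>] mult_ac)
    then show ?thesis by (simp flip: power_add)
  qed
  have "mean (\<lambda>\<omega>. signed_count p l m v \<omega> * signed_count p l m w \<omega>) = (\<integral>x. H x \<partial>L)"
    unfolding mean_signed_count_mult[OF v w] H_def ..
  also have "\<dots> = (\<integral>x. \<integral>\<alpha>. \<integral>\<beta>. H (x(?v i := \<alpha>, ?w i := \<beta>)) \<partial>N \<partial>N \<partial>L)"
    by (rule integral_PiM_update2(1)[OF _ inI(1,4) N.prob_space_axioms Hm H1]) simp
  also have "\<dots> = (\<integral>x. q ^ 4 * \<phi> x * (?g (x (?v j)) (x (?v k)) * ?g (x (?w j)) (x (?w k))) \<partial>L)"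
    unfolding upd by (simp add: signed_path_def)
  finally have eq: "mean (\<lambda>\<omega>. signed_count p l m v \<omega> * signed_count p l m w \<omega>)
    = (\<integral>x. q ^ 4 * \<phi> x * (?g (x (?v j)) (x (?v k)) * ?g (x (?w j)) (x (?w k))) \<partial>L)" .
  have gm: "(\<lambda>x. (?g (x a) (x b))\<^sup>2) \<in> borel_measurable L" "(\<lambda>x. ?g (x a) (x b)) \<in> borel_measurable L"
    if "a \<in> {1..n}" "b \<in> {1..n}" for a b
    using that by (auto intro!: borel_measurable_power borel_measurable_signed_path measurable_component_singleton)
  have g2: "integrable L (\<lambda>x. (?g (x a) (x b))\<^sup>2)" if "a \<in> {1..n}" "b \<in> {1..n}" for a b
    by (rule integrable_bounded_prob[OF prob_M gm(1)[OF that], where C = 1])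
       (use abs_signed_path_le[OF pq(1,2)] in \<open>simp add: abs_square_le_1\<close>)
  \<comment> \<open>The product of two path kernels is replaced by the mean of their squares, each
    of which integrates to \<open>four_cycle_mean p d\<close>.\<close>
  have le: "\<bar>q ^ 4 * \<phi> x * (?g (x (?v j)) (x (?v k)) * ?g (x (?w j)) (x (?w k)))\<bar>
    \<le> q ^ 4 * t * (((?g (x (?v j)) (x (?v k)))\<^sup>2 + (?g (x (?w j)) (x (?w k)))\<^sup>2) / 2)" for x
  proof -
    have "\<bar>?g (x (?v j)) (x (?v k)) * ?g (x (?w j)) (x (?w k))\<bar>
      \<le> ((?g (x (?v j)) (x (?v k)))\<^sup>2 + (?g (x (?w j)) (x (?w k)))\<^sup>2) / 2"
      using abs_mult_le_squares[of 1] by simp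
    moreover have "\<bar>q ^ 4 * \<phi> x\<bar> \<le> q ^ 4 * t"
      using mult_left_mono[OF \<phi>[of x], of "q ^ 4"] by (simp add: abs_mult)
    ultimately show ?thesis unfolding abs_mult[of "q ^ 4 * \<phi> x"] using t by (intro mult_mono) auto
  qed
  have ri: "integrable L (\<lambda>x. q ^ 4 * t * (((?g (x (?v j)) (x (?v k)))\<^sup>2 + (?g (x (?w j)) (x (?w k)))\<^sup>2) / 2))"
    using g2[OF inI(2,3)] g2[OF inI(5,6)] by auto
  have "\<bar>\<integral>x. q ^ 4 * \<phi> x * (?g (x (?v j)) (x (?v k)) * ?g (x (?w j)) (x (?w k))) \<partial>L\<bar>
    \<le> (\<integral>x. \<bar>q ^ 4 * \<phi> x * (?g (x (?v j)) (x (?v k)) * ?g (x (?w j)) (x (?w k)))\<bar> \<partial>L)"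
    by (rule integral_abs_bound)
  also have "\<dots> \<le> (\<integral>x. q ^ 4 * t * (((?g (x (?v j)) (x (?v k)))\<^sup>2 + (?g (x (?w j)) (x (?w k)))\<^sup>2) / 2) \<partial>L)"
  proof (rule integral_mono[OF _ ri le])
    have "(\<lambda>x. q ^ 4 * \<phi> x * (?g (x (?v j)) (x (?v k)) * ?g (x (?w j)) (x (?w k)))) \<in> borel_measurable L"
      using \<phi>m gm(2)[OF inI(2,3)] gm(2)[OF inI(5,6)] by measurable
    then show "integrable L (\<lambda>x. \<bar>q ^ 4 * \<phi> x * (?g (x (?v j)) (x (?v k)) * ?g (x (?w j)) (x (?w k)))\<bar>)"
      by (intro Bochner_Integration.integrable_bound[OF ri]) (use le in \<open>auto intro: order_trans[OF _ abs_ge_self]\<close>)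
  qed
  also have "\<dots> = q ^ 4 * t * four_cycle_mean p d"
    using g2[OF inI(2,3)] g2[OF inI(5,6)] integral_signed_path_components[OF pq(1,2) _ inI(2,3) neq(10), of d]
      integral_signed_path_components[OF pq(1,2) _ inI(5,6) neq(11), of d]
    by (simp del: One_nat_def)
  also have "\<dots> \<le> q ^ 4 * t * edge_rate p d 1"
    using four_cycle_mean_le[OF d pq(1,2)] t by (intro mult_left_mono) auto
  also have "\<dots> \<le> overlap_weight v w * edge_rate p d 1"
  proof (rule mult_right_mono)
    \<comment> \<open>Position \<open>i\<close> contributes \<open>q\<^sup>2\<close>. If the
      endpoints of the opposite edge are both shared, \<open>t = 1\<close> and the weight is
      \<open>q\<^sup>2\<close>; otherwise \<open>t = q\<^sup>2\<close> and the weight is at least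
      \<open>q ^ 6\<close>.\<close>
    have "overlap_weight v w = q\<^sup>2 * ((if v j = w j then 1 else q\<^sup>2) * (if v k = w k then 1 else q\<^sup>2))"
      unfolding overlap_weight_def three using i by simp
    moreover have "q ^ 4 = q\<^sup>2 * q\<^sup>2" by (simp flip: power_add)
    moreover have "q\<^sup>2 * (q\<^sup>2 * 1) \<le> q\<^sup>2 * (1 * 1)" using q1 by (intro mult_left_mono) auto
    moreover have "q ^ 6 \<le> q ^ 4" using pq by (intro power_decreasing) auto
    ultimately show "q ^ 4 * t \<le> overlap_weight v w" by (auto simp: t_def)
  qed (rule edge_rate_bounds(3)[OF pq(1,2)])
  finally show ?thesis unfolding eq by (simp add: mult.commute)
qed

section \<open>Second moment of the cycle count\<close>

lemma sum_overlap:
  assumes v: "v \<in> V"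
  shows "(\<Sum>w\<in>V. \<Prod>i<l. if v i = w i then a else b) = (a + (real m - 1) * b) ^ l"
proof -
  have "(\<Sum>w\<in>V. \<Prod>i<l. if v i = w i then a else b) = (\<Prod>i<l. \<Sum>y<m. if v i = y then a else b)"
    by (rule prod_sum_PiE[symmetric]) auto
  also have "\<dots> = (\<Prod>i<l. a + (real m - 1) * b)"
  proof (intro prod.cong refl)
    fix i assume "i \<in> {..<l}"
    then have vi: "v i < m" using V_less[OF v] by simp
    then have "(\<Sum>y<m. if v i = y then a else b) = a + (\<Sum>y\<in>{..<m} - {v i}. b)"
      by (subst sum.remove[of _ "v i"]) (auto intro!: sum.cong)
    then show "(\<Sum>y<m. if v i = y then a else b) = a + (real m - 1) * b" using vi by (simp add: of_nat_diff)
  qed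
  finally show ?thesis by simp
qed

definition count :: "graph \<Rightarrow> real" where
  "count \<omega> = (\<Sum>v\<in>V. signed_count p l m v \<omega>)"

lemma finite_V: "finite V" by (intro finite_PiE) auto

lemma card_V: "real (card V) = real m ^ l" by (simp add: card_PiE)

lemma mean_sum: "mean (\<lambda>\<omega>. \<Sum>a\<in>A. F a \<omega>) = (\<Sum>a\<in>A. mean (F a))"
  unfolding mean_def sum_distrib_right by (rule sum.swap)

lemma mean_count: "mean count = real m ^ l * (q ^ l * cycle_mean p d l)"
proof -
  have "mean count = (\<Sum>v\<in>V. q ^ l * cycle_mean p d l)"
    unfolding count_def[abs_def] mean_sum by (intro sum.cong refl) (simp only: mean_signed_count integral_cycle)
  then show ?thesis by (simp add: card_V[symmetric])
qed

text \<open>Vertex-disjoint pairs reproduce the squared mean, the diagonal accounts for the final 1,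
  and the remaining pairs share at least one vertex. Their total overlap is at most a difference of
  \<open>l\<close>-th powers, whence only the exponent \<open>l - 1\<close> of
  \<open>1 + m * q\<^sup>2\<close>. The factor \<open>B\<close> allows for extra decorrelation of
  distinct cycles.\<close>

lemma mean_count_square:
  assumes B: "0 \<le> B" "\<And>v w. \<lbrakk>v \<in> V; w \<in> V; v \<noteq> w\<rbrakk> \<Longrightarrow>
      \<bar>mean (\<lambda>\<omega>. signed_count p l m v \<omega> * signed_count p l m w \<omega>)\<bar> \<le> B * overlap_weight v w"
    and m: "1 \<le> m"
  shows "mean (\<lambda>\<omega>. (count \<omega>)\<^sup>2)
    \<le> (mean count)\<^sup>2 + real m ^ l * (B * (real l * (1 + real m * q\<^sup>2) ^ (l - 1)) + 1)"
proof -
  define \<mu> where "\<mu> = q ^ l * cycle_mean p d l"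
  let ?M = "\<lambda>v w. mean (\<lambda>\<omega>. signed_count p l m v \<omega> * signed_count p l m w \<omega>)"
  \<comment> \<open>\<open>?z v w\<close> equals the overlap weight for vertex-disjoint pairs and is
    0 for all others. Subtracting it confines the weight to pairs that meet.\<close>
  let ?z = "\<lambda>v w. \<Prod>i<l. if v i = w i then 0 else q\<^sup>2"
  have zle: "?z v w \<le> overlap_weight v w" for v w
    unfolding overlap_weight_def by (intro prod_mono) auto
  have pt: "?M v w \<le> \<mu>\<^sup>2 + (B * (overlap_weight v w - ?z v w) + of_bool (v = w))" if vw: "v \<in> V" "w \<in> V" for v w
  proof (cases "\<forall>i<l. v i \<noteq> w i")
    case True
    then have "?M v w = \<mu>\<^sup>2" unfolding \<mu>_def using mean_disjoint[OF vw] by simp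
    moreover have "0 \<le> B * (overlap_weight v w - ?z v w)" using B zle[of v w] by simp
    ultimately show ?thesis by simp
  next
    case False
    then have z: "?z v w = 0" by auto
    show ?thesis
    proof (cases "v = w")
      case True
      have "overlap_weight v v = 1" by (simp add: overlap_weight_def)
      then have "?M v w \<le> 1" using abs_mean_signed_count_mult[OF vw] True by simp
      moreover have "0 \<le> \<mu>\<^sup>2 + B * overlap_weight v w" using B overlap_weight_nonneg by simp
      ultimately show ?thesis unfolding z using True by simp
    next
      case False
      then have "?M v w \<le> B * overlap_weight v w" using B(2)[OF vw] by simp
      moreover have "0 \<le> \<mu>\<^sup>2" by simp
      ultimately have "?M v w \<le> \<mu>\<^sup>2 + B * overlap_weight v w" by linarith
      then show ?thesis unfolding z using False by simp
    qed
  qed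
  have "mean (\<lambda>\<omega>. (count \<omega>)\<^sup>2) = (\<Sum>v\<in>V. \<Sum>w\<in>V. ?M v w)"
    unfolding count_def power2_eq_square sum_product mean_sum ..
  also have "\<dots> \<le> (\<Sum>v\<in>V. \<Sum>w\<in>V. \<mu>\<^sup>2 + (B * (overlap_weight v w - ?z v w) + of_bool (v = w)))"
    by (intro sum_mono pt)
  also have "\<dots> = (\<Sum>v\<in>V. real m ^ l * \<mu>\<^sup>2 + B * ((1 + (real m - 1) * q\<^sup>2) ^ l - ((real m - 1) * q\<^sup>2) ^ l) + 1)"
  proof (intro sum.cong refl)
    fix v assume v: "v \<in> V"
    have "(\<Sum>w\<in>V. overlap_weight v w) = (1 + (real m - 1) * q\<^sup>2) ^ l"
      unfolding overlap_weight_def by (rule sum_overlap[OF v])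
    moreover have "(\<Sum>w\<in>V. ?z v w) = ((real m - 1) * q\<^sup>2) ^ l" using sum_overlap[OF v, of 0 "q\<^sup>2"] by simp
    moreover have "(\<Sum>w\<in>V. of_bool (v = w)) = (1 :: real)"
      using v finite_V by (simp add: of_bool_def sum.delta')
    ultimately show "(\<Sum>w\<in>V. \<mu>\<^sup>2 + (B * (overlap_weight v w - ?z v w) + of_bool (v = w)))
      = real m ^ l * \<mu>\<^sup>2 + B * ((1 + (real m - 1) * q\<^sup>2) ^ l - ((real m - 1) * q\<^sup>2) ^ l) + 1"
      by (simp add: sum.distrib sum_subtractf card_V flip: sum_distrib_left)
  qed
  also have "\<dots> = real m ^ l * (real m ^ l * \<mu>\<^sup>2 + B * ((1 + (real m - 1) * q\<^sup>2) ^ l - ((real m - 1) * q\<^sup>2) ^ l) + 1)"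
    by (simp only: sum_constant card_V)
  also have "\<dots> \<le> real m ^ l * (real m ^ l * \<mu>\<^sup>2 + B * (real l * (1 + real m * q\<^sup>2) ^ (l - 1)) + 1)"
  proof (intro mult_left_mono add_mono order_refl)
    define a where "a = (real m - 1) * q\<^sup>2"
    have a: "0 \<le> a" "a \<le> real m * q\<^sup>2" using m by (auto simp: a_def intro!: mult_right_mono)
    have "(1 + a) ^ l - a ^ l = (1 + a - a) * (\<Sum>i<l. a ^ (l - Suc i) * (1 + a) ^ i)"
      by (rule power_diff_sumr2)
    also have "\<dots> \<le> (\<Sum>i<l. (1 + a) ^ (l - Suc i) * (1 + a) ^ i)"
      using a by (simp, intro sum_mono mult_right_mono power_mono) auto
    also have "\<dots> = (\<Sum>i<l. (1 + a) ^ (l - 1))"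
      by (intro sum.cong refl) (simp flip: power_add)
    also have "\<dots> = real l * (1 + a) ^ (l - 1)" by simp
    also have "\<dots> \<le> real l * (1 + real m * q\<^sup>2) ^ (l - 1)" using a by (intro mult_left_mono power_mono) auto
    finally show "(1 + (real m - 1) * q\<^sup>2) ^ l - ((real m - 1) * q\<^sup>2) ^ l \<le> real l * (1 + real m * q\<^sup>2) ^ (l - 1)"
      by (simp add: a_def)
  qed (use B in auto)
  also have "\<dots> = (mean count)\<^sup>2 + real m ^ l * (B * (real l * (1 + real m * q\<^sup>2) ^ (l - 1)) + 1)"
    unfolding mean_count \<mu>_def[symmetric] by (simp add: power_mult_distrib power2_eq_square[of "real m ^ l"] algebra_simps)
  finally show ?thesis .
qed

lemma mean_markov:
  assumes F: "\<And>\<omega>. 0 \<le> F \<omega>" and A: "\<And>\<omega>. \<omega> \<in> A \<Longrightarrow> t \<le> F \<omega>"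
  shows "t * measure (noisy_rgg n p d q) A \<le> mean F"
proof -
  have "t * measure (noisy_rgg n p d q) A = (\<Sum>\<omega>\<in>A \<inter> Pow (vertex_pairs n). t * mix_mass L (noisy_weight p d q) (vertex_pairs n) \<omega>)"
    by (simp add: measure_noisy_rgg[OF pq] sum_distrib_left)
  also have "\<dots> \<le> (\<Sum>\<omega>\<in>A \<inter> Pow (vertex_pairs n). F \<omega> * mix_mass L (noisy_weight p d q) (vertex_pairs n) \<omega>)"
    using A mix_nonneg[OF subset_refl] by (intro sum_mono mult_right_mono) auto
  also have "\<dots> \<le> mean F"
    unfolding mean_def using F mix_nonneg[OF subset_refl] by (intro sum_mono2) (auto simp: finite_vertex_pairs)
  finally show ?thesis .
qed

lemma mean_variance:
  "mean (\<lambda>\<omega>. (F \<omega> - mean F)\<^sup>2) = mean (\<lambda>\<omega>. (F \<omega>)\<^sup>2) - (mean F)\<^sup>2"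
proof -
  let ?Q = "mix_mass L (noisy_weight p d q) (vertex_pairs n)"
  have "mean (\<lambda>\<omega>. (F \<omega> - mean F)\<^sup>2) = (\<Sum>\<omega>\<in>Pow (vertex_pairs n). (F \<omega>)\<^sup>2 * ?Q \<omega> - 2 * mean F * (F \<omega> * ?Q \<omega>) + (mean F)\<^sup>2 * ?Q \<omega>)"
    unfolding mean_def[of "\<lambda>\<omega>. (F \<omega> - mean F)\<^sup>2"] by (intro sum.cong refl) (simp add: power2_diff algebra_simps)
  also have "\<dots> = mean (\<lambda>\<omega>. (F \<omega>)\<^sup>2) - 2 * mean F * mean F + (mean F)\<^sup>2 * 1"
    unfolding sum_mix[OF subset_refl, symmetric] mean_def
    by (simp only: sum.distrib sum_subtractf sum_distrib_left)
  finally show ?thesis by (simp add: power2_eq_square)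
qed

end

subsection \<open>Possibility\<close>

lemma measure_noisy_rgg_0:
  assumes "0 < p" "p < 1"
  shows "measure (noisy_rgg n p d 0) A = measure (erdos_renyi n p) A"
proof -
  interpret edge_mixture "latent n d" "noisy_weight p d 0" "vertex_pairs n" by (rule edge_mixture_noisy) (use assms in auto)
  have "noisy_weight p d 0 x = (\<lambda>_. p)" for x by (simp add: fun_eq_iff noisy_weight_def)
  then have "mix_mass (latent n d) (noisy_weight p d 0) S \<omega> = bern_mass S (\<lambda>_. p) \<omega>" for S \<omega>
    unfolding mix_mass_def using prob_space by simp
  then show ?thesis using assms by (simp add: measure_noisy_rgg measure_erdos_renyi)
qed

text \<open>Chebyshev's inequality under both laws for the number of signed cycles, with the threshold at
  half of its mean.\<close>

lemma total_variation_ge: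
  assumes pq: "0 < p" "p < 1" "0 < q" "q \<le> 1" and d: "1 \<le> d" and l: "l = 3 \<or> l = 4" and lm: "l * m \<le> n" "1 \<le> m"
    and \<mu>: "0 < cycle_mean p d l"
    and B: "0 \<le> B" "l = 4 \<Longrightarrow> B = 1" "l = 3 \<Longrightarrow> B = edge_rate p d 1"
  shows "1 - total_variation (erdos_renyi n p) (noisy_rgg n p d q)
    \<le> 4 * (B * (real l * (1 + real m * q\<^sup>2) ^ (l - 1)) + 2) / ((real m * q\<^sup>2) ^ l * (cycle_mean p d l)\<^sup>2)"
proof -
  interpret A: cycle_count p d q n l m by unfold_locales (use pq d l lm in auto)
  \<comment> \<open>The same statistic under \<open>G(n, p)\<close>: with \<open>q = 0\<close> all
    conditional edge probabilities equal \<open>p\<close>.\<close>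
  interpret Z: cycle_count p d 0 n l m by unfold_locales (use pq d l lm in auto)
  define T where "T = A.count"
  have TZ: "Z.count = T" by (simp add: T_def A.count_def[abs_def] Z.count_def[abs_def])
  define E where "E = real m ^ l * (q ^ l * cycle_mean p d l)"
  have E: "0 < E" using pq lm \<mu> by (simp add: E_def)
  have mA: "A.mean T = E" unfolding T_def E_def by (rule A.mean_count)
  define b where "b = B * (real l * (1 + real m * q\<^sup>2) ^ (l - 1))"
  have var: "A.mean (\<lambda>\<omega>. (T \<omega> - E)\<^sup>2) \<le> real m ^ l * (b + 1)"
  proof -
    have "A.mean (\<lambda>\<omega>. (T \<omega>)\<^sup>2) \<le> (A.mean T)\<^sup>2 + real m ^ l * (b + 1)"
      unfolding T_def b_def
    proof (rule A.mean_count_square[OF B(1) _ lm(2)])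
      fix v w assume vw: "v \<in> A.V" "w \<in> A.V" "v \<noteq> w"
      show "\<bar>A.mean (\<lambda>\<omega>. signed_count p l m v \<omega> * signed_count p l m w \<omega>)\<bar> \<le> B * A.overlap_weight v w"
        using l
      proof
        assume "l = 3" then show ?thesis using A.abs_mean_triangles[OF _ vw] B(3) by simp
      next
        assume "l = 4" then show ?thesis using A.abs_mean_signed_count_mult[OF vw(1,2)] B(2) by simp
      qed
    qed
    then show ?thesis using A.mean_variance[of T] mA by simp
  qed
  have null: "Z.mean (\<lambda>\<omega>. (T \<omega>)\<^sup>2) \<le> real m ^ l"
  proof -
    have l0: "0 < l" using l by auto
    have "Z.mean (\<lambda>\<omega>. (Z.count \<omega>)\<^sup>2) \<le> (Z.mean Z.count)\<^sup>2 + real m ^ l * (0 * (real l * (1 + real m * 0\<^sup>2) ^ (l - 1)) + 1)"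
    \<comment> \<open>For \<open>q = 0\<close> the overlap weight of distinct cycles is 0, so
      \<open>B = 0\<close> is admissible and only the diagonal remains.\<close>
    proof (rule Z.mean_count_square[OF order_refl _ lm(2)])
      fix v w assume vw: "v \<in> Z.V" "w \<in> Z.V" "v \<noteq> w"
      have "\<exists>i\<in>{..<l}. v i \<noteq> w i" using vw by (metis PiE_ext)
      then have "Z.overlap_weight v w = 0" by (auto simp: Z.overlap_weight_def)
      then show "\<bar>Z.mean (\<lambda>\<omega>. signed_count p l m v \<omega> * signed_count p l m w \<omega>)\<bar> \<le> 0 * Z.overlap_weight v w"
        using Z.abs_mean_signed_count_mult[OF vw(1,2)] by simp
    qed
    moreover have "Z.mean Z.count = 0" unfolding Z.mean_count using l0 by simp
    ultimately show ?thesis by (simp add: TZ)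
  qed
  let ?A = "{\<omega>. E / 2 \<le> T \<omega>}"
  have PZ: "(E / 2)\<^sup>2 * measure (erdos_renyi n p) ?A \<le> real m ^ l"
  proof -
    have "(E / 2)\<^sup>2 * measure (noisy_rgg n p d 0) ?A \<le> Z.mean (\<lambda>\<omega>. (T \<omega>)\<^sup>2)"
      using E by (intro Z.mean_markov) (auto intro: power_mono)
    then show ?thesis using null measure_noisy_rgg_0[OF pq(1,2)] by simp
  qed
  have PA: "(E / 2)\<^sup>2 * (1 - measure (noisy_rgg n p d q) ?A) \<le> real m ^ l * (b + 1)"
  proof -
    have "(E / 2)\<^sup>2 * measure (noisy_rgg n p d q) (- ?A) \<le> A.mean (\<lambda>\<omega>. (T \<omega> - E)\<^sup>2)"
    proof (rule A.mean_markov)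
      fix \<omega> assume "\<omega> \<in> - ?A"
      then have "(E / 2)\<^sup>2 \<le> (E - T \<omega>)\<^sup>2" using E by (intro power_mono) auto
      then show "(E / 2)\<^sup>2 \<le> (T \<omega> - E)\<^sup>2" by (simp add: power2_commute)
    qed simp
    then show ?thesis using var total_variation_bounds(4)[OF pq(1,2) less_imp_le[OF pq(3)] pq(4), of n d ?A] by simp
  qed
  have "1 - total_variation (erdos_renyi n p) (noisy_rgg n p d q) \<le> measure (erdos_renyi n p) ?A + (1 - measure (noisy_rgg n p d q) ?A)"
    using total_variation_bounds(3)[OF pq(1,2) less_imp_le[OF pq(3)] pq(4), of n ?A d] by linarith
  then have "(E / 2)\<^sup>2 * (1 - total_variation (erdos_renyi n p) (noisy_rgg n p d q))
    \<le> (E / 2)\<^sup>2 * (measure (erdos_renyi n p) ?A + (1 - measure (noisy_rgg n p d q) ?A))"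
    by (intro mult_left_mono) auto
  also have "\<dots> \<le> real m ^ l * (b + 2)" using PZ PA by (simp add: algebra_simps)
  finally have "1 - total_variation (erdos_renyi n p) (noisy_rgg n p d q) \<le> real m ^ l * (b + 2) / (E / 2)\<^sup>2"
    using E by (simp add: pos_le_divide_eq mult.commute)
  also have "\<dots> = 4 * (b + 2) / ((real m * q\<^sup>2) ^ l * (cycle_mean p d l)\<^sup>2)"
  proof -
    \<comment> \<open>The squared mean divided by the null variance \<open>m ^ l\<close> is
      \<open>(m * q\<^sup>2) ^ l\<close> times the squared cycle mean, which makes
      \<open>m * q\<^sup>2\<close> the natural parameter.\<close>
    have "E\<^sup>2 = real m ^ l * ((real m * q\<^sup>2) ^ l * (cycle_mean p d l)\<^sup>2)"
      by (simp add: E_def power_mult_distrib power2_eq_square mult_ac)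
    then have "real m ^ l * (b + 2) / (E / 2)\<^sup>2 = real m ^ l * (4 * (b + 2)) / (real m ^ l * ((real m * q\<^sup>2) ^ l * (cycle_mean p d l)\<^sup>2))"
      by (simp add: power_divide)
    also have "\<dots> = 4 * (b + 2) / ((real m * q\<^sup>2) ^ l * (cycle_mean p d l)\<^sup>2)"
      using lm(2) by (subst mult_divide_mult_cancel_left) auto
    finally show ?thesis .
  qed
  finally show ?thesis by (simp add: b_def)
qed

text \<open>Let \<open>y = m * q\<^sup>2\<close>. For triangles the squared mean is at least and
  \<open>B\<close> at most of order \<open>1 / d\<close>, so the bound is of order
  \<open>(y\<^sup>2 / d + 1) * d / y ^ 3\<close>. For \<open>d < D\<close> four-cycles have
  \<open>B = 1\<close> and a mean bounded below, which gives the order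
  \<open>y ^ 3 / y ^ 4\<close>.\<close>

lemma total_variation_ge_explicit:
  assumes p: "0 < p" "p < 1"
  obtains C where "0 < C" "\<And>n d m q. \<lbrakk>0 < q; q \<le> 1; 1 \<le> d; 4 * m \<le> n; 1 \<le> m; 1 \<le> real m * q\<^sup>2\<rbrakk> \<Longrightarrow>
    1 - total_variation (erdos_renyi n p) (noisy_rgg n p d q) \<le> C * (1 / (real m * q\<^sup>2) + real d / (real m * q\<^sup>2) ^ 3)"
proof -
  obtain \<kappa> D where \<kappa>: "0 < \<kappa>" and D: "\<And>d. D \<le> d \<Longrightarrow> \<kappa> / sqrt d \<le> triangle_mean p d"
    using triangle_mean_ge[OF p] by auto
  \<comment> \<open>Only finitely many dimensions are concerned, so strict positivity for each gives
    a uniform bound; the inserted 1 keeps the set nonempty.\<close>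
  define \<mu> where "\<mu> = Min (insert 1 ((\<lambda>d. (four_cycle_mean p d)\<^sup>2) ` {1..D}))"
  have \<mu>: "0 < \<mu>"
    unfolding \<mu>_def using four_cycle_mean_pos[OF _ p] by (subst Min_gr_iff) (auto simp: less_imp_neq[THEN not_sym])
  have \<mu>_le: "\<mu> \<le> (four_cycle_mean p d)\<^sup>2" if "1 \<le> d" "d < D" for d
    unfolding \<mu>_def using that by (intro Min_le) auto
  \<comment> \<open>24 is 2 * 3 * 4, from the rate at \<open>k = 1\<close>, the length 3 and
    \<open>(1 + y)\<^sup>2 \<le> 4 * y\<^sup>2\<close>; 136 is 4 * (4 * 8 + 2).\<close>
  define C where "C = 4 * (24 * edge_const p + 2) / \<kappa>\<^sup>2 + 136 / \<mu>"
  have ec: "0 < edge_const p" using edge_const_ge[OF p] by simp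
  have "0 < C" using \<kappa> \<mu> ec by (auto simp: C_def intro!: add_pos_pos divide_pos_pos)
  moreover have "1 - total_variation (erdos_renyi n p) (noisy_rgg n p d q) \<le> C * (1 / (real m * q\<^sup>2) + real d / (real m * q\<^sup>2) ^ 3)"
    if q: "0 < q" "q \<le> 1" and d: "1 \<le> d" and m: "4 * m \<le> n" "1 \<le> m" and y1: "1 \<le> real m * q\<^sup>2" for n d m q
  proof -
    define y where "y = real m * q\<^sup>2"
    have y: "1 \<le> y" using y1 by (simp add: y_def)
    show ?thesis
    proof (cases "d < D")
      case True
      have "1 - total_variation (erdos_renyi n p) (noisy_rgg n p d q) \<le> 4 * (1 * (real 4 * (1 + y) ^ (4 - 1)) + 2) / (y ^ 4 * (cycle_mean p d 4)\<^sup>2)"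
        unfolding y_def by (rule total_variation_ge[OF p q d _ m]) (use four_cycle_mean_pos[OF d p] in \<open>auto simp: cycle_mean_4[OF d p]\<close>)
      also have "\<dots> = 4 * (4 * (1 + y) ^ 3 + 2) / (y ^ 4 * (four_cycle_mean p d)\<^sup>2)" by (simp add: cycle_mean_4[OF d p])
      also have "\<dots> \<le> 4 * (4 * (8 * y ^ 3) + 2 * y ^ 3) / (y ^ 4 * \<mu>)"
      proof (intro frac_le mult_left_mono add_mono)
        have "(1 + y) ^ 3 \<le> (2 * y) ^ 3" using y by (intro power_mono) auto
        then show "(1 + y) ^ 3 \<le> 8 * y ^ 3" by (simp add: power_mult_distrib)
        show "2 \<le> 2 * y ^ 3" using y by simp
      qed (use y \<mu> \<mu>_le[OF d True] in auto)
      also have "\<dots> = 136 / \<mu> * (1 / y)" using y by (simp add: eval_nat_numeral)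
      also have "\<dots> \<le> C * (1 / y)" using y ec \<kappa> by (intro mult_right_mono) (auto simp: C_def)
      also have "\<dots> \<le> C * (1 / y + real d / y ^ 3)" using \<open>0 < C\<close> y by (intro mult_left_mono) auto
      finally show ?thesis by (simp add: y_def)
    next
      case False
      have k0: "0 < \<kappa> / sqrt d" using \<kappa> d by simp
      have tm: "\<kappa> / sqrt d \<le> triangle_mean p d" using D False by simp
      have "(\<kappa> / sqrt d)\<^sup>2 \<le> (triangle_mean p d)\<^sup>2" using tm k0 by (intro power_mono) auto
      then have tm2: "\<kappa>\<^sup>2 / d \<le> (triangle_mean p d)\<^sup>2" by (simp add: power_divide)
      have er: "edge_rate p d 1 \<le> 2 * edge_const p / d" using edge_rate_bounds(2)[of p d 1] by (simp add: mult.commute)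
      have "1 - total_variation (erdos_renyi n p) (noisy_rgg n p d q) \<le> 4 * (edge_rate p d 1 * (real 3 * (1 + y) ^ (3 - 1)) + 2) / (y ^ 3 * (cycle_mean p d 3)\<^sup>2)"
        unfolding y_def
        by (rule total_variation_ge[OF p q d _ _ m(2)]) (use m tm k0 edge_rate_bounds(3)[OF p] in \<open>auto simp: cycle_mean_3[OF p]\<close>)
      also have "\<dots> = 4 * (edge_rate p d 1 * (3 * (1 + y)\<^sup>2) + 2) / (y ^ 3 * (triangle_mean p d)\<^sup>2)" by (simp add: cycle_mean_3[OF p])
      also have "\<dots> \<le> 4 * (2 * edge_const p / d * (3 * (4 * y\<^sup>2)) + 2) / (y ^ 3 * (\<kappa>\<^sup>2 / d))"
      proof (intro frac_le mult_left_mono add_mono mult_mono)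
        have "(1 + y)\<^sup>2 \<le> (2 * y)\<^sup>2" using y by (intro power_mono) auto
        then show "(1 + y)\<^sup>2 \<le> 4 * y\<^sup>2" by (simp add: power_mult_distrib)
      qed (use y \<kappa> d er tm2 ec in auto)
      also have "\<dots> = 4 * (24 * edge_const p) / \<kappa>\<^sup>2 * (1 / y) + 4 * 2 / \<kappa>\<^sup>2 * (real d / y ^ 3)"
        using y d \<kappa> by (simp add: field_simps eval_nat_numeral)
      also have "\<dots> \<le> C * (1 / y) + C * (real d / y ^ 3)"
      proof (intro add_mono mult_right_mono)
        have "0 \<le> 136 / \<mu>" using \<mu> by simp
        moreover have "4 * (24 * edge_const p) / \<kappa>\<^sup>2 \<le> 4 * (24 * edge_const p + 2) / \<kappa>\<^sup>2" "4 * 2 / \<kappa>\<^sup>2 \<le> 4 * (24 * edge_const p + 2) / \<kappa>\<^sup>2"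
          using ec by (auto intro!: divide_right_mono)
        ultimately show "4 * (24 * edge_const p) / \<kappa>\<^sup>2 \<le> C" "4 * 2 / \<kappa>\<^sup>2 \<le> C" unfolding C_def by linarith+
      qed (use y in auto)
      also have "\<dots> = C * (1 / y + real d / y ^ 3)" by (simp add: algebra_simps)
      finally show ?thesis by (simp add: y_def)
    qed
  qed
  ultimately show thesis by (rule that)
qed

text \<open>\<open>X\<close> is the cube of \<open>n * q\<^sup>2\<close> divided by
  \<open>d\<close>. As \<open>d \<ge> 1\<close>, its divergence makes \<open>n * q\<^sup>2\<close>
  diverge too, so both \<open>1 / y\<close> and \<open>d / y ^ 3\<close> tend to 0.\<close>

lemma total_variation_tendsto_1:
  fixes d :: "nat \<Rightarrow> nat" and q :: "nat \<Rightarrow> real"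
  assumes p: "0 < p" "p < 1" and d: "\<And>n. d n \<ge> 1" and q: "\<And>n. 0 \<le> q n \<and> q n \<le> 1"
    and lim: "filterlim (\<lambda>n. real n ^ 3 * q n ^ 6 / real (d n)) at_top sequentially"
  shows "(\<lambda>n. total_variation (erdos_renyi n p) (noisy_rgg n p (d n) (q n))) \<longlonglongrightarrow> 1"
proof -
  define TV where "TV n = total_variation (erdos_renyi n p) (noisy_rgg n p (d n) (q n))" for n
  define X where "X n = real n ^ 3 * q n ^ 6 / real (d n)" for n
  have X: "filterlim X at_top sequentially" using lim by (simp add: X_def[abs_def])
  obtain C where C: "0 < C" and bound: "\<And>n d m q. \<lbrakk>0 < q; q \<le> 1; 1 \<le> d; 4 * m \<le> n; 1 \<le> m; 1 \<le> real m * q\<^sup>2\<rbrakk> \<Longrightarrow>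
    1 - total_variation (erdos_renyi n p) (noisy_rgg n p d q) \<le> C * (1 / (real m * q\<^sup>2) + real d / (real m * q\<^sup>2) ^ 3)"
    using total_variation_ge_explicit[OF p] by blast
  have TV1: "TV n \<le> 1" for n unfolding TV_def using total_variation_bounds(2)[OF p] q by simp
  have X3: "filterlim (\<lambda>n. root 3 (X n)) at_top sequentially"
    unfolding filterlim_at_top
  proof
    fix Z :: real
    have "\<forall>\<^sub>F n in sequentially. (max 0 Z) ^ 3 \<le> X n" using X by (simp add: filterlim_at_top)
    then show "\<forall>\<^sub>F n in sequentially. Z \<le> root 3 (X n)"
    proof eventually_elim
      case (elim n)
      then have "root 3 ((max 0 Z) ^ 3) \<le> root 3 (X n)" by simp
      then show ?case by (simp add: real_root_power_cancel)
    qed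
  qed
  have main: "\<forall>\<^sub>F n in sequentially. 1 - C * (8 / root 3 (X n) + 512 / X n) \<le> TV n"
    \<comment> \<open>512 is the cube of 8: since \<open>X n \<le> (8 * y) ^ 3\<close>, the bound
      \<open>X n > 512\<close> ensures \<open>y \<ge> 1\<close>.\<close>
    using filterlim_at_top_dense[THEN iffD1, OF X, rule_format, of 512] eventually_ge_at_top[of 8]
  proof eventually_elim
    case (elim n)
    \<comment> \<open>Three or four blocks of length \<open>n div 4\<close> fit into the vertex set;
      for \<open>n \<ge> 8\<close> at most a factor 8 is lost.\<close>
    define m where "m = n div 4"
    have m: "4 * m \<le> n" "1 \<le> m" "real n \<le> 8 * real m" using elim(2) by (auto simp: m_def)
    have dn: "1 \<le> real (d n)" using d[of n] by simp
    have q0: "0 < q n"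
    proof -
      have "q n \<noteq> 0" using elim(1) by (auto simp: X_def)
      then show ?thesis using q[of n] by simp
    qed
    define y where "y = real m * (q n)\<^sup>2"
    have y0: "0 < y" using q0 m by (simp add: y_def)
    have "real n * (q n)\<^sup>2 \<le> 8 * y" using mult_right_mono[OF m(3), of "(q n)\<^sup>2"] by (simp add: y_def)
    then have "(real n * (q n)\<^sup>2) ^ 3 \<le> (8 * y) ^ 3" by (intro power_mono) auto
    then have "real n ^ 3 * q n ^ 6 \<le> 512 * y ^ 3" by (simp add: power_mult_distrib flip: power_mult)
    then have Xd: "X n * real (d n) \<le> 512 * y ^ 3" using dn by (simp add: X_def)
    have Xpos: "0 < X n" using elim(1) by simp
    have "X n * 1 \<le> X n * real (d n)" using Xpos dn by (intro mult_left_mono) auto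
    then have Xy: "X n \<le> (8 * y) ^ 3" using Xd by (simp add: power_mult_distrib)
    have "1 ^ 3 \<le> y ^ 3" using Xy elim(1) by (simp add: power_mult_distrib)
    then have y1: "1 \<le> y" using y0 by (metis less_imp_le power_mono_iff zero_le_one zero_less_numeral)
    have "root 3 (X n) \<le> root 3 ((8 * y) ^ 3)" by (rule real_root_le_mono[OF zero_less_numeral Xy])
    moreover have "root 3 ((8 * y) ^ 3) = 8 * y" using y0 by (intro real_root_power_cancel) auto
    ultimately have r: "root 3 (X n) \<le> 8 * y" by linarith
    have "1 - TV n \<le> C * (1 / y + real (d n) / y ^ 3)"
      unfolding TV_def y_def by (rule bound) (use q0 q d m y1 in \<open>auto simp: y_def\<close>)
    also have "\<dots> \<le> C * (8 / root 3 (X n) + 512 / X n)"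
    proof (intro mult_left_mono add_mono)
      have "0 < root 3 (X n)" using Xpos by simp
      then show "1 / y \<le> 8 / root 3 (X n)" using r y0 by (simp add: field_simps)
      show "real (d n) / y ^ 3 \<le> 512 / X n" using Xd Xpos y0 by (simp add: field_simps)
    qed (use C in auto)
    finally show ?case by simp
  qed
  have "(\<lambda>n. 1 - C * (8 / root 3 (X n) + 512 / X n)) \<longlonglongrightarrow> 1 - C * (0 + 0)"
    by (intro tendsto_intros tendsto_divide_0[OF tendsto_const] filterlim_at_top_imp_at_infinity X X3)
  then have lower: "(\<lambda>n. 1 - C * (8 / root 3 (X n) + 512 / X n)) \<longlonglongrightarrow> 1" by simp
  have "TV \<longlonglongrightarrow> 1"
    by (rule tendsto_sandwich[OF main _ lower tendsto_const]) (use TV1 in auto)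
  then show ?thesis unfolding TV_def .
qed

theorem theorem5p1:
  fixes p :: real and d :: "nat \<Rightarrow> nat" and q :: "nat \<Rightarrow> real"
  assumes "0 < p" "p < 1"
    and "\<And>n. d n \<ge> 1"
    and "\<And>n. 0 \<le> q n \<and> q n \<le> 1"
  shows
    "(((\<lambda>n. real n * q n) \<longlonglongrightarrow> 0 \<or> (\<lambda>n. real n ^ 3 * q n ^ 2 / real (d n)) \<longlonglongrightarrow> 0) \<longrightarrow>
       (\<lambda>n. total_variation (erdos_renyi n p) (noisy_rgg n p (d n) (q n))) \<longlonglongrightarrow> 0) \<and>
     (filterlim (\<lambda>n. real n ^ 3 * q n ^ 6 / real (d n)) at_top sequentially \<longrightarrow>
       (\<lambda>n. total_variation (erdos_renyi n p) (noisy_rgg n p (d n) (q n))) \<longlonglongrightarrow> 1)"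
  using total_variation_tendsto_0[OF assms(1,2), of d q] total_variation_tendsto_1[OF assms(1,2), of d q] assms(3,4) by blast

end
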